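(* Let $D\in\{-3,-4,-7,-8,-11,-15,-19,-20,-24\}$. Then $c_{\mathfrak z_D}(\Delta,n)\neq0$ for every integer $n\ge0$ such that $n$ is even if $D=-4$ and $n$ is divisible by $3$ if $D=-3$ (for the other $D$, for every $n\ge 0$). That is, all non-trivial Fourier coefficients of $\Delta$ at $\mathfrak z_D$ are non-zero.
   Context: $\Delta(z)=q\prod_{n\ge1}(1-q^n)^{24}$, $q=e^{2\pi i z}$, the weight $12$ cusp form for $\mathrm{SL}(2,\mathbb Z)$. $\mathfrak z_D=\sqrt D/2$ if $D$ is even, $(1+\sqrt D)/2$ if $D$ is odd (so $\mathfrak z_{-4}=i$, $\mathfrak z_{-3}=(1+i\sqrt3)/2$). For $z_0=\alpha+i\beta\in\mathbb H$ put $\sigma_{z_0}=\frac{1}{2i\beta}\begin{pmatrix}-\overline{z_0}&z_0\\-1&1\end{pmatrix}$ and, for $\gamma=\begin{pmatrix}a&b\\c&d\end{pmatrix}$, $(f|_{12}\gamma)(z)=\det(\gamma)^{6}f(\gamma z)(cz+d)^{-12}$. The coefficients $c_{z_0}(\Delta,n)$ are defined by $(\Delta|_{12}\sigma_{z_0})(z)=\sum_{n\ge0}c_{z_0}(\Delta,n)z^n$ for $|z|<1$. (At $i$ the coefficients with $n$ odd, and at $\mathfrak z_{-3}$ those with $3\nmid n$, vanish automatically; these are called trivial.) *)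

theory Defs
  imports "HOL-Complex_Analysis.Complex_Analysis"
begin

definition Delta :: "complex \<Rightarrow> complex" where
  "Delta z = (let q = exp (2 * of_real pi * \<i> * z)
              in q * (\<Prod>n. (1 - q ^ Suc n) ^ 24))"

(* For D < 0 the principal root csqrt is \<i> * sqrt \<bar>D\<bar>. *)
definition cm_point :: "int \<Rightarrow> complex" where
  "cm_point D = (if even D then csqrt (of_int D) / 2 else (1 + csqrt (of_int D)) / 2)"

definition sigma_mat :: "complex \<Rightarrow> complex^2^2" where
  "sigma_mat z0 = (\<chi> i j. 1 / (2 * \<i> * of_real (Im z0)) *
                     (vector [vector [- cnj z0, z0], vector [- 1, 1]] :: complex^2^2) $ i $ j)"

definition slash12 :: "(complex \<Rightarrow> complex) \<Rightarrow> complex^2^2 \<Rightarrow> complex \<Rightarrow> complex" where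
  "slash12 f \<gamma> z = det \<gamma> ^ 6 *
     f ((\<gamma> $ 1 $ 1 * z + \<gamma> $ 1 $ 2) / (\<gamma> $ 2 $ 1 * z + \<gamma> $ 2 $ 2)) /
     (\<gamma> $ 2 $ 1 * z + \<gamma> $ 2 $ 2) ^ 12"

(* The definite description is justified for Delta by sums_fourier_coeff_Delta below. *)
definition fourier_coeff :: "complex \<Rightarrow> (complex \<Rightarrow> complex) \<Rightarrow> nat \<Rightarrow> complex" where
  "fourier_coeff z0 f =
     (THE c. \<forall>z. norm z < 1 \<longrightarrow> (\<lambda>n. c n * z ^ n) sums slash12 f (sigma_mat z0) z)"

lemma cm_point_check: "cm_point (-4) = \<i>" "cm_point (-3) = (1 + \<i> * of_real (sqrt 3)) / 2"
proof -
  have "csqrt (- of_real x) = \<i> * of_real (sqrt x)" if "x \<ge> 0" for x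
    using that csqrt_minus[of "of_real x"] by simp
  from this[of 4] this[of 3] show "cm_point (-4) = \<i>" "cm_point (-3) = (1 + \<i> * of_real (sqrt 3)) / 2"
    by (simp_all add: cm_point_def)
qed

lemma Delta_holomorphic: "Delta holomorphic_on {z. Im z > 0}"
proof -
  let ?P = "\<lambda>N q::complex. \<Prod>n<N. (1 - q ^ Suc n)"
  let ?E = "\<lambda>q::complex. \<Prod>n. (1 - q ^ Suc n)"
  have conv: "convergent_prod (\<lambda>n. 1 - q ^ Suc n)" if "norm q < 1" for q :: complex
  proof -
    have "summable (\<lambda>n. norm q * norm q ^ n)"
      using that by (intro summable_mult summable_geometric) auto
    hence "summable (\<lambda>n. norm ((1 - q ^ Suc n) - 1))"
      by (simp add: norm_mult norm_power)
    thus ?thesis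
      using abs_convergent_prod_conv_summable abs_convergent_prod_imp_convergent_prod by blast
  qed
  have unif: "uniform_limit (cball 0 r) ?P ?E sequentially" if r: "0 < r" "r < 1" for r :: real
  proof -
    have "uniformly_convergent_on (cball 0 r) (\<lambda>N x. \<Sum>n<N. norm (- ((x::complex) ^ Suc n)))"
    proof (rule uniformly_convergentI, rule Weierstrass_m_test_ev)
      show "\<forall>\<^sub>F n in sequentially. \<forall>x\<in>cball 0 r. norm (norm (- ((x::complex) ^ Suc n))) \<le> r * r ^ n"
        using r by (intro always_eventually allI ballI)
          (auto simp: norm_mult norm_power intro!: mult_mono power_mono)
      show "summable (\<lambda>n. r * r ^ n)"
        using r by (intro summable_mult summable_geometric) auto
    qed
    hence "uniformly_convergent_on (cball 0 r) (\<lambda>N x. \<Prod>n<N. 1 + - ((x::complex) ^ Suc n))"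
      by (intro uniformly_convergent_on_prod continuous_intros) auto
    then obtain g where g: "uniform_limit (cball 0 r) ?P g sequentially"
      by (auto simp: uniformly_convergent_on_def)
    have "g q = ?E q" if "q \<in> cball 0 r" for q
    proof (rule LIMSEQ_unique)
      show "(\<lambda>N. ?P N q) \<longlonglongrightarrow> g q"
        using tendsto_uniform_limitI[OF g that] .
      have "(\<lambda>n. \<Prod>i\<le>n. 1 - q ^ Suc i) \<longlonglongrightarrow> ?E q"
        using that r by (intro convergent_prod_LIMSEQ conv) auto
      thus "(\<lambda>N. ?P N q) \<longlonglongrightarrow> ?E q"
        by (simp add: LIMSEQ_lessThan_iff_atMost)
    qed
    with g show ?thesis
      by (metis (no_types, lifting) uniform_limit_cong')
  qed
  have hol: "?E holomorphic_on ball 0 1"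
  proof (rule holomorphic_uniform_sequence)
    show "?P n holomorphic_on ball 0 1" for n
      by (intro holomorphic_intros)
    fix x :: complex assume x: "x \<in> ball 0 1"
    define d where "d = (1 - norm x) / 2"
    have "cball x d \<subseteq> cball 0 ((1 + norm x) / 2)"
    proof
      fix y assume "y \<in> cball x d"
      moreover have "norm y \<le> norm x + dist x y"
        by (metis dist_commute dist_norm norm_triangle_sub)
      ultimately show "y \<in> cball 0 ((1 + norm x) / 2)"
        by (simp add: d_def field_simps)
    qed
    moreover have "0 < (1 + norm x) / 2"
      by (simp add: add_pos_nonneg)
    ultimately have "uniform_limit (cball x d) ?P ?E sequentially"
      using x by (intro uniform_limit_on_subset[OF unif[of "(1 + norm x) / 2"]]) auto
    moreover have "cball x d \<subseteq> ball 0 1"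
      using \<open>cball x d \<subseteq> cball 0 ((1 + norm x) / 2)\<close> x by force
    ultimately show "\<exists>d>0. cball x d \<subseteq> ball 0 1 \<and> uniform_limit (cball x d) ?P ?E sequentially"
      using x by (intro exI[of _ d]) (auto simp: d_def)
  qed auto
  have pw: "(\<Prod>n. (1 - q ^ Suc n) ^ 24) = ?E q ^ 24" if "norm q < 1" for q
    using convergent_prod_has_prod[OF conv[OF that], THEN has_prod_power, of 24]
    by (metis has_prod_unique)
  have nq: "norm (exp (2 * of_real pi * \<i> * z)) < 1" if "Im z > 0" for z
    using that by simp
  have "(\<lambda>z. exp (2 * of_real pi * \<i> * z) * ?E (exp (2 * of_real pi * \<i> * z)) ^ 24)
          holomorphic_on {z. Im z > 0}"
    using nq by (intro holomorphic_intros holomorphic_on_compose_gen[OF _ hol, unfolded o_def]) auto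
  thus ?thesis
    by (rule holomorphic_transform) (use pw nq in \<open>simp add: Delta_def Let_def\<close>)
qed

lemma sums_fourier_coeff_Delta:
  assumes z0: "Im z0 > 0" and z: "norm z < 1"
  shows "(\<lambda>n. fourier_coeff z0 Delta n * z ^ n) sums slash12 Delta (sigma_mat z0) z"
proof -
  let ?F = "slash12 Delta (sigma_mat z0)"
  let ?P = "\<lambda>c. \<forall>z. norm z < 1 \<longrightarrow> (\<lambda>n. c n * z ^ n) sums ?F z"
  define s where "s = 1 / (2 * \<i> * complex_of_real (Im z0))"
  have s0: "s \<noteq> 0" using z0 by (auto simp: s_def)
  have eq: "?F = (\<lambda>z. det (sigma_mat z0) ^ 6 * Delta ((z0 - cnj z0 * z) / (1 - z)) / (s * (1 - z)) ^ 12)"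
  proof
    fix z
    have "(s * - cnj z0 * z + s * z0) / (s * - 1 * z + s * 1) = (s * (z0 - cnj z0 * z)) / (s * (1 - z))"
      by (simp add: algebra_simps)
    also have "\<dots> = (z0 - cnj z0 * z) / (1 - z)"
      using s0 by simp
    finally have "(s * - cnj z0 * z + s * z0) / (s * - 1 * z + s * 1) = (z0 - cnj z0 * z) / (1 - z)" .
    moreover have "s * - 1 * z + s * 1 = s * (1 - z)"
      by (simp add: algebra_simps)
    ultimately show "?F z = det (sigma_mat z0) ^ 6 * Delta ((z0 - cnj z0 * z) / (1 - z)) / (s * (1 - z)) ^ 12"
      by (simp add: slash12_def sigma_mat_def s_def [symmetric])
  qed
  have im: "Im ((z0 - cnj z0 * w) / (1 - w)) > 0" if "norm w < 1" for w
  proof -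
    have w1: "w \<noteq> 1" using that by auto
    have "Im ((z0 - cnj z0 * w) * cnj (1 - w)) = Im z0 * (1 - (Re w ^ 2 + Im w ^ 2))"
      by (simp add: algebra_simps power2_eq_square)
    moreover have "Re w ^ 2 + Im w ^ 2 < 1"
      using that by (simp add: cmod_def)
    ultimately have "Im ((z0 - cnj z0 * w) * cnj (1 - w)) > 0"
      using z0 by simp
    thus ?thesis
      using w1 by (subst complex_div_cnj)
        (simp add: Im_divide_of_real zero_less_divide_iff del: of_real_power flip: of_real_power)
  qed
  have ball: "1 - w \<noteq> 0" if "w \<in> ball 0 1" for w :: complex
    using that by auto
  have "?F holomorphic_on ball 0 1"
    unfolding eq using s0 im ball
    by (intro holomorphic_intros holomorphic_on_compose_gen[OF _ Delta_holomorphic, unfolded o_def]) auto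
  hence ex: "?P (\<lambda>n. (deriv ^^ n) ?F 0 / fact n)"
    using holomorphic_power_series[of ?F 0 1] by auto
  have uniq: "c = d" if "?P c" "?P d" for c d
  proof -
    have "(\<lambda>n. (c n - d n) * w ^ n) sums 0" if "norm w < 1" for w
      using sums_diff[of _ "?F w" _ "?F w"] that \<open>?P c\<close> \<open>?P d\<close>
      by (fastforce simp: algebra_simps)
    note sums0 = this
    have "c n - d n = 0" for n
    proof (rule ccontr)
      assume n: "c n - d n \<noteq> 0"
      have "n > 0"
        using sums0[of 0] n powser_sums_zero_iff[of "\<lambda>n. c n - d n" 0] by (cases n) auto
      then obtain r where "0 < r" "\<And>z::complex. z \<in> cball 0 r - {0} \<Longrightarrow> (0::complex) \<noteq> 0"
        using powser_0_nonzero[of 1 0 "\<lambda>n. c n - d n" "\<lambda>_. 0" n] sums0 n by auto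
      from this(2)[of "of_real r"] this(1) show False by simp
    qed
    thus ?thesis by auto
  qed
  have "?P (fourier_coeff z0 Delta)"
    unfolding fourier_coeff_def using ex uniq[OF _ ex] by (rule theI[of ?P])
  thus ?thesis using z by blast
qed

end

theory Submission
  imports Defs
begin

text \<open>
  Let \<open>\<tau>\<close> be the point in question. Up to a non-zero constant the Taylor coefficients of \<open>\<Delta>\<close> at \<open>\<tau>\<close>
  are values \<open>F\<^sub>n / n!\<close>, where \<open>F\<^sub>0 = 1\<close> and \<open>F\<^sub>n\<close> is a universal polynomial with integer coefficients in
  \<open>y = E\<^sub>2\<^sup>*/12\<close>, \<open>a = E\<^sub>4/144\<close>, \<open>b = E\<^sub>6/432\<close> at \<open>\<tau>\<close>: Ramanujan's equations \<open>y' = y\<^sup>2 - a\<close>,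
  \<open>a' = 4ya - b\<close>, \<open>b' = 6yb - 24a\<^sup>2\<close>, \<open>\<Delta>' = 12y\<Delta>\<close> keep their shape in the disc coordinate.

  Multiplication by \<open>\<tau>\<close> maps the lattice spanned by \<open>1\<close> and \<open>\<tau>\<close> into itself. Comparing Laurent coefficients of
  \<open>\<Sum>\<^sub>v \<wp>(z + v)\<close> (\<open>v\<close> in the kernel) and \<open>\<tau>\<^sup>2 \<wp>(\<tau>z)\<close> gives the power sums of the values of \<open>\<wp>\<close> on the kernel,
  and hence determines \<open>(y, a, b)\<close> up to the scaling \<open>(\<kappa>y, \<kappa>\<^sup>2a, \<kappa>\<^sup>3b)\<close> and Galois conjugation; after scaling the
  triple consists of algebraic integers of degree at most two.

  Modulo a prime \<open>p\<close> the \<open>p\<close>-th iterate of a derivation is a derivation. So if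
  \<open>X\<^sub>p \<equiv> c X\<^sub>1\<close> holds for the jets of \<open>y\<close>, \<open>a\<close>, \<open>b\<close>, \<open>F\<close>, then \<open>F\<^sub>n\<^sub>+\<^sub>p \<equiv> c F\<^sub>n\<^sub>+\<^sub>1\<close> for all \<open>n\<close>, and
  it suffices to see that \<open>F\<^sub>1, \<dots>, F\<^sub>p\<^sub>-\<^sub>1\<close> do not vanish modulo \<open>p\<close> for one suitable \<open>p\<close>.
\<close>

section \<open>Lambert series\<close>

text \<open>Everything analytic rests on one function, \<open>qzeta\<close>: a Weierstrass zeta
  function written as a Lambert series in exp z, with period 2 pi i and increment -1 along 2 pi i
  \<tau>. A combination in which the increments cancel is elliptic, and if its polar parts cancel as
  well it is constant by Liouville. Ramanujan's equations, the differential equations of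
  \<open>wp\<close>, the translation formula for half periods and the sum over the kernel all arise
  in this way, so modularity of the Eisenstein series never enters: the change to the disc
  coordinate is checked on the differential equations alone. Two ambiguities shape the arithmetic
  half. The kernel equations are satisfied by all conjugates of the wanted solution, and sometimes
  by a spurious one; a spurious root is removed by a further power sum, while s stays an arbitrary
  square root of d. Accordingly the test modulo p is made on norms of pairs of integers: it is blind
  to the choice of s, it is multiplicative, and it still makes sense for s = 0, which serves the
  discriminants of class number one.\<close>

definition lambert :: "complex \<Rightarrow> (nat \<Rightarrow> complex) \<Rightarrow> (complex \<Rightarrow> complex) \<Rightarrow> complex \<Rightarrow> complex" where
  "lambert q c h x = (\<Sum>n. c n * h (q ^ n * x))"

definition lambert_dom :: "complex \<Rightarrow> complex set" where
  "lambert_dom q = {x. \<forall>n. q ^ n * x \<noteq> 1}"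

text \<open>The linear bound on \<open>h\<close> near 0 makes the tail behave like a geometric
  series in q. There is room for coefficients of size n, which is the price of one differentiation
  in q.\<close>

locale lambert_series =
  fixes q :: complex and c :: "nat \<Rightarrow> complex" and h :: "complex \<Rightarrow> complex" and C :: real
  assumes q: "norm q < 1"
    and h_holo: "h holomorphic_on - {1}"
    and h_bound: "norm x \<le> 1/2 \<Longrightarrow> norm (h x) \<le> C * norm x"
    and c_bound: "norm (c n) \<le> real n + 1"
begin

lemma C_nonneg: "C \<ge> 0"
proof -
  have "0 \<le> C * norm (1/2 :: complex)"
    by (rule order_trans[OF norm_ge_zero h_bound]) simp
  thus ?thesis by simp
qed

lemma eventually_small: "\<exists>N. \<forall>n\<ge>N. \<forall>x. norm x < R \<longrightarrow> norm (q ^ n * x) \<le> 1/2"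
proof -
  have "(\<lambda>n. norm q ^ n * R) \<longlonglongrightarrow> 0 * R"
    using q by (intro tendsto_intros) auto
  hence "eventually (\<lambda>n. norm q ^ n * R < 1/2) sequentially"
    by (intro order_tendstoD) auto
  then obtain N where N: "\<And>n. n \<ge> N \<Longrightarrow> norm q ^ n * R < 1/2" by (auto simp: eventually_at_top_linorder)
  have "norm (q ^ n * x) \<le> 1/2" if "n \<ge> N" "norm x < R" for n x
  proof -
    have "norm (q ^ n * x) \<le> norm q ^ n * R"
      unfolding norm_mult norm_power using that by (intro mult_left_mono) auto
    thus ?thesis using N[OF that(1)] by simp
  qed
  thus ?thesis by blast
qed

text \<open>Infinitely many points are excluded from \<open>lambert_dom\<close>, but they move off
  to infinity: inside a ball q^n x is small for large n, so only finitely many conditions are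
  active.\<close>

lemma open_dom: "open (lambert_dom q \<inter> ball 0 R)"
proof -
  obtain N where N: "\<And>n x. n \<ge> N \<Longrightarrow> norm x < R \<Longrightarrow> norm (q ^ n * x) \<le> 1/2"
    using eventually_small by blast
  have "q ^ n * x \<noteq> 1" if "n \<ge> N" "norm x < R" for n x
    using N[OF that] by auto
  hence "lambert_dom q \<inter> ball 0 R = ball 0 R \<inter> (\<Inter>n<N. {x. q ^ n * x \<noteq> 1})"
    unfolding lambert_dom_def by (auto simp: not_less) (metis lessThan_iff not_less)
  moreover have "open {x. q ^ n * x \<noteq> 1}" for n
    by (intro open_Collect_neq continuous_intros)
  ultimately show ?thesis by (auto intro!: open_Int open_INT)
qed

lemma open_lambert_dom: "open (lambert_dom q)"
proof -
  have "lambert_dom q = (\<Union>R. lambert_dom q \<inter> ball 0 R)"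
    by (auto intro: gt_ex)
  thus ?thesis using open_dom by (metis open_UN)
qed

lemma term_holo: "(\<lambda>x. c n * h (q ^ n * x)) holomorphic_on lambert_dom q"
  by (intro holomorphic_intros holomorphic_on_compose_gen[OF _ h_holo, unfolded o_def])
     (auto simp: lambert_dom_def)

lemma uniform_limit_lambert:
  "uniform_limit (lambert_dom q \<inter> ball 0 R) (\<lambda>N x. \<Sum>n<N. c n * h (q ^ n * x)) (lambert q c h) sequentially"
proof (cases "R > 0")
  case True
  obtain N where N: "\<And>n x. n \<ge> N \<Longrightarrow> norm x < R \<Longrightarrow> norm (q ^ n * x) \<le> 1/2"
    using eventually_small by blast
  have "summable (\<lambda>n. (real n + 1) * norm q ^ n)"
    using q sums_summable[OF geometric_deriv_sums[of "norm q"]] by (simp add: add.commute)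
  hence "summable (\<lambda>n. C * R * ((real n + 1) * norm q ^ n))" by (intro summable_mult)
  moreover have "norm (c n * h (q ^ n * x)) \<le> C * R * ((real n + 1) * norm q ^ n)"
    if "n \<ge> N" "x \<in> lambert_dom q \<inter> ball 0 R" for n x
  proof -
    have "norm (h (q ^ n * x)) \<le> C * norm (q ^ n * x)" using that by (intro h_bound N) auto
    also have "\<dots> \<le> C * (norm q ^ n * R)"
      unfolding norm_mult norm_power using that C_nonneg by (intro mult_left_mono) auto
    finally have "norm (c n) * norm (h (q ^ n * x)) \<le> (real n + 1) * (C * (norm q ^ n * R))"
      using c_bound by (intro mult_mono) auto
    thus ?thesis by (simp add: norm_mult mult_ac)
  qed
  ultimately show ?thesis unfolding lambert_def
    by (intro Weierstrass_m_test_ev[where M = "\<lambda>n. C * R * ((real n + 1) * norm q ^ n)"])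
       (unfold eventually_at_top_linorder, blast+)
qed (simp add: uniform_limit_iff ball_empty not_less)

lemma lambert_sums: "x \<in> lambert_dom q \<Longrightarrow> (\<lambda>n. c n * h (q ^ n * x)) sums lambert q c h x"
  using tendsto_uniform_limitI[OF uniform_limit_lambert, of x "norm x + 1"]
  by (simp add: sums_def)

lemma lambert_holo: "lambert q c h holomorphic_on lambert_dom q"
proof (rule holomorphic_uniform_sequence[OF open_lambert_dom, where f = "\<lambda>N x. \<Sum>n<N. c n * h (q ^ n * x)"])
  fix x assume x: "x \<in> lambert_dom q"
  define R where "R = norm x + 1"
  have "open (lambert_dom q \<inter> ball 0 R)" "x \<in> lambert_dom q \<inter> ball 0 R"
    using x open_dom by (auto simp: R_def)
  then obtain d where d: "d > 0" "cball x d \<subseteq> lambert_dom q \<inter> ball 0 R"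
    using open_contains_cball by blast
  thus "\<exists>d>0. cball x d \<subseteq> lambert_dom q \<and>
      uniform_limit (cball x d) (\<lambda>N x. \<Sum>n<N. c n * h (q ^ n * x)) (lambert q c h) sequentially"
    using uniform_limit_on_subset[OF uniform_limit_lambert d(2)] by blast
next
  show "(\<lambda>x. \<Sum>n<N. c n * h (q ^ n * x)) holomorphic_on lambert_dom q" for N
    by (intro holomorphic_on_sum term_holo)
qed

lemma lambert_deriv_sums:
  assumes x: "x \<in> lambert_dom q"
  shows "(\<lambda>n. c n * q ^ n * deriv h (q ^ n * x)) sums deriv (lambert q c h) x"
proof -
  define R where "R = norm x + 1"
  have "(\<lambda>N. deriv (\<lambda>x. \<Sum>n<N. c n * h (q ^ n * x)) x) \<longlonglongrightarrow> deriv (lambert q c h) x"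
    by (rule deriv_complex_uniform_limit[OF uniform_limit_lambert[of R]])
       (use x open_dom in \<open>auto intro!: always_eventually holomorphic_on_sum holomorphic_on_subset[OF term_holo] simp: R_def\<close>)
  moreover have "deriv (\<lambda>x. \<Sum>n<N. c n * h (q ^ n * x)) x = (\<Sum>n<N. c n * q ^ n * deriv h (q ^ n * x))" for N
  proof (rule DERIV_imp_deriv)
    have "((\<lambda>x. h (q ^ n * x)) has_field_derivative deriv h (q ^ n * x) * q ^ n) (at x)" for n
    proof (rule DERIV_chain2[where f = h and g = "\<lambda>x. q ^ n * x"])
      show "(h has_field_derivative deriv h (q ^ n * x)) (at (q ^ n * x))"
        using x by (intro holomorphic_derivI[OF h_holo]) (auto simp: lambert_dom_def)
    qed (auto intro!: derivative_eq_intros)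
    thus "((\<lambda>x. \<Sum>n<N. c n * h (q ^ n * x)) has_field_derivative (\<Sum>n<N. c n * q ^ n * deriv h (q ^ n * x))) (at x)"
      by (auto intro!: derivative_eq_intros sum.cong simp: mult_ac)
  qed
  ultimately show ?thesis by (simp add: sums_def)
qed

end

lemma lambert_dom_mult: "x \<in> lambert_dom q \<Longrightarrow> q * x \<in> lambert_dom q"
  unfolding lambert_dom_def by (auto simp: mult.assoc[symmetric] simp flip: power_Suc2) (metis power_Suc)

text \<open>Source of quasi-periodicity: x -> q x drops the term n = 0, and for x = exp z it is
  translation by 2 pi i \<tau>.\<close>

lemma lambert_shift:
  assumes "lambert_series q (\<lambda>_. 1) h C" "x \<in> lambert_dom q"
  shows "lambert q (\<lambda>_. 1) h (q * x) = lambert q (\<lambda>_. 1) h x - h x"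
proof -
  interpret lambert_series q "\<lambda>_. 1" h C by fact
  have "(\<lambda>n. h (q ^ Suc n * x)) sums (lambert q (\<lambda>_. 1) h x - h x)"
    using lambert_sums[OF assms(2)] by (subst sums_Suc_iff) simp
  moreover have "(\<lambda>n. h (q ^ Suc n * x)) sums lambert q (\<lambda>_. 1) h (q * x)"
    using lambert_sums[OF lambert_dom_mult[OF assms(2)]] by (simp add: mult_ac)
  ultimately show ?thesis by (rule sums_unique2[symmetric])
qed

lemma lambert_shift_nat:
  assumes "lambert_series q (\<lambda>_. 1) h C" "lambert_series q of_nat h C" "x \<in> lambert_dom q"
  shows "lambert q of_nat h (q * x) = lambert q of_nat h x - lambert q (\<lambda>_. 1) h (q * x)"
proof -
  interpret A: lambert_series q "\<lambda>_. 1" h C by fact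
  interpret B: lambert_series q of_nat h C by fact
  have "(\<lambda>n. of_nat (Suc n) * h (q ^ Suc n * x)) sums lambert q of_nat h x"
    using B.lambert_sums[OF assms(3)] by (subst sums_Suc_iff) simp
  moreover have "(\<lambda>n. of_nat n * h (q ^ Suc n * x) + h (q ^ Suc n * x)) sums
      (lambert q of_nat h (q * x) + lambert q (\<lambda>_. 1) h (q * x))"
    using sums_add[OF B.lambert_sums[of "q * x"] A.lambert_sums[of "q * x"]] lambert_dom_mult[OF assms(3)]
    by (simp add: mult_ac)
  ultimately show ?thesis by (simp add: ring_distribs add.commute sums_unique2 eq_diff_eq)
qed

section \<open>The kernel x/(1-x) and its Euler derivative x/(1-x)^2\<close>

definition geom1 :: "complex \<Rightarrow> complex" where "geom1 x = x / (1 - x)"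
definition geom2 :: "complex \<Rightarrow> complex" where "geom2 x = x / (1 - x) ^ 2"

lemma norm_one_minus_ge: "norm x \<le> 1/2 \<Longrightarrow> norm (1 - x :: complex) \<ge> 1/2"
  using norm_triangle_ineq2[of 1 x] by simp

lemma lambert_geom1: "norm q < 1 \<Longrightarrow> (\<And>n. norm (c n) \<le> real n + 1) \<Longrightarrow> lambert_series q c geom1 4"
  unfolding lambert_series_def geom1_def
proof (intro conjI allI impI)
  fix x :: complex assume x: "norm x \<le> 1/2"
  have "norm x / norm (1 - x) \<le> norm x / (1/2)"
    using norm_one_minus_ge[OF x] by (intro divide_left_mono) auto
  thus "norm (x / (1 - x)) \<le> 4 * norm x"
    using norm_ge_zero[of x] by (simp add: norm_divide del: norm_ge_zero)
qed (auto intro!: holomorphic_intros)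

lemma lambert_geom2: "norm q < 1 \<Longrightarrow> (\<And>n. norm (c n) \<le> real n + 1) \<Longrightarrow> lambert_series q c geom2 4"
  unfolding lambert_series_def geom2_def
proof (intro conjI allI impI)
  fix x :: complex assume x: "norm x \<le> 1/2"
  have "(1/2) ^ 2 \<le> norm (1 - x) ^ 2"
    using norm_one_minus_ge[OF x] by (intro power_mono) auto
  hence "norm x / norm (1 - x) ^ 2 \<le> norm x / (1/2) ^ 2"
    using norm_one_minus_ge[OF x] by (intro divide_left_mono) (auto intro!: mult_pos_pos zero_less_power)
  thus "norm (x / (1 - x) ^ 2) \<le> 4 * norm x" by (simp add: norm_divide norm_power) (simp add: power2_eq_square)
qed (auto intro!: holomorphic_intros)

lemma deriv_geom1: "x \<noteq> 1 \<Longrightarrow> x * deriv geom1 x = geom2 x"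
proof -
  assume "x \<noteq> 1"
  hence "(geom1 has_field_derivative (1 / (1 - x) ^ 2)) (at x)"
    unfolding geom1_def by (auto intro!: derivative_eq_intros simp: field_simps power2_eq_square)
  thus ?thesis by (simp add: DERIV_imp_deriv geom2_def)
qed

lemma geom2_inverse: "x \<noteq> 0 \<Longrightarrow> geom2 (1 / x) = geom2 x"
  by (cases "x = 1") (auto simp: geom2_def field_simps power2_eq_square)

lemma geom1_inverse: "x \<noteq> 0 \<Longrightarrow> x \<noteq> 1 \<Longrightarrow> geom1 (1 / x) = - 1 - geom1 x"
  by (auto simp: geom1_def field_simps)

section \<open>Divisor sums and their Taylor coefficients\<close>

lemma dirichlet_double_sum:
  fixes f :: "nat \<Rightarrow> nat \<Rightarrow> complex"
  assumes bound: "\<And>n d. norm (f (Suc n) (Suc d)) \<le> a n * b d"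
    and a: "summable a" "\<And>n. a n \<ge> 0" and b: "summable b" "\<And>n. b n \<ge> 0"
    and inner: "\<And>n. (\<lambda>d. f (Suc n) (Suc d)) sums g n"
  shows "summable g" "(\<lambda>m. \<Sum>d | d dvd Suc m. f (Suc m div d) d) sums suminf g"
proof -
  define h where "h = (\<lambda>(n, d). f (Suc n) (Suc d))"
  have b': "(b has_sum suminf b) UNIV"
    using b by (intro norm_summable_imp_has_sum) (auto simp: summable_sums)
  have "a summable_on UNIV"
    using a by (intro norm_summable_imp_summable_on) auto
  hence "(\<lambda>x. (case x of (n, d) \<Rightarrow> a n * b d)) summable_on UNIV \<times> UNIV"
    using b' a b by (intro summable_on_SigmaI[where g = "\<lambda>n. a n * suminf b"])
      (auto intro!: has_sum_cmult_right summable_on_cmult_left)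
  hence "(\<lambda>x. norm (h x)) summable_on UNIV \<times> UNIV"
    by (rule summable_on_comparison_test) (use bound in \<open>auto simp: h_def\<close>)
  hence "h summable_on UNIV \<times> UNIV" by (rule abs_summable_summable)
  then obtain S where S: "(h has_sum S) (UNIV \<times> UNIV)" by (auto simp: summable_on_def)
  have "((\<lambda>d. h (n, d)) has_sum g n) UNIV" for n
  proof -
    have "summable (\<lambda>d. a n * b d)" using b(1) by (intro summable_mult)
    hence "summable (\<lambda>d. norm (h (n, d)))"
      by (rule summable_comparison_test'[where N = 0]) (simp add: h_def bound)
    thus ?thesis using inner[of n] by (intro norm_summable_imp_has_sum) (auto simp: h_def)
  qed
  from has_sum_SigmaD[OF S this] have "(g has_sum S) UNIV" by simp
  hence g: "g sums S" by (rule has_sum_imp_sums)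
  thus "summable g" by (rule sums_summable)
  define h' where "h' = (\<lambda>(m, d). f (Suc m div d) d)"
  \<comment> \<open>Absolute summability permits regrouping by the product: the pair (n+1, d+1) is
    traded for m+1 = (n+1)(d+1) together with its divisor d+1.\<close>
  have "(h has_sum S) (UNIV \<times> UNIV) \<longleftrightarrow> (h' has_sum S) (SIGMA m:UNIV. {d. d dvd Suc m})"
  proof (rule has_sum_reindex_bij_witness[where i = "\<lambda>(m, d). (Suc m div d - 1, d - 1)"
        and j = "\<lambda>(n, d). (Suc n * Suc d - 1, Suc d)"])
    fix x assume "x \<in> (SIGMA m:UNIV. {d::nat. d dvd Suc m})"
    then obtain m d where x: "x = (m, d)" "d dvd Suc m" by auto
    then obtain k where k: "Suc m = d * k" by (elim dvdE)
    hence "d > 0" "k > 0" by (auto intro: Nat.gr0I)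
    then obtain d' k' where dk: "d = Suc d'" "k = Suc k'" by (metis Suc_pred)
    have "Suc m div d = Suc k'" unfolding k dk by (rule nonzero_mult_div_cancel_left) simp
    moreover have "Suc k' * Suc d' - 1 = m" using k unfolding dk by (simp add: mult.commute)
    ultimately show "(case case x of (m, d) \<Rightarrow> (Suc m div d - 1, d - 1) of (n, d) \<Rightarrow> (Suc n * Suc d - 1, Suc d)) = x"
      by (simp add: x dk)
  qed (auto simp: h_def h'_def simp del: mult_Suc mult_Suc_right)
  with S have "(h' has_sum S) (SIGMA m:UNIV. {d. d dvd Suc m})" by simp
  hence "((\<lambda>m. \<Sum>d | d dvd Suc m. f (Suc m div d) d) has_sum S) UNIV"
    by (rule has_sum_SigmaD) (auto simp: h'_def intro!: has_sum_finite)
  hence "(\<lambda>m. \<Sum>d | d dvd Suc m. f (Suc m div d) d) sums S" by (rule has_sum_imp_sums)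
  thus "(\<lambda>m. \<Sum>d | d dvd Suc m. f (Suc m div d) d) sums suminf g" using g by (simp add: sums_iff)
qed

lemma summable_Suc_sq_power:
  fixes r :: real
  assumes "0 \<le> r" "r < 1"
  shows "summable (\<lambda>n. (real n + 1) ^ 2 * r ^ n)"
proof -
  have "summable (\<lambda>n. diffs (\<lambda>_. 1) n * x ^ n)" if "norm x < 1" for x :: real
    using that by (intro termdiff_converges[where K = 1]) (auto intro: summable_geometric)
  hence "summable (\<lambda>n. diffs (diffs (\<lambda>_. 1)) n * r ^ n)"
    using assms by (intro termdiff_converges[where K = 1]) auto
  moreover have "norm ((real n + 1) ^ 2 * r ^ n) \<le> diffs (diffs (\<lambda>_. 1)) n * r ^ n" for n
    using assms by (auto simp: diffs_def power2_eq_square algebra_simps intro!: mult_right_mono)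
  ultimately show ?thesis by (rule summable_comparison_test'[where N = 0])
qed

text \<open>The weight \<open>b\<close> will be 1 for the zeta function and m for its derivative
  under q d/dq. Only positive arguments of \<open>b\<close> occur.\<close>

definition divisor_series :: "complex \<Rightarrow> (nat \<Rightarrow> complex) \<Rightarrow> complex \<Rightarrow> complex" where
  "divisor_series q b z = (\<Sum>m. b (Suc m) * q ^ Suc m *
     (\<Sum>d | d dvd Suc m. exp (of_nat d * z) - exp (- of_nat d * z)))"

definition divisor_coeff :: "complex \<Rightarrow> (nat \<Rightarrow> complex) \<Rightarrow> nat \<Rightarrow> complex" where
  "divisor_coeff q b k = (1 - (-1) ^ k) / fact k *
     (\<Sum>m. b (Suc m) * q ^ Suc m * of_nat (\<Sum>d | d dvd Suc m. d ^ k))"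

text \<open>The m-th term of the divisor series contains exp(d z) for d up to m, so convergence is
  available only where |q| exp |z| < 1.\<close>

lemma ex_exp_radius:
  assumes "norm (q :: complex) < 1"
  shows "\<exists>r>0. norm q * exp r < 1"
proof -
  have "((\<lambda>r. norm q * exp r) \<longlongrightarrow> norm q * exp 0) (at_right (0::real))"
    by (intro tendsto_intros) 
  hence "eventually (\<lambda>r. norm q * exp r < 1) (at_right 0)"
    by (rule order_tendstoD) (use assms in auto)
  moreover have "eventually (\<lambda>r::real. r > 0) (at_right 0)" by (rule eventually_at_right_less)
  ultimately have "eventually (\<lambda>r. r > 0 \<and> norm q * exp r < 1) (at_right 0)" by eventually_elim auto
  thus ?thesis using eventually_happens trivial_limit_at_right_real by (metis (mono_tags, lifting))
qed

lemma divisor_series_uniform_limit: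
  assumes r: "norm q * exp r < 1" and b: "\<And>m. norm (b (Suc m)) \<le> real (Suc m)"
  shows "uniform_limit (ball 0 r) (\<lambda>N z. \<Sum>m<N. b (Suc m) * q ^ Suc m *
     (\<Sum>d | d dvd Suc m. exp (of_nat d * z) - exp (- of_nat d * z))) (divisor_series q b) sequentially"
  unfolding divisor_series_def
proof (rule Weierstrass_m_test)
  let ?\<rho> = "norm q * exp r"
  \<comment> \<open>One factor m + 1 bounds \<open>b\<close>, the other the number of
    divisors.\<close>
  show "summable (\<lambda>m. 2 * ?\<rho> * ((real m + 1) ^ 2 * ?\<rho> ^ m))"
    using r by (intro summable_mult summable_Suc_sq_power) auto
  fix m and z :: complex assume z: "z \<in> ball 0 r"
  have "norm (exp (of_nat d * z) - exp (- of_nat d * z)) \<le> 2 * exp (real (Suc m) * r)" if "d dvd Suc m" for d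
  proof -
    have "real d * norm z \<le> real (Suc m) * r" using that z by (intro mult_mono) (auto dest: dvd_imp_le)
    hence "norm (exp (of_nat d * z)) \<le> exp (real (Suc m) * r)" "norm (exp (- of_nat d * z)) \<le> exp (real (Suc m) * r)"
      using norm_exp[of "of_nat d * z"] norm_exp[of "- of_nat d * z"]
      by (auto simp: norm_mult intro: order_trans)
    thus ?thesis
      using norm_triangle_ineq4[of "exp (of_nat d * z)" "exp (- of_nat d * z)"] by linarith
  qed
  hence "norm (\<Sum>d | d dvd Suc m. exp (of_nat d * z) - exp (- of_nat d * z)) \<le>
      real (card {d. d dvd Suc m}) * (2 * exp (real (Suc m) * r))"
    by (intro sum_norm_bound) auto
  also have "\<dots> \<le> real (Suc m) * (2 * exp (real (Suc m) * r))"
  proof -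
    have "{d. d dvd Suc m} \<subseteq> {1..Suc m}" by (auto dest: dvd_imp_le intro!: Suc_leI Nat.gr0I)
    hence "card {d. d dvd Suc m} \<le> Suc m" using card_mono[of "{1..Suc m}"] by simp
    thus ?thesis by (intro mult_right_mono) (auto simp del: of_nat_Suc)
  qed
  finally have "norm (b (Suc m)) * norm q ^ Suc m *
      norm (\<Sum>d | d dvd Suc m. exp (of_nat d * z) - exp (- of_nat d * z)) \<le>
      (real (Suc m) * norm q ^ Suc m) * (real (Suc m) * (2 * exp (real (Suc m) * r)))"
    using b[of m] by (intro mult_mono mult_right_mono) (auto simp del: of_nat_Suc power_Suc)
  also have "\<dots> = 2 * ?\<rho> * ((real m + 1) ^ 2 * ?\<rho> ^ m)"
    unfolding exp_of_nat_mult by (simp add: power_mult_distrib power2_eq_square algebra_simps)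
  finally show "norm (b (Suc m) * q ^ Suc m *
      (\<Sum>d | d dvd Suc m. exp (of_nat d * z) - exp (- of_nat d * z))) \<le> 2 * ?\<rho> * ((real m + 1) ^ 2 * ?\<rho> ^ m)"
    by (simp only: norm_mult norm_power)
qed

lemma divisor_series_holo:
  assumes r: "norm q * exp r < 1" and b: "\<And>m. norm (b (Suc m)) \<le> real (Suc m)"
  shows "divisor_series q b holomorphic_on ball 0 r"
proof (rule holomorphic_uniform_sequence[where f = "\<lambda>N z. \<Sum>m<N. b (Suc m) * q ^ Suc m *
     (\<Sum>d | d dvd Suc m. exp (of_nat d * z) - exp (- of_nat d * z))"])
  fix x :: complex assume "x \<in> ball 0 r"
  then obtain d where d: "d > 0" "cball x d \<subseteq> ball 0 r"
    using open_contains_cball[of "ball 0 r"] open_ball by blast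
  thus "\<exists>d>0. cball x d \<subseteq> ball 0 r \<and> uniform_limit (cball x d) (\<lambda>N z. \<Sum>m<N. b (Suc m) * q ^ Suc m *
     (\<Sum>d | d dvd Suc m. exp (of_nat d * z) - exp (- of_nat d * z))) (divisor_series q b) sequentially"
    using uniform_limit_on_subset[OF divisor_series_uniform_limit[OF r b] d(2)] by blast
qed (auto intro!: holomorphic_intros)

lemma divisor_series_deriv_sums:
  assumes q: "norm q < 1" and b: "\<And>m. norm (b (Suc m)) \<le> real (Suc m)"
  shows "(\<lambda>m. (1 - (-1) ^ k) * (b (Suc m) * q ^ Suc m * of_nat (\<Sum>d | d dvd Suc m. d ^ k)))
           sums (deriv ^^ k) (divisor_series q b) 0"
proof -
  obtain r where r: "r > 0" "norm q * exp r < 1" using ex_exp_radius[OF q] by blast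
  define g where "g N z = (\<Sum>m<N. b (Suc m) * q ^ Suc m *
     (\<Sum>d | d dvd Suc m. exp (of_nat d * z) - exp (- of_nat d * z)))" for N z
  have "(\<lambda>N. (deriv ^^ k) (g N) 0) \<longlonglongrightarrow> (deriv ^^ k) (divisor_series q b) 0"
    by (rule higher_deriv_complex_uniform_limit[OF divisor_series_uniform_limit[OF r(2) b, folded g_def]])
       (use r in \<open>auto intro!: always_eventually holomorphic_intros simp: g_def\<close>)
  moreover have "(deriv ^^ k) (g N) 0 = (\<Sum>m<N. (1 - (-1) ^ k) * (b (Suc m) * q ^ Suc m * of_nat (\<Sum>d | d dvd Suc m. d ^ k)))" for N
  proof -
    define G where "G = (\<Sum>m<N. fps_const (b (Suc m) * q ^ Suc m) *
       (\<Sum>d | d dvd Suc m. fps_exp (of_nat d :: complex) - fps_exp (- of_nat d)))"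
    have "g N has_fps_expansion G"
      unfolding g_def G_def
      by (intro has_fps_expansion_sum has_fps_expansion_mult has_fps_expansion_const
            has_fps_expansion_diff has_fps_expansion_exp)
    from fps_nth_fps_expansion[OF this, of k] have "(deriv ^^ k) (g N) 0 = fact k * fps_nth G k" by simp
    also have "\<dots> = (\<Sum>m<N. (1 - (-1) ^ k) * (b (Suc m) * q ^ Suc m * of_nat (\<Sum>d | d dvd Suc m. d ^ k)))"
      unfolding G_def fps_sum_nth fps_mult_left_const_nth sum_distrib_left of_nat_sum
    proof (intro sum.cong refl)
      fix m d
      have "(- of_nat d :: complex) ^ k = (-1) ^ k * of_nat d ^ k" by (metis mult_minus1 power_mult_distrib)
      thus "fact k * (b (Suc m) * q ^ Suc m * fps_nth (fps_exp (of_nat d) - fps_exp (- of_nat d)) k) =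
             (1 - (- 1) ^ k) * (b (Suc m) * q ^ Suc m * of_nat (d ^ k))"
        by (simp add: field_simps)
    qed
    finally show ?thesis .
  qed
  ultimately show ?thesis by (simp add: sums_def)
qed

lemma divisor_series_fps:
  assumes q: "norm q < 1" and b: "\<And>m. norm (b (Suc m)) \<le> real (Suc m)"
  shows "divisor_series q b has_fps_expansion Abs_fps (divisor_coeff q b)"
proof -
  obtain r where r: "r > 0" "norm q * exp r < 1" using ex_exp_radius[OF q] by blast
  have exp: "divisor_series q b has_fps_expansion fps_expansion (divisor_series q b) 0"
    by (rule has_fps_expansion_fps_expansion[OF _ _ divisor_series_holo[OF r(2) b]]) (use r in auto)
  have "fps_nth (fps_expansion (divisor_series q b) 0) k = divisor_coeff q b k" for k
  proof -
    note S = divisor_series_deriv_sums[OF q b, where k = k]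
    have "divisor_coeff q b k = (deriv ^^ k) (divisor_series q b) 0 / fact k"
    \<comment> \<open>For even k the factor 1 - (-1)^k is 0 and cannot be divided out of the series;
      then both sides vanish.\<close>
    proof (cases "even k")
      case True
      thus ?thesis using S by (simp add: divisor_coeff_def sums_iff)
    next
      case False
      hence eq: "(1 - (-1 :: complex) ^ k) = 2" by simp
      have "(\<lambda>m. b (Suc m) * q ^ Suc m * of_nat (\<Sum>d | d dvd Suc m. d ^ k)) sums ((deriv ^^ k) (divisor_series q b) 0 / 2)"
        using sums_divide[OF S, where c = 2] unfolding eq by simp
      thus ?thesis unfolding divisor_coeff_def eq by (simp add: sums_iff mult.commute[of 2])
    qed
    thus ?thesis by (simp add: fps_expansion_def)
  qed
  hence "fps_expansion (divisor_series q b) 0 = Abs_fps (divisor_coeff q b)" by (intro fps_ext) simp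
  thus ?thesis using exp by simp
qed

section \<open>Elliptic functions\<close>

definition lattice_pts :: "complex \<Rightarrow> complex \<Rightarrow> complex set" where
  "lattice_pts \<omega>1 \<omega>2 = {of_int m * \<omega>1 + of_int n * \<omega>2 | m n. True}"

lemma lattice_ptsI: "z = of_int m * \<omega>1 + of_int n * \<omega>2 \<Longrightarrow> z \<in> lattice_pts \<omega>1 \<omega>2"
  unfolding lattice_pts_def by blast

lemma lattice_pts_0 [simp]: "0 \<in> lattice_pts \<omega>1 \<omega>2"
  by (rule lattice_ptsI[of _ 0 _ 0]) simp

lemma lattice_pts_add: "x \<in> lattice_pts \<omega>1 \<omega>2 \<Longrightarrow> y \<in> lattice_pts \<omega>1 \<omega>2 \<Longrightarrow> x + y \<in> lattice_pts \<omega>1 \<omega>2"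
proof -
  assume "x \<in> lattice_pts \<omega>1 \<omega>2" "y \<in> lattice_pts \<omega>1 \<omega>2"
  then obtain m n m' n' where "x = of_int m * \<omega>1 + of_int n * \<omega>2" "y = of_int m' * \<omega>1 + of_int n' * \<omega>2"
    by (auto simp: lattice_pts_def)
  thus ?thesis by (intro lattice_ptsI[of _ "m + m'" _ "n + n'"]) (simp add: algebra_simps)
qed

lemma lattice_pts_minus: "x \<in> lattice_pts \<omega>1 \<omega>2 \<Longrightarrow> - x \<in> lattice_pts \<omega>1 \<omega>2"
proof -
  assume "x \<in> lattice_pts \<omega>1 \<omega>2"
  then obtain m n where "x = of_int m * \<omega>1 + of_int n * \<omega>2"
    by (auto simp: lattice_pts_def)
  thus ?thesis by (intro lattice_ptsI[of _ "- m" _ "- n"]) (simp add: algebra_simps)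
qed

lemma lattice_pts_minus_iff [simp]: "- x \<in> lattice_pts \<omega>1 \<omega>2 \<longleftrightarrow> x \<in> lattice_pts \<omega>1 \<omega>2"
  using lattice_pts_minus[of x] lattice_pts_minus[of "- x"] by auto

lemma lattice_pts_add_iff [simp]:
  assumes "y \<in> lattice_pts \<omega>1 \<omega>2"
  shows "x + y \<in> lattice_pts \<omega>1 \<omega>2 \<longleftrightarrow> x \<in> lattice_pts \<omega>1 \<omega>2"
    "y + x \<in> lattice_pts \<omega>1 \<omega>2 \<longleftrightarrow> x \<in> lattice_pts \<omega>1 \<omega>2"
    "x - y \<in> lattice_pts \<omega>1 \<omega>2 \<longleftrightarrow> x \<in> lattice_pts \<omega>1 \<omega>2"
proof -
  show a: "x + y \<in> lattice_pts \<omega>1 \<omega>2 \<longleftrightarrow> x \<in> lattice_pts \<omega>1 \<omega>2" for x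
    using lattice_pts_add[OF _ assms, of x] lattice_pts_add[OF _ lattice_pts_minus[OF assms], of "x + y"] by auto
  show "y + x \<in> lattice_pts \<omega>1 \<omega>2 \<longleftrightarrow> x \<in> lattice_pts \<omega>1 \<omega>2"
    using a by (simp add: add.commute)
  show "x - y \<in> lattice_pts \<omega>1 \<omega>2 \<longleftrightarrow> x \<in> lattice_pts \<omega>1 \<omega>2"
    using a[of "x - y"] by simp
qed

lemma lattice_pts_basis [simp]: "\<omega>1 \<in> lattice_pts \<omega>1 \<omega>2" "\<omega>2 \<in> lattice_pts \<omega>1 \<omega>2"
  by (rule lattice_ptsI[of _ 1 _ 0] lattice_ptsI[of _ 0 _ 1]; simp)+

locale period_lattice =
  fixes \<omega>1 \<omega>2 :: complex
  assumes indep: "Im (\<omega>2 / \<omega>1) \<noteq> 0"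
begin

abbreviation "L \<equiv> lattice_pts \<omega>1 \<omega>2"

lemma omega1_nz: "\<omega>1 \<noteq> 0" using indep by auto

text \<open>After division by \<omega>1 a non-zero point is m + n \<sigma>: if n = 0 its modulus is
  at least 1, otherwise its imaginary part is at least that of \<sigma> in absolute value.\<close>

lemma lattice_discrete: "\<exists>\<delta>>0. \<forall>z\<in>L. z \<noteq> 0 \<longrightarrow> norm z \<ge> \<delta>"
proof (intro exI[of _ "norm \<omega>1 * min 1 \<bar>Im (\<omega>2 / \<omega>1)\<bar>"] conjI ballI impI)
  show "norm \<omega>1 * min 1 \<bar>Im (\<omega>2 / \<omega>1)\<bar> > 0" using omega1_nz indep by simp
  fix z assume "z \<in> L" "z \<noteq> 0"
  then obtain m n where z: "z = of_int m * \<omega>1 + of_int n * \<omega>2" by (auto simp: lattice_pts_def)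
  define \<sigma> where "\<sigma> = \<omega>2 / \<omega>1"
  have z': "z = \<omega>1 * (of_int m + of_int n * \<sigma>)" using omega1_nz by (simp add: \<sigma>_def z field_simps)
  have "norm (of_int m + of_int n * \<sigma>) \<ge> min 1 \<bar>Im \<sigma>\<bar>"
  proof (cases "n = 0")
    case True
    with \<open>z \<noteq> 0\<close> z' have "m \<noteq> 0" by auto
    hence "\<bar>m\<bar> \<ge> 1" by simp
    hence "real_of_int \<bar>m\<bar> \<ge> 1" by linarith
    thus ?thesis using True by simp
  next
    case False
    hence "\<bar>n\<bar> \<ge> 1" by simp
    hence "real_of_int \<bar>n\<bar> \<ge> 1" by linarith
    hence "1 * \<bar>Im \<sigma>\<bar> \<le> real_of_int \<bar>n\<bar> * \<bar>Im \<sigma>\<bar>" by (intro mult_right_mono) auto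
    also have "\<dots> = \<bar>Im (of_int m + of_int n * \<sigma>)\<bar>" by (simp add: abs_mult)
    also have "\<dots> \<le> norm (of_int m + of_int n * \<sigma>)" by (rule abs_Im_le_cmod)
    finally show ?thesis by simp
  qed
  thus "norm \<omega>1 * min 1 \<bar>Im (\<omega>2 / \<omega>1)\<bar> \<le> norm z"
    unfolding z' norm_mult \<sigma>_def by (intro mult_left_mono) auto
qed

lemma closed_lattice: "closed L"
proof -
  obtain \<delta> where \<delta>: "\<delta> > 0" "\<And>z. z \<in> L \<Longrightarrow> z \<noteq> 0 \<Longrightarrow> norm z \<ge> \<delta>" using lattice_discrete by blast
  show ?thesis
  proof (rule discrete_imp_closed[OF \<delta>(1)], intro ballI impI)
    fix x y assume "x \<in> L" "y \<in> L" "dist y x < \<delta>"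
    thus "y = x" using \<delta>(2)[of "y - x"] by (force simp: dist_norm)
  qed
qed

lemma eventually_not_lattice: "eventually (\<lambda>z. z \<notin> L) (at z0)"
proof (cases "z0 \<in> L")
  case False
  have "eventually (\<lambda>z. z \<in> - L) (at z0)"
    using False closed_lattice by (intro eventually_at_in_open') auto
  thus ?thesis by simp
next
  case True
  obtain \<delta> where \<delta>: "\<delta> > 0" "\<And>z. z \<in> L \<Longrightarrow> z \<noteq> 0 \<Longrightarrow> norm z \<ge> \<delta>" using lattice_discrete by blast
  have "z \<notin> L" if "z \<noteq> z0" "dist z z0 < \<delta>" for z
    using \<delta>(2)[of "z - z0"] that True by (auto simp: dist_norm)
  thus ?thesis using \<delta>(1) unfolding eventually_at by blast
qed

lemma lattice_reduce: "\<exists>w\<in>L. \<exists>s\<in>{0..1}. \<exists>t\<in>{0..1}. z = w + (of_real s * \<omega>1 + of_real t * \<omega>2)"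
proof -
  define \<sigma> where "\<sigma> = \<omega>2 / \<omega>1"
  define b where "b = Im (z / \<omega>1) / Im \<sigma>"
  define a where "a = Re (z / \<omega>1) - b * Re \<sigma>"
  have "b * Im \<sigma> = Im (z / \<omega>1)" using indep by (simp add: b_def \<sigma>_def)
  hence "z / \<omega>1 = of_real a + of_real b * \<sigma>" by (intro complex_eqI) (simp_all add: a_def)
  hence ab: "z = of_real a * \<omega>1 + of_real b * \<omega>2"
    using omega1_nz by (simp add: \<sigma>_def field_simps)
  have fl: "complex_of_real x = of_int \<lfloor>x\<rfloor> + of_real (frac x)" for x
    by (simp add: frac_def)
  have "z = (of_int \<lfloor>a\<rfloor> * \<omega>1 + of_int \<lfloor>b\<rfloor> * \<omega>2) + (of_real (frac a) * \<omega>1 + of_real (frac b) * \<omega>2)"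
    unfolding ab by (subst fl[of a], subst fl[of b]) (simp only: ring_distribs add_ac)
  moreover have "of_int \<lfloor>a\<rfloor> * \<omega>1 + of_int \<lfloor>b\<rfloor> * \<omega>2 \<in> L" by (rule lattice_ptsI) simp
  moreover have "frac x \<in> {0..1}" for x :: real using frac_lt_1[of x] by auto
  ultimately show ?thesis by blast
qed

lemma periodic_lattice:
  assumes "\<And>z. z \<notin> L \<Longrightarrow> f (z + \<omega>1) = f z" "\<And>z. z \<notin> L \<Longrightarrow> f (z + \<omega>2) = f z"
  assumes "w \<in> L" "z \<notin> L"
  shows "f (z + w) = (f z :: complex)"
proof -
  have int: "f (z + of_int m * \<omega>) = f z" if "\<omega> \<in> L" "\<And>z. z \<notin> L \<Longrightarrow> f (z + \<omega>) = f z" "z \<notin> L" "\<And>m::int. of_int m * \<omega> \<in> L" for m z \<omega>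
  proof (induction m rule: int_induct[where k = 0])
    case (step1 i)
    show ?case using that(2)[of "z + of_int i * \<omega>"] that(3,4) step1 by (simp add: algebra_simps)
  next
    case (step2 i)
    have "z + of_int (i - 1) * \<omega> \<notin> L" using that(3) lattice_pts_add_iff(1)[OF that(4)[of "i - 1"], of z] by blast
    from that(2)[OF this] show ?case using step2 by (simp add: algebra_simps)
  qed simp
  obtain m n where w: "w = of_int m * \<omega>1 + of_int n * \<omega>2" using assms(3) by (auto simp: lattice_pts_def)
  have L: "of_int k * \<omega>1 \<in> L" "of_int k * \<omega>2 \<in> L" for k
    by (rule lattice_ptsI[of _ k _ 0] lattice_ptsI[of _ 0 _ k]; simp)+
  have "f (z + w) = f ((z + of_int m * \<omega>1) + of_int n * \<omega>2)" by (simp add: w algebra_simps)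
  also have "\<dots> = f (z + of_int m * \<omega>1)" using assms L by (intro int) auto
  also have "\<dots> = f z" using assms L by (intro int) auto
  finally show ?thesis .
qed

text \<open>Liouville's theorem in the form used throughout. The function \<open>g\<close> extends
  \<open>f\<close> across 0, its translates extend \<open>f\<close> across every lattice point, and
  a closed period parallelogram already yields all values, so the extension is entire and
  bounded.\<close>

lemma elliptic_const:
  assumes f: "f holomorphic_on - L"
    and per: "\<And>z. z \<notin> L \<Longrightarrow> f (z + \<omega>1) = f z" "\<And>z. z \<notin> L \<Longrightarrow> f (z + \<omega>2) = f z"
    and g: "g analytic_on {0}" "eventually (\<lambda>z. f z = g z) (at 0)"
    and z: "z \<notin> L"
  shows "f z = g 0"
proof -
  define F where "F z = (if z \<in> L then g 0 else f z)" for z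
  note per' = periodic_lattice[of f, OF per]
  have F_per: "F (z + w) = F z" if "w \<in> L" for z w
    using that per'[of w z] by (auto simp: F_def)
  have "F analytic_on {z}" for z
  proof (cases "z \<in> L")
    case False
    have "f analytic_on - L" using f closed_lattice by (simp add: analytic_on_open open_Compl)
    hence "f analytic_on {z}" using False by (auto intro: analytic_on_subset)
    moreover have "eventually (\<lambda>w. w \<in> - L) (nhds z)"
      using False closed_lattice by (intro eventually_nhds_in_open) auto
    hence "eventually (\<lambda>w. F w = f w) (nhds z)" by eventually_elim (auto simp: F_def)
    ultimately show ?thesis by (subst analytic_at_cong) auto
  next
    case True
    have "eventually (\<lambda>w. F w = g w) (at 0)"
      using g(2) eventually_not_lattice[of 0] by eventually_elim (auto simp: F_def)
    hence "eventually (\<lambda>w. F w = g w) (nhds 0)"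
      unfolding eventually_at_filter by eventually_elim (auto simp: F_def)
    hence "F analytic_on {0}" using g(1) by (subst analytic_at_cong) auto
    moreover have "(\<lambda>w. w - z) analytic_on {z}" by (intro analytic_intros)
    ultimately have "(F \<circ> (\<lambda>w. w - z)) analytic_on {z}"
      by (intro analytic_on_compose) auto
    moreover have "F \<circ> (\<lambda>w. w - z) = F" using F_per[OF True, of "w - z" for w] by (simp add: fun_eq_iff)
    ultimately show ?thesis by (simp only:)
  qed
  hence "F analytic_on UNIV" by (subst analytic_on_analytic_at) auto
  hence F_holo: "F holomorphic_on UNIV" by (rule analytic_imp_holomorphic)
  have "range F \<subseteq> F ` ((\<lambda>(s, t). of_real s * \<omega>1 + of_real t * \<omega>2) ` ({0..1} \<times> {0..1}))"
  proof (rule image_subsetI)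
    fix z
    obtain w s t where "w \<in> L" "s \<in> {0..1}" "t \<in> {0..1}" "z = w + (of_real s * \<omega>1 + of_real t * \<omega>2)"
      using lattice_reduce by meson
    moreover from this have "F z = F (of_real s * \<omega>1 + of_real t * \<omega>2)"
      using F_per by (metis add.commute)
    ultimately show "F z \<in> F ` ((\<lambda>(s, t). of_real s * \<omega>1 + of_real t * \<omega>2) ` ({0..1} \<times> {0..1}))" by force
  qed
  moreover have "compact (F ` ((\<lambda>(s, t). of_real s * \<omega>1 + of_real t * \<omega>2) ` ({0..1::real} \<times> {0..1::real})))"
    by (intro compact_continuous_image compact_Times compact_Icc
          continuous_on_subset[OF holomorphic_on_imp_continuous_on[OF F_holo]])
       (auto simp: case_prod_unfold intro!: continuous_intros)
  ultimately have "bounded (range F)" using compact_imp_bounded bounded_subset by blast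
  then obtain c where c: "\<And>z. F z = c" using Liouville_theorem[OF F_holo] by (auto simp: constant_on_def)
  thus ?thesis using c[of 0] c[of z] z by (simp add: F_def)
qed

end

section \<open>The quasi-periodic zeta function\<close>

definition nome :: "complex \<Rightarrow> complex" where
  "nome \<tau> = exp (2 * of_real pi * \<i> * \<tau>)"

abbreviation (input) per1 :: complex where "per1 \<equiv> 2 * of_real pi * \<i>"

text \<open>The logarithmic derivative of a theta function, that is, the Weierstrass zeta function
  of the lattice 2 pi i (Z + Z \<tau>) minus the multiple of z that makes 2 pi i a genuine period.
  The constant -1/2 makes it odd.\<close>

definition qzeta :: "complex \<Rightarrow> complex \<Rightarrow> complex" where
  "qzeta \<tau> z = - 1 / 2 - (lambert (nome \<tau>) (\<lambda>_. 1) geom1 (exp z) -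
     lambert (nome \<tau>) (\<lambda>_. 1) geom1 (nome \<tau> * exp (- z)))"

text \<open>The termwise derivative q d/dq of \<open>qzeta\<close> at fixed z. The relation to
  d/d\<tau> is established on Taylor coefficients, in \<open>wfps_deriv\<close>. The weight n kills
  the term n = 0, so the second argument can be exp(-z) where \<open>qzeta\<close> has q
  exp(-z).\<close>

definition qzeta_D :: "complex \<Rightarrow> complex \<Rightarrow> complex" where
  "qzeta_D \<tau> z = - (lambert (nome \<tau>) of_nat geom2 (exp z) - lambert (nome \<tau>) of_nat geom2 (exp (- z)))"

locale upper =
  fixes \<tau> :: complex
  assumes Im_pos: "Im \<tau> > 0"
begin

definition q :: complex where "q = nome \<tau>"
definition per2 :: complex where "per2 = per1 * \<tau>"

lemma exp_per2: "exp per2 = q" by (simp add: per2_def q_def nome_def)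
lemma q_nz: "q \<noteq> 0" by (simp add: q_def nome_def)
lemma norm_q: "norm q < 1" using Im_pos by (simp add: q_def nome_def)

sublocale period_lattice per1 per2
  by standard (use Im_pos in \<open>simp add: per2_def\<close>)

lemmas geom1_series = lambert_geom1[OF norm_q]
lemmas geom2_series = lambert_geom2[OF norm_q]

lemma g1: "lambert_series q (\<lambda>_. 1) geom1 4" by (rule geom1_series) simp
lemma g2: "lambert_series q (\<lambda>_. 1) geom2 4" by (rule geom2_series) simp
lemma g2n: "lambert_series q of_nat geom2 4" by (rule geom2_series) simp

lemma exp_in_dom:
  assumes "z \<notin> L"
  shows "exp z \<in> lambert_dom q"
proof -
  have "q ^ n * exp z \<noteq> 1" for n
  proof
    assume "q ^ n * exp z = 1"
    hence "exp (of_nat n * per2 + z) = 1" by (simp add: exp_add exp_of_nat_mult exp_per2)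
    then obtain k :: int where "Re (of_nat n * per2 + z) = 0" "Im (of_nat n * per2 + z) = of_int (2 * k) * pi"
      by (subst (asm) exp_eq_1) auto
    hence "of_nat n * per2 + z = of_int k * per1" by (simp add: complex_eq_iff)
    hence "z = of_int k * per1 + of_int (- int n) * per2" by (simp add: algebra_simps)
    thus False using assms lattice_ptsI by blast
  qed
  thus ?thesis by (simp add: lambert_dom_def)
qed

lemma exp_neg_in_dom: "z \<notin> L \<Longrightarrow> exp (- z) \<in> lambert_dom q"
  by (rule exp_in_dom) simp

lemma exp_ne_1: "z \<notin> L \<Longrightarrow> exp z \<noteq> 1"
  using exp_in_dom[of z] by (auto simp: lambert_dom_def dest: spec[of _ 0])

lemma open_compl_L: "open (- L)" using closed_lattice by (simp add: open_Compl)

lemma qzeta_holo: "qzeta \<tau> holomorphic_on - L"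
proof -
  have A: "(\<lambda>z. lambert q (\<lambda>_. 1) geom1 (exp z)) holomorphic_on - L"
    by (rule holomorphic_on_compose_gen[OF _ lambert_series.lambert_holo[OF g1], unfolded o_def])
       (auto intro!: holomorphic_intros exp_in_dom)
  have B: "(\<lambda>z. lambert q (\<lambda>_. 1) geom1 (q * exp (- z))) holomorphic_on - L"
    by (rule holomorphic_on_compose_gen[OF _ lambert_series.lambert_holo[OF g1], unfolded o_def])
       (auto intro!: holomorphic_intros lambert_dom_mult exp_neg_in_dom)
  show ?thesis unfolding qzeta_def q_def[symmetric] by (intro holomorphic_intros A B)
qed

lemma qzeta_D_holo: "qzeta_D \<tau> holomorphic_on - L"
proof -
  have A: "(\<lambda>z. lambert q of_nat geom2 (exp z)) holomorphic_on - L"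
    by (rule holomorphic_on_compose_gen[OF _ lambert_series.lambert_holo[OF g2n], unfolded o_def])
       (auto intro!: holomorphic_intros exp_in_dom)
  have B: "(\<lambda>z. lambert q of_nat geom2 (exp (- z))) holomorphic_on - L"
    by (rule holomorphic_on_compose_gen[OF _ lambert_series.lambert_holo[OF g2n], unfolded o_def])
       (auto intro!: holomorphic_intros exp_neg_in_dom)
  show ?thesis unfolding qzeta_D_def q_def[symmetric] by (intro holomorphic_intros A B)
qed

lemma exp_per1: "exp (z + per1) = exp z"
  using exp_plus_2pin[of z 1] by (simp add: mult_ac)

lemma qzeta_per1: "qzeta \<tau> (z + per1) = qzeta \<tau> z"
  unfolding qzeta_def exp_minus exp_per1 ..

lemma qzeta_D_per1: "qzeta_D \<tau> (z + per1) = qzeta_D \<tau> z"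
  unfolding qzeta_D_def exp_minus exp_per1 ..

lemma exp_add_per2: "exp (z + per2) = q * exp z" by (simp add: exp_add exp_per2 mult.commute)
lemma exp_minus_per2: "q * exp (- (z + per2)) = exp (- z)" 
  unfolding exp_minus exp_add_per2 using q_nz by simp

text \<open>The first sum loses geom1(exp z) and the second gains geom1(exp(-z)); by the reflection
  rule these two add up to -1.\<close>

lemma qzeta_per2:
  assumes "z \<notin> L"
  shows "qzeta \<tau> (z + per2) = qzeta \<tau> z - 1"
proof -
  have "geom1 (exp (- z)) = - 1 - geom1 (exp z)"
    using geom1_inverse[of "exp z"] exp_ne_1[OF assms] by (simp add: exp_minus field_simps)
  thus ?thesis
    unfolding qzeta_def q_def[symmetric] exp_add_per2 exp_minus_per2
    by (simp add: lambert_shift[OF g1 exp_in_dom[OF assms]] lambert_shift[OF g1 exp_neg_in_dom[OF assms]])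
qed

lemma qzeta_odd:
  assumes "z \<notin> L"
  shows "qzeta \<tau> (- z) = - qzeta \<tau> z"
proof -
  have "geom1 (exp (- z)) = - 1 - geom1 (exp z)"
    using geom1_inverse[of "exp z"] exp_ne_1[OF assms] by (simp add: exp_minus field_simps)
  thus ?thesis
    unfolding qzeta_def q_def[symmetric]
    by (simp add: lambert_shift[OF g1 exp_in_dom[OF assms]] lambert_shift[OF g1 exp_neg_in_dom[OF assms]])
qed

lemma geom1_lambert_deriv:
  assumes "x \<in> lambert_dom q"
  shows "x * deriv (lambert q (\<lambda>_. 1) geom1) x = lambert q (\<lambda>_. 1) geom2 x"
proof -
  have "(\<lambda>n. x * (1 * q ^ n * deriv geom1 (q ^ n * x))) sums (x * deriv (lambert q (\<lambda>_. 1) geom1) x)"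
    by (intro sums_mult lambert_series.lambert_deriv_sums[OF g1 assms])
  moreover have "x * (1 * q ^ n * deriv geom1 (q ^ n * x)) = 1 * geom2 (q ^ n * x)" for n
    using deriv_geom1[of "q ^ n * x"] assms by (simp add: lambert_dom_def mult_ac)
  ultimately show ?thesis using lambert_series.lambert_sums[OF g2 assms] by (simp add: sums_unique2)
qed

lemma deriv_qzeta:
  assumes "z \<notin> L"
  shows "deriv (qzeta \<tau>) z = - (lambert q (\<lambda>_. 1) geom2 (exp z) + lambert q (\<lambda>_. 1) geom2 (q * exp (- z)))"
proof -
  let ?S = "lambert q (\<lambda>_. 1) geom1"
  note dom = exp_in_dom[OF assms] lambert_dom_mult[OF exp_neg_in_dom[OF assms]]
  have D: "(?S has_field_derivative deriv ?S x) (at x)" if "x \<in> lambert_dom q" for x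
    using lambert_series.lambert_holo[OF g1] lambert_series.open_lambert_dom[OF g1] that
    by (rule holomorphic_derivI)
  have "((\<lambda>z. ?S (exp z)) has_field_derivative deriv ?S (exp z) * exp z) (at z)"
    by (rule DERIV_chain2[OF D]) (use dom in \<open>auto intro!: derivative_eq_intros\<close>)
  moreover have "((\<lambda>z. ?S (q * exp (- z))) has_field_derivative deriv ?S (q * exp (- z)) * (- (q * exp (- z)))) (at z)"
    by (rule DERIV_chain2[OF D]) (use dom in \<open>auto intro!: derivative_eq_intros\<close>)
  ultimately have "(qzeta \<tau> has_field_derivative - (deriv ?S (exp z) * exp z - deriv ?S (q * exp (- z)) * (- (q * exp (- z))))) (at z)"
    unfolding qzeta_def q_def[symmetric] by (auto intro!: derivative_eq_intros)
  from DERIV_imp_deriv[OF this] show ?thesis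
    using geom1_lambert_deriv[OF dom(1)] geom1_lambert_deriv[OF dom(2)] by (simp add: mult_ac)
qed

text \<open>This is q d/dq of the increment rule for \<open>qzeta\<close>: the translation
  \<open>per2\<close> is a logarithm of q, so it moves with q and contributes a derivative in
  z.\<close>

lemma qzeta_D_per2:
  assumes "z \<notin> L"
  shows "qzeta_D \<tau> (z + per2) = qzeta_D \<tau> z - deriv (qzeta \<tau>) z"
proof -
  have "z + per2 \<notin> L" using assms by simp
  note dom = exp_in_dom[OF assms] exp_neg_in_dom[OF assms] exp_neg_in_dom[OF this]
  have "geom2 (exp (- z)) = geom2 (exp z)"
    using geom2_inverse[of "exp z"] by (simp add: exp_minus field_simps)
  hence "lambert q (\<lambda>_. 1) geom2 (exp (- z)) = lambert q (\<lambda>_. 1) geom2 (q * exp (- z)) + geom2 (exp z)"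
    using lambert_shift[OF g2 dom(2)] by simp
  moreover have "lambert q of_nat geom2 (exp (- (z + per2))) =
      lambert q of_nat geom2 (exp (- z)) + lambert q (\<lambda>_. 1) geom2 (exp (- z))"
    using lambert_shift_nat[OF g2 g2n dom(3)] unfolding exp_minus_per2 by (simp only: diff_add_cancel)
  ultimately show ?thesis
    unfolding deriv_qzeta[OF assms] qzeta_D_def q_def[symmetric] exp_add_per2
      lambert_shift_nat[OF g2 g2n dom(1)] lambert_shift[OF g2 dom(1)] by simp
qed

lemma deriv_qzeta_per:
  assumes "z \<notin> L"
  shows "deriv (qzeta \<tau>) (z + per1) = deriv (qzeta \<tau>) z" "deriv (qzeta \<tau>) (z + per2) = deriv (qzeta \<tau>) z"
    "deriv (qzeta \<tau>) (- z) = deriv (qzeta \<tau>) z"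
proof -
  have D: "(qzeta \<tau> has_field_derivative deriv (qzeta \<tau>) z) (at z)" if "z \<notin> L" for z
    using qzeta_holo open_compl_L that by (intro holomorphic_derivI) auto
  have ev: "eventually (\<lambda>w. w \<notin> L) (nhds z)"
    using eventually_nhds_in_open[OF open_compl_L, of z] assms by simp
  have "((\<lambda>w. qzeta \<tau> (w + per1)) has_field_derivative deriv (qzeta \<tau>) (z + per1) * 1) (at z)"
    by (rule DERIV_chain2[OF D]) (use assms in \<open>auto intro!: derivative_eq_intros\<close>)
  thus "deriv (qzeta \<tau>) (z + per1) = deriv (qzeta \<tau>) z"
    by (simp add: qzeta_per1 DERIV_imp_deriv)
  have "((\<lambda>w. qzeta \<tau> (w + per2)) has_field_derivative deriv (qzeta \<tau>) (z + per2) * 1) (at z)"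
    by (rule DERIV_chain2[OF D]) (use assms in \<open>auto intro!: derivative_eq_intros\<close>)
  moreover have "eventually (\<lambda>w. qzeta \<tau> (w + per2) = qzeta \<tau> w - 1) (nhds z)"
    using ev by eventually_elim (rule qzeta_per2)
  ultimately have "((\<lambda>w. qzeta \<tau> w - 1) has_field_derivative deriv (qzeta \<tau>) (z + per2)) (at z)"
    by (subst (asm) DERIV_cong_ev) auto
  moreover have "((\<lambda>w. qzeta \<tau> w - 1) has_field_derivative deriv (qzeta \<tau>) z) (at z)"
    using D[OF assms] by (auto intro!: derivative_eq_intros)
  ultimately show "deriv (qzeta \<tau>) (z + per2) = deriv (qzeta \<tau>) z" using DERIV_unique by blast
  have "((\<lambda>w. qzeta \<tau> (- w)) has_field_derivative deriv (qzeta \<tau>) (- z) * (- 1)) (at z)"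
    by (rule DERIV_chain2[OF D]) (use assms in \<open>auto intro!: derivative_eq_intros\<close>)
  moreover have "eventually (\<lambda>w. qzeta \<tau> (- w) = - qzeta \<tau> w) (nhds z)"
    using ev by eventually_elim (rule qzeta_odd)
  ultimately have "((\<lambda>w. - qzeta \<tau> w) has_field_derivative - deriv (qzeta \<tau>) (- z)) (at z)"
    by (subst (asm) DERIV_cong_ev) auto
  moreover have "((\<lambda>w. - qzeta \<tau> w) has_field_derivative - deriv (qzeta \<tau>) z) (at z)"
    using D[OF assms] by (auto intro!: derivative_eq_intros)
  ultimately show "deriv (qzeta \<tau>) (- z) = deriv (qzeta \<tau>) z" using DERIV_unique by fastforce
qed

end

section \<open>Taylor expansions at 0 of the zeta function and of its q-derivative\<close>

lemma lambert_geom1_divisor: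
  assumes q: "norm q < 1" and z: "norm q * exp (norm z) < 1"
  shows "(\<lambda>m. q ^ Suc m * (\<Sum>d | d dvd Suc m. exp (of_nat d * z))) sums
           lambert q (\<lambda>_. 1) geom1 (q * exp z)"
proof -
  define f where "f n d = q ^ (n * d) * exp (of_nat d * z)" for n d
  define \<rho> where "\<rho> = norm q * exp (norm z)"
  have ex: "norm (exp (of_nat d * z)) \<le> exp (norm z) ^ d" for d
    using norm_exp[of "of_nat d * z"] by (simp add: exp_of_nat_mult norm_mult)
  have bound: "norm (f (Suc n) (Suc d)) \<le> norm q ^ n * \<rho> ^ Suc d" for n d
  proof -
    \<comment> \<open>The inequality (n+1)(d+1) >= n + (d+1) separates the two indices.\<close>
    have "norm (f (Suc n) (Suc d)) \<le> norm q ^ (n + Suc d) * exp (norm z) ^ Suc d"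
      unfolding f_def norm_mult norm_power using q ex[of "Suc d"]
      by (intro mult_mono power_decreasing) auto
    thus ?thesis by (simp add: \<rho>_def power_add power_mult_distrib mult_ac)
  qed
  have inner: "(\<lambda>d. f (Suc n) (Suc d)) sums geom1 (q ^ Suc n * exp z)" for n
  proof -
    define x where "x = q ^ Suc n * exp z"
    have "norm x < 1"
    proof -
      have "norm (q ^ Suc n * exp z) \<le> norm q ^ 1 * exp (norm z)"
        unfolding norm_mult norm_power using q norm_exp[of z] by (intro mult_mono power_decreasing) auto
      thus ?thesis using z by (simp add: x_def)
    qed
    from sums_mult[OF geometric_sums[OF this], of x]
    have "(\<lambda>d. x ^ Suc d) sums geom1 x" by (simp add: geom1_def)
    moreover have "f (Suc n) (Suc d) = x ^ Suc d" for d
      unfolding f_def x_def power_mult_distrib power_mult exp_of_nat_mult by (simp only: mult_ac)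
    ultimately show ?thesis by (simp add: x_def)
  qed
  have "(\<lambda>m. \<Sum>d | d dvd Suc m. f (Suc m div d) d) sums suminf (\<lambda>n. geom1 (q ^ Suc n * exp z))"
    by (rule dirichlet_double_sum(2)[where f = f and a = "\<lambda>n. norm q ^ n" and b = "\<lambda>d. \<rho> ^ Suc d", OF bound _ _ _ _ inner])
       (use q z in \<open>auto simp: \<rho>_def intro!: summable_geometric summable_mult\<close>)
  also have "(\<lambda>m. \<Sum>d | d dvd Suc m. f (Suc m div d) d) = (\<lambda>m. q ^ Suc m * (\<Sum>d | d dvd Suc m. exp (of_nat d * z)))"
    by (auto simp: f_def sum_distrib_left fun_eq_iff intro!: sum.cong)
  also have "suminf (\<lambda>n. geom1 (q ^ Suc n * exp z)) = lambert q (\<lambda>_. 1) geom1 (q * exp z)"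
    by (simp add: lambert_def mult_ac)
  finally show ?thesis .
qed

text \<open>The term n = 0 has weight 0, so the geometric expansion is only applied for n >= 1,
  where q^n exp z lies in the unit disc.\<close>

lemma lambert_geom2_divisor:
  assumes q: "norm q < 1" and z: "norm q * exp (norm z) < 1" "exp z \<in> lambert_dom q"
  shows "(\<lambda>m. of_nat (Suc m) * q ^ Suc m * (\<Sum>d | d dvd Suc m. exp (of_nat d * z))) sums
           lambert q of_nat geom2 (exp z)"
proof -
  define f where "f n d = of_nat n * of_nat d * q ^ (n * d) * exp (of_nat d * z)" for n d
  define \<rho> where "\<rho> = norm q * exp (norm z)"
  have ex: "norm (exp (of_nat d * z)) \<le> exp (norm z) ^ d" for d
    using norm_exp[of "of_nat d * z"] by (simp add: exp_of_nat_mult norm_mult)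
  have bound: "norm (f (Suc n) (Suc d)) \<le> (of_nat (Suc n) * norm q ^ n) * (of_nat (Suc d) * \<rho> ^ Suc d)" for n d
  proof -
    have "norm (f (Suc n) (Suc d)) \<le> of_nat (Suc n) * of_nat (Suc d) * norm q ^ (n + Suc d) * exp (norm z) ^ Suc d"
      unfolding f_def norm_mult norm_power norm_of_nat using q ex[of "Suc d"]
      by (intro mult_mono power_decreasing) auto
    thus ?thesis by (simp add: \<rho>_def power_add power_mult_distrib mult_ac)
  qed
  have inner: "(\<lambda>d. f (Suc n) (Suc d)) sums (of_nat (Suc n) * geom2 (q ^ Suc n * exp z))" for n
  proof -
    define x where "x = q ^ Suc n * exp z"
    have "norm x < 1"
    proof -
      have "norm (q ^ Suc n * exp z) \<le> norm q ^ 1 * exp (norm z)"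
        unfolding norm_mult norm_power using q norm_exp[of z] by (intro mult_mono power_decreasing) auto
      thus ?thesis using z by (simp add: x_def)
    qed
    from sums_mult[OF geometric_deriv_sums[OF this], of "of_nat (Suc n) * x"]
    have "(\<lambda>d. of_nat (Suc n) * of_nat (Suc d) * x ^ Suc d) sums (of_nat (Suc n) * geom2 x)"
      by (simp add: geom2_def mult_ac)
    moreover have "f (Suc n) (Suc d) = of_nat (Suc n) * of_nat (Suc d) * x ^ Suc d" for d
      unfolding f_def x_def power_mult_distrib power_mult exp_of_nat_mult by (simp only: mult_ac)
    ultimately show ?thesis by (simp add: x_def)
  qed
  have S: "summable (\<lambda>n. of_nat (Suc n) * r ^ n)" if "0 \<le> r" "r < 1" for r :: real
    using that sums_summable[OF geometric_deriv_sums[of r]] by simp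
  have "summable (\<lambda>n. of_nat (Suc n) * norm q ^ n)" using q by (intro S) auto
  moreover have "summable (\<lambda>d. of_nat (Suc d) * \<rho> ^ Suc d)"
    using summable_mult[OF S[of \<rho>], of \<rho>] z by (simp add: \<rho>_def mult_ac)
  ultimately have "(\<lambda>m. \<Sum>d | d dvd Suc m. f (Suc m div d) d) sums suminf (\<lambda>n. of_nat (Suc n) * geom2 (q ^ Suc n * exp z))"
    by (intro dirichlet_double_sum(2)[where f = f and a = "\<lambda>n. of_nat (Suc n) * norm q ^ n"
          and b = "\<lambda>d. of_nat (Suc d) * \<rho> ^ Suc d"] bound inner) (auto simp: \<rho>_def simp del: of_nat_Suc power_Suc)
  also have "(\<lambda>m. \<Sum>d | d dvd Suc m. f (Suc m div d) d) =
      (\<lambda>m. of_nat (Suc m) * q ^ Suc m * (\<Sum>d | d dvd Suc m. exp (of_nat d * z)))"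
  proof
    fix m
    have "f (Suc m div d) d = of_nat (Suc m) * q ^ Suc m * exp (of_nat d * z)" if "d dvd Suc m" for d
      using dvd_div_mult_self[OF that] unfolding f_def by (metis of_nat_mult)
    thus "(\<Sum>d | d dvd Suc m. f (Suc m div d) d) = of_nat (Suc m) * q ^ Suc m * (\<Sum>d | d dvd Suc m. exp (of_nat d * z))"
      unfolding sum_distrib_left by (intro sum.cong) auto
  qed
  also have "suminf (\<lambda>n. of_nat (Suc n) * geom2 (q ^ Suc n * exp z)) = lambert q of_nat geom2 (exp z)"
  proof -
    have "(\<lambda>n. of_nat n * geom2 (q ^ n * exp z)) sums lambert q of_nat geom2 (exp z)"
      by (rule lambert_series.lambert_sums[OF lambert_geom2[OF q] z(2)]) auto
    hence "(\<lambda>n. of_nat (Suc n) * geom2 (q ^ Suc n * exp z)) sums lambert q of_nat geom2 (exp z)"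
      by (subst sums_Suc_iff) simp
    thus ?thesis by (simp add: sums_iff)
  qed
  finally show ?thesis .
qed

lemma divisor_series_eq:
  assumes "(\<lambda>m. b (Suc m) * q ^ Suc m * (\<Sum>d | d dvd Suc m. exp (of_nat d * z))) sums S"
    "(\<lambda>m. b (Suc m) * q ^ Suc m * (\<Sum>d | d dvd Suc m. exp (of_nat d * - z))) sums T"
  shows "divisor_series q b z = S - T"
  using sums_diff[OF assms] unfolding divisor_series_def
  by (simp add: sum_subtractf right_diff_distrib sums_iff del: power_Suc)

text \<open>The Taylor series of \<open>1/2 + 1 / (exp z - 1) - 1 / z\<close>.\<close>
definition bernoulli_fps :: "complex fps" where
  "bernoulli_fps = fps_const (1/2) + fps_shift 1 (inverse (fps_shift 1 (fps_exp 1 - 1)) - 1)"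

lemma bernoulli_fps_1: "fps_nth bernoulli_fps 1 = 1 / 12"
proof -
  define E :: "complex fps" where "E = fps_shift 1 (fps_exp 1 - 1)"
  have E: "fps_nth E 0 = 1" "fps_nth E 1 = 1/2" "fps_nth E 2 = 1/6"
    by (simp_all add: E_def fact_numeral numeral_2_eq_2)
  have "inverse E * E = 1" using E(1) by (intro inverse_mult_eq_1) simp
  hence eq: "fps_nth (inverse E * E) n = fps_nth 1 n" for n by simp
  have I0: "fps_nth (inverse E) 0 = 1" using E by simp
  have "fps_nth (inverse E) 0 * fps_nth E 1 + fps_nth (inverse E) 1 * fps_nth E 0 = 0"
    using eq[of 1] by (simp add: fps_mult_nth)
  hence I1: "fps_nth (inverse E) 1 = - 1/2" unfolding E I0 by (simp only: add_eq_0_iff) simp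
  have "fps_nth (inverse E) 0 * fps_nth E 2 + fps_nth (inverse E) 1 * fps_nth E 1 + fps_nth (inverse E) 2 * fps_nth E 0 = 0"
    using eq[of 2] by (simp add: fps_mult_nth numeral_2_eq_2)
  hence "fps_nth (inverse E) 2 = 1 / 12" unfolding E I0 I1 by (simp only: add_eq_0_iff) simp
  thus ?thesis by (simp add: bernoulli_fps_def E_def numeral_2_eq_2)
qed

lemma bernoulli_expansion:
  "\<exists>f. f has_fps_expansion bernoulli_fps \<and> (\<forall>z. exp z \<noteq> 1 \<longrightarrow> - 1 / 2 - geom1 (exp z) = 1 / z + f z)"
proof -
  define E :: "complex fps" where "E = fps_shift 1 (fps_exp 1 - 1)"
  define e where "e z = (if z = 0 then fps_nth (fps_exp 1 - 1) 1 else (exp z - 1) / z ^ 1)" for z :: complex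
  have sub: "1 \<le> subdegree F" if "fps_nth F 0 = 0" "fps_nth F n \<noteq> 0" for F :: "complex fps" and n
    using that by (intro subdegree_geI) auto
  have "1 \<le> subdegree (fps_exp 1 - 1 :: complex fps)" by (rule sub[of _ 1]) simp_all
  hence "e has_fps_expansion E"
    unfolding e_def E_def by (intro has_fps_expansion_shift has_fps_expansion_diff has_fps_expansion_exp1 has_fps_expansion_1) auto
  hence "(\<lambda>z. inverse (e z) - 1) has_fps_expansion inverse E - 1"
    by (intro fps_expansion_intros) (simp_all add: E_def)
  \<comment> \<open>The zero series has subdegree 0, so a non-zero coefficient has to be exhibited.
    The one at z^2 is B_2/2! = 1/12.\<close>
  moreover have "1 \<le> subdegree (inverse E - 1)"
  proof (rule sub[of _ 2])
    have "fps_nth bernoulli_fps 1 = fps_nth (inverse E - 1) 2"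
      by (simp add: bernoulli_fps_def E_def numeral_2_eq_2)
    thus "fps_nth (inverse E - 1) 2 \<noteq> 0" unfolding bernoulli_fps_1 by auto
  qed (simp add: E_def)
  ultimately have "(\<lambda>z. 1/2 + (if z = 0 then fps_nth (inverse E - 1) 1 else (inverse (e z) - 1) / z ^ 1)) has_fps_expansion
          fps_const (1/2) + fps_shift 1 (inverse E - 1)"
    by (intro has_fps_expansion_add has_fps_expansion_const has_fps_expansion_shift) auto
  hence "(\<lambda>z. 1/2 + (if z = 0 then fps_nth (inverse E - 1) 1 else (inverse (e z) - 1) / z ^ 1)) has_fps_expansion bernoulli_fps"
    by (simp add: bernoulli_fps_def E_def)
  moreover have "- 1 / 2 - geom1 (exp z) = 1 / z + (1/2 + (if z = 0 then fps_nth (inverse E - 1) 1 else (inverse (e z) - 1) / z ^ 1))"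
    if "exp z \<noteq> 1" for z
  proof -
    have "z \<noteq> 0" using that by auto
    thus ?thesis using that by (simp add: e_def geom1_def field_simps)
  qed
  ultimately show ?thesis by blast
qed

text \<open>For fixed k the coefficient is a power series in q, on which d/d\<tau> acts as 2 pi i q
  d/dq and multiplies the m-th term by m.\<close>

lemma divisor_coeff_deriv:
  assumes \<tau>: "Im \<tau> > 0" and k: "odd k"
  shows "((\<lambda>\<tau>. divisor_coeff (nome \<tau>) (\<lambda>_. 1) k) has_field_derivative
           2 * of_real pi * \<i> * divisor_coeff (nome \<tau>) of_nat k) (at \<tau>)"
proof -
  define c :: "nat \<Rightarrow> complex" where "c n = (if n = 0 then 0 else of_nat (\<Sum>d | d dvd n. d ^ k))" for n
  have norm: "norm (nome \<tau>) < 1" using \<tau> by (simp add: nome_def)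
  have summ: "summable (\<lambda>n. c n * q ^ n)" if "norm q < 1" for q
  proof -
    have "summable (\<lambda>m. (1 - (-1) ^ k) * (1 * q ^ Suc m * of_nat (\<Sum>d | d dvd Suc m. d ^ k)))"
      using sums_summable[OF divisor_series_deriv_sums[OF that, of "\<lambda>_. 1"]] by simp
    hence "summable (\<lambda>m. (1/2) * (2 * (q ^ Suc m * of_nat (\<Sum>d | d dvd Suc m. d ^ k))))"
      using k by (intro summable_mult) (simp del: power_Suc of_nat_sum)
    hence "summable (\<lambda>m. c (Suc m) * q ^ Suc m)" by (simp add: c_def mult.commute del: power_Suc of_nat_sum)
    thus ?thesis by (subst (asm) summable_Suc_iff)
  qed
  have eq1: "divisor_coeff q (\<lambda>_. 1) k = 2 / fact k * (\<Sum>n. c n * q ^ n)" if "norm q < 1" for q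
    using k suminf_split_head[OF summ[OF that]] unfolding divisor_coeff_def
    by (simp add: c_def mult.commute del: power_Suc of_nat_sum)
  have D: "((\<lambda>q. \<Sum>n. c n * q ^ n) has_field_derivative (\<Sum>n. diffs c n * q ^ n)) (at q)" if "norm q < 1" for q
    by (rule termdiffs_strong'[OF summ that])
  have eq2: "divisor_coeff q of_nat k = 2 / fact k * ((\<Sum>n. diffs c n * q ^ n) * q)" if "norm q < 1" for q
  proof -
    have "summable (\<lambda>n. diffs c n * q ^ n)"
      by (rule termdiff_converges[OF that summ])
    hence "(\<Sum>n. diffs c n * q ^ n) * q = (\<Sum>n. diffs c n * q ^ n * q)" by (rule suminf_mult2)
    also have "\<dots> = (\<Sum>m. of_nat (Suc m) * q ^ Suc m * of_nat (\<Sum>d | d dvd Suc m. d ^ k))"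
      by (simp add: diffs_def c_def mult_ac del: of_nat_sum of_nat_Suc)
    finally show ?thesis using k by (simp add: divisor_coeff_def)
  qed
  have "((\<lambda>\<tau>. 2 / fact k * (\<Sum>n. c n * nome \<tau> ^ n)) has_field_derivative
      2 / fact k * ((\<Sum>n. diffs c n * nome \<tau> ^ n) * (nome \<tau> * (2 * of_real pi * \<i>)))) (at \<tau>)"
    unfolding nome_def
    by (intro DERIV_cmult DERIV_chain2[OF D]) (use norm in \<open>auto simp: nome_def intro!: derivative_eq_intros\<close>)
  also have "2 / fact k * ((\<Sum>n. diffs c n * nome \<tau> ^ n) * (nome \<tau> * (2 * of_real pi * \<i>))) =
      2 * of_real pi * \<i> * divisor_coeff (nome \<tau>) of_nat k"
    unfolding eq2[OF norm] by simp
  finally show ?thesis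
  proof (rule has_field_derivative_transform_within_open[where S = "{z. Im z > 0}"])
    show "open {z. Im z > 0}" by (rule open_halfspace_Im_gt)
  qed (use \<tau> in \<open>auto simp: eq1 nome_def\<close>)
qed

section \<open>Power series expansions compared on a punctured neighbourhood of 0\<close>

lemma fps_expansion_unique_at:
  fixes f g :: "complex \<Rightarrow> complex"
  assumes f: "f has_fps_expansion F" and g: "g has_fps_expansion G" and eq: "eventually (\<lambda>z. f z = g z) (at 0)"
  shows "F = G"
proof -
  have "(f \<longlongrightarrow> f 0) (at 0)" "(g \<longlongrightarrow> g 0) (at 0)"
    using has_fps_expansion_imp_continuous[OF f, of UNIV] has_fps_expansion_imp_continuous[OF g, of UNIV]
    by (auto simp: continuous_within)
  moreover have "(f \<longlongrightarrow> g 0) (at 0) \<longleftrightarrow> (g \<longlongrightarrow> g 0) (at 0)" using eq by (rule tendsto_cong)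
  ultimately have "f 0 = g 0" using tendsto_unique[of "at (0 :: complex)"] by auto
  hence "eventually (\<lambda>z. f z = g z) (nhds 0)"
    using eq unfolding eventually_at_filter by (auto elim: eventually_mono)
  hence "g has_fps_expansion F" using f by (subst (asm) has_fps_expansion_cong) auto
  thus ?thesis using g by (rule fps_expansion_unique_complex)
qed

lemma eventually_at_deriv:
  fixes f g :: "complex \<Rightarrow> complex"
  assumes "eventually (\<lambda>z. f z = g z) (at z0)"
  shows "eventually (\<lambda>z. deriv f z = deriv g z) (at z0)"
proof -
  obtain S where S: "open S" "z0 \<in> S" "\<And>z. z \<in> S \<Longrightarrow> z \<noteq> z0 \<Longrightarrow> f z = g z"
    using assms unfolding eventually_at_topological by blast
  have "deriv f z = deriv g z" if "z \<in> S" "z \<noteq> z0" for z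
  proof (rule deriv_cong_ev)
    have "eventually (\<lambda>w. w \<in> S - {z0}) (nhds z)" using that S(1) by (intro eventually_nhds_in_open) auto
    thus "eventually (\<lambda>w. f w = g w) (nhds z)" by eventually_elim (use S in auto)
  qed simp
  thus ?thesis using S unfolding eventually_at_topological by blast
qed

lemma has_fps_expansion_eventually_deriv:
  assumes "f has_fps_expansion (F :: complex fps)"
  shows "eventually (\<lambda>z. (f has_field_derivative deriv f z) (at z)) (at 0)"
proof -
  obtain S where S: "open S" "0 \<in> S" "f holomorphic_on S"
    using has_fps_expansion_imp_analytic_0[OF assms] unfolding analytic_at by blast
  have "eventually (\<lambda>z. z \<in> S) (at 0)" using S by (intro eventually_at_in_open') auto
  thus ?thesis by eventually_elim (rule holomorphic_derivI[OF S(3,1)])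
qed

lemma has_fps_expansion_scale:
  fixes f :: "complex \<Rightarrow> complex"
  assumes "f has_fps_expansion F"
  shows "(\<lambda>z. f (c * z)) has_fps_expansion Abs_fps (\<lambda>n. c ^ n * fps_nth F n)"
proof -
  have "(f \<circ> (\<lambda>z. c * z)) has_fps_expansion fps_compose F (fps_const c * fps_X)"
    by (intro has_fps_expansion_compose assms fps_expansion_intros) auto
  thus ?thesis by (simp add: o_def fps_compose_linear)
qed

lemma has_fps_expansion_div_power:
  fixes f :: "complex \<Rightarrow> complex"
  assumes "f has_fps_expansion F" "\<And>k. k < n \<Longrightarrow> fps_nth F k = 0"
  shows "\<exists>g. g has_fps_expansion fps_shift n F \<and> (\<forall>z. z \<noteq> 0 \<longrightarrow> g z = f z / z ^ n)"
\<comment> \<open>The zero series has subdegree 0, so the general argument by subdegree does not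
  reach it.\<close>
proof (cases "F = 0")
  case True
  then have "eventually (\<lambda>z. f z = 0) (nhds 0)" using assms(1) by (simp add: has_fps_expansion_def)
  hence "eventually (\<lambda>z. (if z = 0 then 0 else f z / z ^ n) = 0) (nhds 0)" by eventually_elim auto
  hence "(\<lambda>z. if z = 0 then 0 else f z / z ^ n) has_fps_expansion fps_shift n F"
    using True by (simp add: has_fps_expansion_def)
  thus ?thesis by (intro exI[of _ "\<lambda>z. if z = 0 then 0 else f z / z ^ n"]) auto
next
  case False
  hence "n \<le> subdegree F" using assms(2) by (intro subdegree_geI) auto
  from has_fps_expansion_shift[OF assms(1) this refl] show ?thesis
    by (intro exI[of _ "\<lambda>z. if z = 0 then fps_nth F n else f z / z ^ n"]) auto
qed

text \<open>The Taylor series at 0 of \<open>qzeta\<close> minus its pole 1/z. The series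
  \<open>vfps\<close> plays the same role for \<open>qzeta_D\<close>, which has no pole.\<close>

definition wfps :: "complex \<Rightarrow> complex fps" where
  "wfps \<tau> = bernoulli_fps - Abs_fps (divisor_coeff (nome \<tau>) (\<lambda>_. 1))"

definition vfps :: "complex \<Rightarrow> complex fps" where
  "vfps \<tau> = - Abs_fps (divisor_coeff (nome \<tau>) of_nat)"

text \<open>\<open>eis2\<close>, \<open>eis4\<close>, \<open>eis6\<close> are the Eisenstein series \<open>E\<^sub>2/12\<close>, \<open>E\<^sub>4/144\<close>, \<open>E\<^sub>6/432\<close>.\<close>
definition eis2 where "eis2 \<tau> = fps_nth (wfps \<tau>) 1"
definition eis4 where "eis4 \<tau> = - 5 * fps_nth (wfps \<tau>) 3"
definition eis6 where "eis6 \<tau> = 70 * fps_nth (wfps \<tau>) 5"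

lemma wfps_deriv:
  assumes "Im \<tau> > 0" "odd k"
  shows "((\<lambda>\<tau>. fps_nth (wfps \<tau>) k) has_field_derivative 2 * of_real pi * \<i> * fps_nth (vfps \<tau>) k) (at \<tau>)"
  unfolding wfps_def vfps_def
  using DERIV_diff[OF DERIV_const divisor_coeff_deriv[OF assms], of "fps_nth bernoulli_fps k"] by simp

text \<open>Adding \<open>eis2\<close> removes the constant term of the Laurent expansion at 0,
  which makes this the classical Weierstrass function of the lattice.\<close>

definition wp :: "complex \<Rightarrow> complex \<Rightarrow> complex" where
  "wp \<tau> z = eis2 \<tau> - deriv (qzeta \<tau>) z"

context upper
begin

lemma eventually_radius: "eventually (\<lambda>z::complex. norm q * exp (norm z) < 1) (at 0)"
proof -
  obtain r where r: "r > 0" "norm q * exp r < 1" using ex_exp_radius[OF norm_q] by blast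
  have "norm q * exp (norm z) < 1" if "z \<in> ball 0 r" for z :: complex
  proof -
    have "norm q * exp (norm z) \<le> norm q * exp r" using that by (intro mult_left_mono) auto
    thus ?thesis using r by linarith
  qed
  moreover have "eventually (\<lambda>z. z \<in> ball 0 r) (at (0::complex))"
    using r by (intro eventually_at_in_open') auto
  ultimately show ?thesis by (auto elim: eventually_mono)
qed

lemma qzeta_near: "\<exists>w. w has_fps_expansion wfps \<tau> \<and> eventually (\<lambda>z. qzeta \<tau> z = 1 / z + w z) (at 0)"
proof -
  obtain f where f: "f has_fps_expansion bernoulli_fps" "\<And>z. exp z \<noteq> 1 \<Longrightarrow> - 1 / 2 - geom1 (exp z) = 1 / z + f z"
    using bernoulli_expansion by blast
  have "(\<lambda>z. f z - divisor_series q (\<lambda>_. 1) z) has_fps_expansion wfps \<tau>"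
    unfolding wfps_def q_def[symmetric]
    by (intro has_fps_expansion_diff f divisor_series_fps norm_q) simp
  moreover have "eventually (\<lambda>z. qzeta \<tau> z = 1 / z + (f z - divisor_series q (\<lambda>_. 1) z)) (at 0)"
    using eventually_radius eventually_not_lattice[of 0]
  proof eventually_elim
    case (elim z)
    have "divisor_series q (\<lambda>_. 1) z = lambert q (\<lambda>_. 1) geom1 (q * exp z) - lambert q (\<lambda>_. 1) geom1 (q * exp (- z))"
      by (rule divisor_series_eq)
         (use lambert_geom1_divisor[OF norm_q, of z] lambert_geom1_divisor[OF norm_q, of "- z"] elim in simp_all)
    moreover have "lambert q (\<lambda>_. 1) geom1 (exp z) = geom1 (exp z) + lambert q (\<lambda>_. 1) geom1 (q * exp z)"
      using lambert_shift[OF g1 exp_in_dom[OF elim(2)]] by simp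
    ultimately show ?case
      using f(2)[OF exp_ne_1[OF elim(2)]] unfolding qzeta_def q_def[symmetric] by (simp add: algebra_simps)
  qed
  ultimately show ?thesis by blast
qed

lemma qzeta_D_near: "\<exists>v. v has_fps_expansion vfps \<tau> \<and> eventually (\<lambda>z. qzeta_D \<tau> z = v z) (at 0)"
proof -
  have "(\<lambda>z. - divisor_series q of_nat z) has_fps_expansion vfps \<tau>"
    unfolding vfps_def q_def[symmetric]
    by (intro has_fps_expansion_minus divisor_series_fps norm_q) (simp only: norm_of_nat)
  moreover have "eventually (\<lambda>z. qzeta_D \<tau> z = - divisor_series q of_nat z) (at 0)"
    using eventually_radius eventually_not_lattice[of 0]
  proof eventually_elim
    case (elim z)
    have "divisor_series q of_nat z = lambert q of_nat geom2 (exp z) - lambert q of_nat geom2 (exp (- z))"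
      by (rule divisor_series_eq)
         (use lambert_geom2_divisor[OF norm_q, of z] lambert_geom2_divisor[OF norm_q, of "- z"] elim
           exp_in_dom exp_neg_in_dom in simp_all)
    thus ?case unfolding qzeta_D_def q_def[symmetric] by simp
  qed
  ultimately show ?thesis by blast
qed

lemma wfps_even: "even k \<Longrightarrow> fps_nth (wfps \<tau>) k = 0"
proof -
  assume k: "even k"
  obtain w where w: "w has_fps_expansion wfps \<tau>" "eventually (\<lambda>z. qzeta \<tau> z = 1 / z + w z) (at 0)"
    using qzeta_near by blast
  have "eventually (\<lambda>z. qzeta \<tau> (- z) = 1 / (- z) + w (- z)) (at 0)"
  proof -
    have fm: "filtermap uminus (at (0 :: complex)) = at 0" using filtermap_at_minus[of "0 :: complex"] by simp
    have "eventually (\<lambda>z. qzeta \<tau> z = 1 / z + w z) (filtermap uminus (at 0))"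
      unfolding fm by (rule w(2))
    thus ?thesis unfolding eventually_filtermap .
  qed
  hence "eventually (\<lambda>z. w (- 1 * z) = - w z) (at 0)"
    using w(2) eventually_not_lattice[of 0] by eventually_elim (simp add: qzeta_odd)
  from fps_expansion_unique_at[OF has_fps_expansion_scale[OF w(1)] has_fps_expansion_minus[OF w(1)] this]
  have "Abs_fps (\<lambda>n. (- 1) ^ n * fps_nth (wfps \<tau>) n) = - wfps \<tau>" .
  from arg_cong[OF this, of "\<lambda>F. fps_nth F k"] k show ?thesis by simp
qed

lemma deriv_periodic:
  assumes "f holomorphic_on - L" "p \<in> L" "z \<notin> L" "\<And>z. z \<notin> L \<Longrightarrow> f (z + p) = f z"
  shows "deriv f (z + p) = deriv f z"
proof -
  have D: "(f has_field_derivative deriv f z) (at z)" if "z \<notin> L" for z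
    using assms(1) open_compl_L that by (intro holomorphic_derivI) auto
  have "((\<lambda>w. f (w + p)) has_field_derivative deriv f (z + p) * 1) (at z)"
    by (rule DERIV_chain2[OF D]) (use assms in \<open>auto intro!: derivative_eq_intros\<close>)
  moreover have "eventually (\<lambda>w. f (w + p) = f w) (nhds z)"
    using eventually_nhds_in_open[OF open_compl_L, of z] assms by (auto elim!: eventually_mono)
  ultimately have "(f has_field_derivative deriv f (z + p)) (at z)"
    by (subst (asm) DERIV_cong_ev) auto
  thus ?thesis using D[OF assms(3)] DERIV_unique by blast
qed

text \<open>A Burgers equation: it is the heat equation of the theta function seen through its
  logarithmic derivative. Along \<open>per2\<close> both \<open>qzeta_D\<close> and the product of
  \<open>qzeta\<close> with its derivative change by minus that derivative, and the poles of third
  order cancel against half the second derivative. The combination \<open>X\<close> is therefore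
  constant; the constant affects degree 0 only, hence the restriction on n.\<close>

lemma vfps_burgers:
  "n > 0 \<Longrightarrow> fps_nth (vfps \<tau>) n =
     fps_nth (fps_deriv (fps_shift 1 (wfps \<tau>)) + wfps \<tau> * fps_deriv (wfps \<tau>) + fps_const (1/2) * fps_deriv (fps_deriv (wfps \<tau>))) n"
proof -
  assume n: "n > 0"
  obtain w where w: "w has_fps_expansion wfps \<tau>" "eventually (\<lambda>z. qzeta \<tau> z = 1 / z + w z) (at 0)"
    using qzeta_near by blast
  obtain v where v: "v has_fps_expansion vfps \<tau>" "eventually (\<lambda>z. qzeta_D \<tau> z = v z) (at 0)"
    using qzeta_D_near by blast
  \<comment> \<open>This is w(z)/z, regular because w is odd. Its derivative accounts for the mixed
    terms w'/z - w/z^2 of the product.\<close>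
  obtain k where k: "k has_fps_expansion fps_shift 1 (wfps \<tau>)" "\<And>z. z \<noteq> 0 \<Longrightarrow> k z = w z / z ^ 1"
    using has_fps_expansion_div_power[OF w(1), of 1] wfps_even[of 0] by auto
  define X where "X z = qzeta_D \<tau> z - (qzeta \<tau> z * deriv (qzeta \<tau>) z + deriv (deriv (qzeta \<tau>)) z / 2)" for z
  define g where "g z = v z - (deriv k z + w z * deriv w z + 1 / 2 * deriv (deriv w) z)" for z
  define G where "G = vfps \<tau> - (fps_deriv (fps_shift 1 (wfps \<tau>)) + wfps \<tau> * fps_deriv (wfps \<tau>) + fps_const (1/2) * fps_deriv (fps_deriv (wfps \<tau>)))"
  have g: "g has_fps_expansion G"
    unfolding g_def G_def by (intro fps_expansion_intros v w k)
  have dW: "deriv (qzeta \<tau>) holomorphic_on - L" using qzeta_holo open_compl_L by (rule holomorphic_deriv)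
  have ddW: "deriv (deriv (qzeta \<tau>)) holomorphic_on - L" using dW open_compl_L by (rule holomorphic_deriv)
  have "eventually (\<lambda>z. deriv (qzeta \<tau>) z = deriv (\<lambda>z. 1 / z + w z) z) (at 0)"
    using eventually_at_deriv[OF w(2)] .
  hence D1: "eventually (\<lambda>z. deriv (qzeta \<tau>) z = - 1 / z ^ 2 + deriv w z) (at 0)"
    using has_fps_expansion_eventually_deriv[OF w(1)] eventually_neq_at_within[of 0]
  proof eventually_elim
    case (elim z)
    have "((\<lambda>z. 1 / z + w z) has_field_derivative (- 1 / z ^ 2 + deriv w z)) (at z)"
      using elim by (auto intro!: derivative_eq_intros simp: power2_eq_square)
    thus ?case using elim(1) by (simp add: DERIV_imp_deriv)
  qed
  have D2: "eventually (\<lambda>z. deriv (deriv (qzeta \<tau>)) z = 2 / z ^ 3 + deriv (deriv w) z) (at 0)"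
    using eventually_at_deriv[OF D1] has_fps_expansion_eventually_deriv[OF has_fps_expansion_deriv[OF w(1)]] eventually_neq_at_within[of 0]
  proof eventually_elim
    case (elim z)
    have "((\<lambda>z. - 1 / z ^ 2 + deriv w z) has_field_derivative (2 / z ^ 3 + deriv (deriv w) z)) (at z)"
      using elim by (auto intro!: derivative_eq_intros simp: power2_eq_square power3_eq_cube field_simps)
    thus ?case using elim(1) by (simp add: DERIV_imp_deriv)
  qed
  have "eventually (\<lambda>z. deriv k z = deriv (\<lambda>z. w z / z ^ 1) z) (at 0)"
    by (rule eventually_at_deriv, rule eventually_mono[OF eventually_neq_at_within[of 0]]) (rule k(2))
  hence D3: "eventually (\<lambda>z. deriv k z = deriv w z / z - w z / z ^ 2) (at 0)"
    using has_fps_expansion_eventually_deriv[OF w(1)] eventually_neq_at_within[of 0]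
  proof eventually_elim
    case (elim z)
    have "((\<lambda>z. w z / z ^ 1) has_field_derivative (deriv w z / z - w z / z ^ 2)) (at z)"
      using elim by (auto intro!: derivative_eq_intros simp: power2_eq_square field_simps)
    thus ?case using elim(1) by (simp add: DERIV_imp_deriv)
  qed
  have Xg: "eventually (\<lambda>z. X z = g z) (at 0)"
    using w(2) v(2) D1 D2 D3 eventually_neq_at_within[of 0]
  proof eventually_elim
    case (elim z)
    define i where "i = 1 / z"
    have "X z = v z - ((i + w z) * (- (i ^ 2) + deriv w z) + (2 * i ^ 3 + deriv (deriv w) z) / 2)"
      unfolding X_def elim(1-4) i_def by (simp add: power_one_over)
    also have "\<dots> = v z - (deriv w z * i - w z * i ^ 2 + w z * deriv w z + 1 / 2 * deriv (deriv w) z)"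
      by (simp add: algebra_simps power2_eq_square power3_eq_cube)
    also have "\<dots> = g z"
      unfolding g_def elim(5) i_def by (simp add: power_one_over)
    finally show ?case .
  qed
  have X: "X z = g 0" if "z \<notin> L" for z
  proof (rule elliptic_const[of X g])
    show "X holomorphic_on - L" unfolding X_def by (intro holomorphic_intros qzeta_holo qzeta_D_holo dW ddW) auto
    have dd: "deriv (deriv (qzeta \<tau>)) (z + per1) = deriv (deriv (qzeta \<tau>)) z"
      "deriv (deriv (qzeta \<tau>)) (z + per2) = deriv (deriv (qzeta \<tau>)) z" if "z \<notin> L" for z
      using that by (auto intro!: deriv_periodic[OF dW] deriv_qzeta_per)
    fix z assume z: "z \<notin> L"
    show "X (z + per1) = X z" unfolding X_def
      using z by (simp add: dd deriv_qzeta_per qzeta_per1 qzeta_D_per1)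
    show "X (z + per2) = X z" unfolding X_def
      using z by (simp add: dd deriv_qzeta_per qzeta_per2 qzeta_D_per2 algebra_simps)
  qed (use that g Xg in \<open>auto intro: has_fps_expansion_imp_analytic_0\<close>)
  have "eventually (\<lambda>z. g z = g 0) (at 0)"
    using Xg eventually_not_lattice[of 0] by eventually_elim (use X in auto)
  from fps_expansion_unique_at[OF g has_fps_expansion_const this] have "G = fps_const (g 0)" .
  from arg_cong[OF this, of "\<lambda>F. fps_nth F n"] n show ?thesis by (simp add: G_def)
qed

end

section \<open>The Weierstrass function and its differential equations\<close>

definition pfps :: "complex \<Rightarrow> complex fps" where
  "pfps \<tau> = fps_const (eis2 \<tau>) - fps_deriv (wfps \<tau>)"

context upper
begin

lemma dqzeta_holo: "deriv (qzeta \<tau>) holomorphic_on - L" using qzeta_holo open_compl_L by (rule holomorphic_deriv)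

lemma wp_holo: "wp \<tau> holomorphic_on - L"
  unfolding wp_def by (intro holomorphic_intros dqzeta_holo)

lemma dwp_holo: "deriv (wp \<tau>) holomorphic_on - L" using wp_holo open_compl_L by (rule holomorphic_deriv)

lemma ddwp_holo: "deriv (deriv (wp \<tau>)) holomorphic_on - L" using dwp_holo open_compl_L by (rule holomorphic_deriv)

lemma D_wp: "z \<notin> L \<Longrightarrow> (wp \<tau> has_field_derivative deriv (wp \<tau>) z) (at z)"
  using wp_holo open_compl_L by (intro holomorphic_derivI) auto

lemma wp_minus: "z \<notin> L \<Longrightarrow> wp \<tau> (- z) = wp \<tau> z"
  by (simp add: wp_def deriv_qzeta_per)

lemma wp_per12: "z \<notin> L \<Longrightarrow> wp \<tau> (z + per1) = wp \<tau> z" "z \<notin> L \<Longrightarrow> wp \<tau> (z + per2) = wp \<tau> z"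
  by (simp_all add: wp_def deriv_qzeta_per)

lemma wp_per: "p \<in> L \<Longrightarrow> z \<notin> L \<Longrightarrow> wp \<tau> (z + p) = wp \<tau> z"
  by (rule periodic_lattice[of "wp \<tau>", OF wp_per12])

lemma dwp_per: "p \<in> L \<Longrightarrow> z \<notin> L \<Longrightarrow> deriv (wp \<tau>) (z + p) = deriv (wp \<tau>) z"
  by (rule deriv_periodic[OF wp_holo _ _ wp_per])

lemma ddwp_per: "p \<in> L \<Longrightarrow> z \<notin> L \<Longrightarrow> deriv (deriv (wp \<tau>)) (z + p) = deriv (deriv (wp \<tau>)) z"
  by (rule deriv_periodic[OF dwp_holo _ _ dwp_per])

lemma dwp_minus:
  assumes "z \<notin> L"
  shows "deriv (wp \<tau>) (- z) = - deriv (wp \<tau>) z"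
proof -
  have "((\<lambda>w. wp \<tau> (- w)) has_field_derivative deriv (wp \<tau>) (- z) * (- 1)) (at z)"
    by (rule DERIV_chain2[OF D_wp]) (use assms in \<open>auto intro!: derivative_eq_intros\<close>)
  moreover have "eventually (\<lambda>w. wp \<tau> (- w) = wp \<tau> w) (nhds z)"
    using eventually_nhds_in_open[OF open_compl_L, of z] assms wp_minus by (auto elim!: eventually_mono)
  ultimately have "(wp \<tau> has_field_derivative - deriv (wp \<tau>) (- z)) (at z)"
    by (subst (asm) DERIV_cong_ev) auto
  thus ?thesis using D_wp[OF assms] DERIV_unique by (metis minus_equation_iff)
qed

lemma pfps_nth: "fps_nth (pfps \<tau>) 0 = 0" "fps_nth (pfps \<tau>) 1 = 0" "fps_nth (pfps \<tau>) 2 = 3 / 5 * eis4 \<tau>"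
  "fps_nth (pfps \<tau>) 3 = 0" "fps_nth (pfps \<tau>) 4 = - eis6 \<tau> / 14"
proof -
  have "fps_nth (wfps \<tau>) 2 = 0" "fps_nth (wfps \<tau>) 4 = 0" by (rule wfps_even; simp)+
  thus "fps_nth (pfps \<tau>) 0 = 0" "fps_nth (pfps \<tau>) 1 = 0" "fps_nth (pfps \<tau>) 2 = 3 / 5 * eis4 \<tau>"
    "fps_nth (pfps \<tau>) 3 = 0" "fps_nth (pfps \<tau>) 4 = - eis6 \<tau> / 14"
    by (auto simp: pfps_def eis2_def eis4_def eis6_def eval_nat_numeral)
qed

lemma pfps_odd: "odd k \<Longrightarrow> fps_nth (pfps \<tau>) k = 0"
  using wfps_even[of "Suc k"] by (cases "k = 0") (simp_all add: pfps_def)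

lemma wp_near: "\<exists>p. p has_fps_expansion pfps \<tau> \<and> eventually (\<lambda>z. wp \<tau> z = 1 / z ^ 2 + p z) (at 0)"
proof -
  obtain w where w: "w has_fps_expansion wfps \<tau>" "eventually (\<lambda>z. qzeta \<tau> z = 1 / z + w z) (at 0)"
    using qzeta_near by blast
  have "eventually (\<lambda>z. deriv (qzeta \<tau>) z = deriv (\<lambda>z. 1 / z + w z) z) (at 0)"
    using eventually_at_deriv[OF w(2)] .
  hence "eventually (\<lambda>z. wp \<tau> z = 1 / z ^ 2 + (eis2 \<tau> - deriv w z)) (at 0)"
    using has_fps_expansion_eventually_deriv[OF w(1)] eventually_neq_at_within[of 0]
  proof eventually_elim
    case (elim z)
    have "((\<lambda>z. 1 / z + w z) has_field_derivative (- 1 / z ^ 2 + deriv w z)) (at z)"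
      using elim by (auto intro!: derivative_eq_intros simp: power2_eq_square)
    thus ?case using elim(1) by (simp add: DERIV_imp_deriv wp_def)
  qed
  moreover have "(\<lambda>z. eis2 \<tau> - deriv w z) has_fps_expansion pfps \<tau>"
    unfolding pfps_def by (intro fps_expansion_intros w)
  ultimately show ?thesis by blast
qed

lemma dwp_near:
  assumes p: "p has_fps_expansion F" "eventually (\<lambda>z. wp \<tau> z = 1 / z ^ 2 + p z) (at 0)"
  shows "eventually (\<lambda>z. deriv (wp \<tau>) z = - 2 / z ^ 3 + deriv p z) (at 0)"
    "eventually (\<lambda>z. deriv (deriv (wp \<tau>)) z = 6 / z ^ 4 + deriv (deriv p) z) (at 0)"
proof -
  show D1: "eventually (\<lambda>z. deriv (wp \<tau>) z = - 2 / z ^ 3 + deriv p z) (at 0)"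
    using eventually_at_deriv[OF p(2)] has_fps_expansion_eventually_deriv[OF p(1)] eventually_neq_at_within[of 0]
  proof eventually_elim
    case (elim z)
    have "((\<lambda>z. 1 / z ^ 2 + p z) has_field_derivative (- 2 / z ^ 3 + deriv p z)) (at z)"
      using elim by (auto intro!: derivative_eq_intros simp: power2_eq_square power3_eq_cube field_simps)
    thus ?case using elim(1) by (simp add: DERIV_imp_deriv)
  qed
  show "eventually (\<lambda>z. deriv (deriv (wp \<tau>)) z = 6 / z ^ 4 + deriv (deriv p) z) (at 0)"
    using eventually_at_deriv[OF D1] has_fps_expansion_eventually_deriv[OF has_fps_expansion_deriv[OF p(1)]]
      eventually_neq_at_within[of 0]
  proof eventually_elim
    case (elim z)
    have "((\<lambda>z. - 2 / z ^ 3 + deriv p z) has_field_derivative (6 / z ^ 4 + deriv (deriv p) z)) (at z)"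
      using elim by (auto intro!: derivative_eq_intros simp: power2_eq_square power3_eq_cube power4_eq_xxxx field_simps)
    thus ?case using elim(1) by (simp add: DERIV_imp_deriv)
  qed
qed

text \<open>Both terms on the two sides have polar part 6/z^4 only, because the expansion of
  \<open>wp\<close> minus 1/z^2 starts at z^2. The second form is a recursion for the higher Taylor
  coefficients.\<close>

lemma wp_ode2:
  shows "z \<notin> L \<Longrightarrow> deriv (deriv (wp \<tau>)) z = 6 * wp \<tau> z ^ 2 - 6 * eis4 \<tau>"
    and "fps_deriv (fps_deriv (pfps \<tau>)) - fps_const 12 * fps_shift 2 (pfps \<tau>) - fps_const 6 * pfps \<tau> ^ 2 = fps_const (- 6 * eis4 \<tau>)"
proof -
  obtain p where p: "p has_fps_expansion pfps \<tau>" "eventually (\<lambda>z. wp \<tau> z = 1 / z ^ 2 + p z) (at 0)"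
    using wp_near by blast
  obtain k where k: "k has_fps_expansion fps_shift 2 (pfps \<tau>)" "\<And>z. z \<noteq> 0 \<Longrightarrow> k z = p z / z ^ 2"
  proof -
    have "fps_nth (pfps \<tau>) k = 0" if "k < 2" for k using that pfps_nth by (auto simp: less_2_cases_iff)
    thus ?thesis using that has_fps_expansion_div_power[OF p(1), of 2] by blast
  qed
  define X where "X z = deriv (deriv (wp \<tau>)) z - 6 * wp \<tau> z ^ 2" for z
  define g where "g z = deriv (deriv p) z - 12 * k z - 6 * p z ^ 2" for z
  define G where "G = fps_deriv (fps_deriv (pfps \<tau>)) - fps_const 12 * fps_shift 2 (pfps \<tau>) - fps_const 6 * pfps \<tau> ^ 2"
  have g: "g has_fps_expansion G"
    unfolding g_def G_def by (intro fps_expansion_intros p k)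
  have Xg: "eventually (\<lambda>z. X z = g z) (at 0)"
    using p(2) dwp_near(2)[OF p] eventually_neq_at_within[of 0]
  proof eventually_elim
    case (elim z)
    define i where "i = 1 / z"
    have "X z = (6 * i ^ 4 + deriv (deriv p) z) - 6 * (i ^ 2 + p z) ^ 2"
      unfolding X_def elim(1,2) by (simp add: i_def power_one_over)
    also have "\<dots> = deriv (deriv p) z - 12 * (p z * i ^ 2) - 6 * p z ^ 2"
      by (simp add: algebra_simps power2_eq_square power4_eq_xxxx)
    also have "\<dots> = g z"
      unfolding g_def k(2)[OF elim(3)] by (simp add: i_def power_one_over)
    finally show ?case .
  qed
  have g0: "g 0 = - 6 * eis4 \<tau>"
    using has_fps_expansion_imp_0_eq_fps_nth_0[OF g] pfps_nth
    by (simp add: G_def eval_nat_numeral field_simps)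
  have X: "X z = - 6 * eis4 \<tau>" if "z \<notin> L" for z
    unfolding g0[symmetric]
  proof (rule elliptic_const[of X g])
    show "X holomorphic_on - L" unfolding X_def by (intro holomorphic_intros wp_holo ddwp_holo open_compl_L)
  qed (use that g Xg in \<open>auto intro: has_fps_expansion_imp_analytic_0 simp: X_def ddwp_per wp_per\<close>)
  thus "z \<notin> L \<Longrightarrow> deriv (deriv (wp \<tau>)) z = 6 * wp \<tau> z ^ 2 - 6 * eis4 \<tau>" by (simp add: X_def algebra_simps)
  have "eventually (\<lambda>z. g z = - 6 * eis4 \<tau>) (at 0)"
    using Xg eventually_not_lattice[of 0] by eventually_elim (use X in auto)
  from fps_expansion_unique_at[OF g has_fps_expansion_const this]
  show "fps_deriv (fps_deriv (pfps \<tau>)) - fps_const 12 * fps_shift 2 (pfps \<tau>) - fps_const 6 * pfps \<tau> ^ 2 = fps_const (- 6 * eis4 \<tau>)"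
    unfolding G_def .
qed

text \<open>Degrees 4 and 6 of the recursion. In classical terms these are E_8 = E_4^2 and E_10 =
  E_4 E_6.\<close>

lemma pfps_nth68: "fps_nth (pfps \<tau>) 6 = 3 / 25 * eis4 \<tau> ^ 2" "fps_nth (pfps \<tau>) 8 = - 9 / 770 * eis4 \<tau> * eis6 \<tau>"
proof -
  have *: "fps_nth (fps_deriv (fps_deriv (pfps \<tau>)) - fps_const 12 * fps_shift 2 (pfps \<tau>) - fps_const 6 * pfps \<tau> ^ 2) n = 0" if "n > 0" for n
    unfolding wp_ode2(2) using that by simp
  have "30 * fps_nth (pfps \<tau>) 6 - 12 * fps_nth (pfps \<tau>) 6 - 6 * fps_nth (pfps \<tau>) 2 ^ 2 = 0"
    using *[of 4] pfps_nth pfps_odd by (simp add: power2_eq_square fps_mult_nth eval_nat_numeral)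
  thus "fps_nth (pfps \<tau>) 6 = 3 / 25 * eis4 \<tau> ^ 2" unfolding pfps_nth by (simp add: power2_eq_square field_simps)
  have "56 * fps_nth (pfps \<tau>) 8 - 12 * fps_nth (pfps \<tau>) 8 - 6 * (2 * fps_nth (pfps \<tau>) 2 * fps_nth (pfps \<tau>) 4) = 0"
    using *[of 6] pfps_nth pfps_odd by (simp add: power2_eq_square fps_mult_nth eval_nat_numeral)
  thus "fps_nth (pfps \<tau>) 8 = - 9 / 770 * eis4 \<tau> * eis6 \<tau>" unfolding pfps_nth by (simp add: field_simps) algebra
qed

lemma wp_ode1:
  assumes "z \<notin> L"
  shows "deriv (wp \<tau>) z ^ 2 = 4 * wp \<tau> z ^ 3 - 12 * eis4 \<tau> * wp \<tau> z + 2 * eis6 \<tau>"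
proof -
  obtain p where p: "p has_fps_expansion pfps \<tau>" "eventually (\<lambda>z. wp \<tau> z = 1 / z ^ 2 + p z) (at 0)"
    using wp_near by blast
  define r where "r = 3 / 5 * eis4 \<tau>"
  have "(\<lambda>z. p z - r * z ^ 2) has_fps_expansion pfps \<tau> - fps_const r * fps_X ^ 2"
    by (intro fps_expansion_intros p)
  moreover have "fps_nth (pfps \<tau> - fps_const r * fps_X ^ 2) k = 0" if "k < 4" for k
  proof -
    have "k \<in> {0, 1, 2, 3}" using that by auto
    thus ?thesis using pfps_nth by (auto simp: r_def)
  qed
  \<comment> \<open>The constant of the equation appears in degree 0 after cancellation of poles of
    order 6, so the coefficient of z^4 in \<open>p\<close> must be isolated: p = r z^2 + z^4
    t.\<close>
  ultimately obtain t where t: "t has_fps_expansion fps_shift 4 (pfps \<tau> - fps_const r * fps_X ^ 2)"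
    "\<And>z. z \<noteq> 0 \<Longrightarrow> t z = (p z - r * z ^ 2) / z ^ 4"
    using has_fps_expansion_div_power[of "\<lambda>z. p z - r * z ^ 2" _ 4] by blast
  have pt: "p z = r * z ^ 2 + z ^ 4 * t z" if "z \<noteq> 0" for z
    using t(2)[OF that] that by simp
  have "eventually (\<lambda>z. deriv p z = deriv (\<lambda>z. r * z ^ 2 + z ^ 4 * t z) z) (at 0)"
    by (rule eventually_at_deriv, rule eventually_mono[OF eventually_neq_at_within[of 0]]) (rule pt)
  hence dp: "eventually (\<lambda>z. deriv p z = 2 * r * z + 4 * z ^ 3 * t z + z ^ 4 * deriv t z) (at 0)"
    using has_fps_expansion_eventually_deriv[OF t(1)] 
  proof eventually_elim
    case (elim z)
    have "((\<lambda>z. r * z ^ 2 + z ^ 4 * t z) has_field_derivative (2 * r * z + 4 * z ^ 3 * t z + z ^ 4 * deriv t z)) (at z)"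
      using elim(2) by (auto intro!: derivative_eq_intros)
    thus ?case using elim(1) by (simp add: DERIV_imp_deriv)
  qed
  define X where "X z = deriv (wp \<tau>) z ^ 2 - 4 * wp \<tau> z ^ 3 + 12 * eis4 \<tau> * wp \<tau> z" for z
  define g where "g z = - 28 * t z - 4 * z * deriv t z + (2 * r * z + 4 * z ^ 3 * t z + z ^ 4 * deriv t z) ^ 2
      - 12 * z ^ 2 * (r + z ^ 2 * t z) ^ 2 - 4 * (r * z ^ 2 + z ^ 4 * t z) ^ 3 + 12 * eis4 \<tau> * (r * z ^ 2 + z ^ 4 * t z)" for z
  have g: "g analytic_on {0}"
    unfolding g_def
    by (intro analytic_intros has_fps_expansion_imp_analytic_0[OF t(1)]
         has_fps_expansion_imp_analytic_0[OF has_fps_expansion_deriv[OF t(1)]])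
  have Xg: "eventually (\<lambda>z. X z = g z) (at 0)"
    using p(2) dwp_near(1)[OF p] dp eventually_neq_at_within[of 0]
  proof eventually_elim
    case (elim z)
    \<comment> \<open>Writing i for 1/z turns the claim into a polynomial identity, in which mixed
      monomials are reduced by i z = 1.\<close>
    define i where "i = 1 / z"
    define T T' where "T = t z" "T' = deriv t z"
    have iz: "i * z = 1" using elim(4) by (simp add: i_def)
    have wp: "wp \<tau> z = i ^ 2 + (r * z ^ 2 + z ^ 4 * T)"
      unfolding elim(1) pt[OF elim(4)] by (simp add: i_def power_one_over T_T'_def)
    have dwp: "deriv (wp \<tau>) z = - 2 * i ^ 3 + (2 * r * z + 4 * z ^ 3 * T + z ^ 4 * T')"
      unfolding elim(2,3) by (simp add: i_def power_one_over T_T'_def)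
    have a: "eis4 \<tau> = 5 / 3 * r" by (simp add: r_def)
    have p1: "i ^ 3 * z = i ^ 2" "i ^ 3 * z ^ 3 = 1" "i ^ 3 * z ^ 4 = z" "i ^ 4 * z ^ 2 = i ^ 2" "i ^ 4 * z ^ 4 = 1" "i ^ 2 * z ^ 2 = 1"
      "i ^ 2 * z ^ 4 = z ^ 2"
      using elim(4) by (simp_all add: i_def field_simps eval_nat_numeral)
    have "(- 2 * i ^ 3 + (2 * r * z + 4 * z ^ 3 * T + z ^ 4 * T')) ^ 2 =
        4 * i ^ 6 - 8 * r * (i ^ 3 * z) - 16 * (i ^ 3 * z ^ 3) * T - 4 * (i ^ 3 * z ^ 4) * T' + (2 * r * z + 4 * z ^ 3 * T + z ^ 4 * T') ^ 2"
      by (simp add: eval_nat_numeral algebra_simps)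
    moreover have "(i ^ 2 + (r * z ^ 2 + z ^ 4 * T)) ^ 3 =
       i ^ 6 + 3 * (r * (i ^ 4 * z ^ 2) + (i ^ 4 * z ^ 4) * T) + 3 * (z ^ 2 * (i ^ 2 * z ^ 2)) * (r + z ^ 2 * T) ^ 2 + (r * z ^ 2 + z ^ 4 * T) ^ 3"
      by (simp add: eval_nat_numeral algebra_simps)
    ultimately show ?case
      unfolding X_def g_def wp dwp p1 a by (simp add: T_T'_def algebra_simps)
  qed
  have "fps_nth (fps_shift 4 (pfps \<tau> - fps_const r * fps_X ^ 2)) 0 = - eis6 \<tau> / 14"
    using pfps_nth by simp
  hence "t 0 = - eis6 \<tau> / 14" using has_fps_expansion_imp_0_eq_fps_nth_0[OF t(1)] by simp
  hence g0: "g 0 = 2 * eis6 \<tau>" by (simp add: g_def)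
  have "X z = 2 * eis6 \<tau>"
    unfolding g0[symmetric]
  proof (rule elliptic_const[of X g])
    show "X holomorphic_on - L" unfolding X_def by (intro holomorphic_intros wp_holo dwp_holo open_compl_L) 
  qed (use assms g Xg in \<open>auto simp: X_def dwp_per wp_per\<close>)
  thus ?thesis by (simp add: X_def algebra_simps)
qed

end

section \<open>Half periods: values, Taylor expansions and translation\<close>

context upper
begin

lemma dwp_half_period:
  assumes "v \<notin> L" "2 * v \<in> L"
  shows "deriv (wp \<tau>) v = 0"
proof -
  have "deriv (wp \<tau>) (v + - (2 * v)) = deriv (wp \<tau>) v"
    by (rule dwp_per[OF lattice_pts_minus[OF assms(2)] assms(1)])
  thus ?thesis using dwp_minus[OF assms(1)] by simp
qed

lemma wp_half_period:
  assumes "v \<notin> L" "2 * v \<in> L"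
  shows "4 * wp \<tau> v ^ 3 - 12 * eis4 \<tau> * wp \<tau> v + 2 * eis6 \<tau> = 0"
  using wp_ode1[OF assms(1)] dwp_half_period[OF assms] by simp

lemma wp_shift_fps:
  assumes v: "v \<notin> L"
  obtains G where "(\<lambda>z. wp \<tau> (v + z)) has_fps_expansion G" "fps_nth G 0 = wp \<tau> v"
    "fps_nth G 1 = deriv (wp \<tau>) v"
    "fps_deriv (fps_deriv G) = fps_const 6 * G ^ 2 - fps_const (6 * eis4 \<tau>)"
proof -
  define f where "f z = wp \<tau> (v + z)" for z
  have "wp \<tau> analytic_on {v}"
    using wp_holo open_compl_L v by (meson ComplI analytic_at)
  hence G: "f has_fps_expansion fps_expansion (wp \<tau>) v"
    unfolding f_def by (rule analytic_at_imp_has_fps_expansion)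
  have ev: "eventually (\<lambda>z. v + z \<notin> L) (nhds 0)"
  proof -
    have "eventually (\<lambda>z. v + z \<in> - L) (nhds 0)"
      by (rule eventually_compose_filterlim[OF eventually_nhds_in_open[OF open_compl_L, of v]])
         (use v in \<open>auto intro!: tendsto_eq_intros filterlim_ident\<close>)
    thus ?thesis by simp
  qed
  have df: "deriv f z = deriv (wp \<tau>) (v + z)" if "v + z \<notin> L" for z
  proof -
    have "(f has_field_derivative deriv (wp \<tau>) (v + z) * 1) (at z)"
      unfolding f_def
      by (rule DERIV_chain2[where f = "wp \<tau>" and g = "\<lambda>z. v + z", OF D_wp[OF that]]) (auto intro!: derivative_eq_intros)
    thus ?thesis by (simp add: DERIV_imp_deriv)
  qed
  have D2: "(deriv (wp \<tau>) has_field_derivative deriv (deriv (wp \<tau>)) z) (at z)" if "z \<notin> L" for z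
    using dwp_holo open_compl_L that by (intro holomorphic_derivI) auto
  have "eventually (\<lambda>z. deriv (deriv f) z = 6 * f z ^ 2 - 6 * eis4 \<tau>) (nhds 0)"
    using ev ev[THEN eventually_eventually[THEN iffD2]]
  proof eventually_elim
    case (elim z)
    have "eventually (\<lambda>w. deriv f w = deriv (wp \<tau>) (v + w)) (nhds z)"
      using elim(2) by eventually_elim (rule df)
    hence "deriv (deriv f) z = deriv (\<lambda>w. deriv (wp \<tau>) (v + w)) z" by (intro deriv_cong_ev) auto
    also have "((\<lambda>w. deriv (wp \<tau>) (v + w)) has_field_derivative deriv (deriv (wp \<tau>)) (v + z) * 1) (at z)"
      by (rule DERIV_chain2[where f = "deriv (wp \<tau>)" and g = "\<lambda>z. v + z", OF D2[OF elim(1)]])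
         (auto intro!: derivative_eq_intros)
    hence "deriv (\<lambda>w. deriv (wp \<tau>) (v + w)) z = deriv (deriv (wp \<tau>)) (v + z)" by (simp add: DERIV_imp_deriv)
    finally show ?case using wp_ode2(1)[OF elim(1)] by (simp add: f_def)
  qed
  moreover have "deriv (deriv f) has_fps_expansion fps_deriv (fps_deriv (fps_expansion (wp \<tau>) v))"
    by (intro fps_expansion_intros G)
  moreover have "(\<lambda>z. 6 * f z ^ 2 - 6 * eis4 \<tau>) has_fps_expansion
      fps_const 6 * fps_expansion (wp \<tau>) v ^ 2 - fps_const (6 * eis4 \<tau>)"
    by (intro fps_expansion_intros G)
  ultimately have "fps_deriv (fps_deriv (fps_expansion (wp \<tau>) v)) =
      fps_const 6 * fps_expansion (wp \<tau>) v ^ 2 - fps_const (6 * eis4 \<tau>)"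
    by (intro fps_expansion_unique_at) (auto simp: eventually_at_filter elim: eventually_mono)
  moreover have "fps_nth (fps_expansion (wp \<tau>) v) 0 = wp \<tau> v" "fps_nth (fps_expansion (wp \<tau>) v) 1 = deriv (wp \<tau>) v"
    by (simp_all add: fps_expansion_def)
  ultimately show ?thesis using that G unfolding f_def by blast
qed

text \<open>At 0 the double pole of the first factor meets the double zero of the second, and
  translation by v merely swaps the factors. The product is thus elliptic for the finer lattice
  spanned by \<open>per1\<close> and \<open>v\<close>, with 0 as its only class of singularities.
  The constant is half the second derivative of \<open>wp\<close> at v.\<close>

lemma wp_half_translate:
  fixes t :: int
  defines "v \<equiv> (of_int t * per1 - per2) / 2"
  assumes z: "z \<notin> lattice_pts per1 v"
  shows "(wp \<tau> z - wp \<tau> v) * (wp \<tau> (z + v) - wp \<tau> v) = 3 * wp \<tau> v ^ 2 - 3 * eis4 \<tau>"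
    and "v \<notin> L"
proof -
  define e where "e = wp \<tau> v"
  interpret half: period_lattice per1 v
    by standard (use Im_pos in \<open>simp add: v_def per2_def diff_divide_distrib\<close>)
  have sub: "z \<in> half.L" if "z \<in> L" for z
  proof -
    from that obtain m n where "z = of_int m * per1 + of_int n * per2" by (auto simp: lattice_pts_def)
    hence "z = of_int (m + n * t) * per1 + of_int (- 2 * n) * v" by (simp add: v_def field_simps)
    thus ?thesis by (rule lattice_ptsI)
  qed
  have sub': "z + v \<notin> L" if "z \<notin> half.L" for z
    using sub[of "z + v"] that lattice_pts_add_iff(1)[of v per1 v z] by auto
  have v2: "2 * v \<in> L" by (rule lattice_ptsI[of _ t _ "-1"]) (simp add: v_def)
  show v: "v \<notin> L"
  proof
    assume "v \<in> L"
    then obtain m n where eq: "(of_int t * per1 - per2) / 2 = of_int m * per1 + of_int n * per2"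
      by (auto simp: lattice_pts_def v_def)
    have "Im (((of_int t * per1 - per2) / 2) / per1) = Im ((of_int m * per1 + of_int n * per2) / per1)"
      by (simp only: eq)
    hence "- Im \<tau> / 2 = of_int n * Im \<tau>"
      by (simp add: per2_def diff_divide_distrib add_divide_distrib)
    hence "Im \<tau> * (2 * of_int n + 1) = 0" by (simp add: algebra_simps)
    hence "2 * real_of_int n + 1 = 0" using Im_pos by simp
    hence "2 * n + 1 = 0" by linarith
    thus False by presburger
  qed
  obtain G where G: "(\<lambda>z. wp \<tau> (v + z)) has_fps_expansion G" "fps_nth G 0 = wp \<tau> v"
    "fps_nth G 1 = deriv (wp \<tau>) v" "fps_deriv (fps_deriv G) = fps_const 6 * G ^ 2 - fps_const (6 * eis4 \<tau>)"
    using wp_shift_fps[OF v] by blast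
  have G2: "fps_nth G 2 = 3 * e ^ 2 - 3 * eis4 \<tau>"
    using arg_cong[OF G(4), of "\<lambda>F. fps_nth F 0"] G(2) by (simp add: e_def eval_nat_numeral algebra_simps) algebra
  have "(\<lambda>z. wp \<tau> (v + z) - e) has_fps_expansion G - fps_const e"
    by (intro fps_expansion_intros G)
  moreover have "fps_nth (G - fps_const e) k = 0" if "k < 2" for k
    using that G dwp_half_period[OF v v2] by (auto simp: less_2_cases_iff e_def)
  ultimately obtain s where s: "s has_fps_expansion fps_shift 2 (G - fps_const e)"
    "\<And>z. z \<noteq> 0 \<Longrightarrow> s z = (wp \<tau> (v + z) - e) / z ^ 2"
    using has_fps_expansion_div_power[of _ _ 2] by blast
  obtain p where p: "p has_fps_expansion pfps \<tau>" "eventually (\<lambda>z. wp \<tau> z = 1 / z ^ 2 + p z) (at 0)"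
    using wp_near by blast
  define g where "g z = (1 + z ^ 2 * (p z - e)) * s z" for z
  define f where "f z = (wp \<tau> z - e) * (wp \<tau> (z + v) - e)" for z
  have g0: "g 0 = 3 * e ^ 2 - 3 * eis4 \<tau>"
    using has_fps_expansion_imp_0_eq_fps_nth_0[OF s(1)] G2 by (simp add: g_def numeral_2_eq_2)
  have "f z = g 0"
  proof (rule half.elliptic_const[of f g])
    have A: "wp \<tau> holomorphic_on - half.L"
      by (rule holomorphic_on_subset[OF wp_holo]) (use sub in auto)
    have B: "(\<lambda>z. wp \<tau> (z + v)) holomorphic_on - half.L"
      by (rule holomorphic_on_compose_gen[OF _ wp_holo, unfolded o_def])
         (use sub' in \<open>auto intro!: holomorphic_intros\<close>)
    show "f holomorphic_on - half.L" unfolding f_def by (intro holomorphic_intros A B)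
    fix z assume z: "z \<notin> half.L"
    hence zL: "z \<notin> L" "z + v \<notin> L" using sub sub' by auto
    show "f (z + per1) = f z"
      using wp_per12(1)[OF zL(1)] wp_per12(1)[OF zL(2)] by (simp add: f_def add_ac)
    show "f (z + v) = f z"
      using wp_per[OF v2 zL(1)] by (simp add: f_def add_ac mult_2 mult.commute)
  next
    show "g analytic_on {0}" unfolding g_def
      by (intro analytic_intros has_fps_expansion_imp_analytic_0[OF p(1)] has_fps_expansion_imp_analytic_0[OF s(1)])
    show "eventually (\<lambda>z. f z = g z) (at 0)"
      using p(2) eventually_neq_at_within[of 0]
    proof eventually_elim
      case (elim z)
      show ?case unfolding f_def g_def s(2)[OF elim(2)] elim(1) using elim(2)
        by (simp add: field_simps)
    qed
  qed (use z in auto)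
  thus "(wp \<tau> z - wp \<tau> v) * (wp \<tau> (z + v) - wp \<tau> v) = 3 * wp \<tau> v ^ 2 - 3 * eis4 \<tau>"
    by (simp add: f_def g0 e_def)
qed

text \<open>If both invariants vanished, so would \<open>wp\<close> at a half period and then, by the translation formula,
  in a neighbourhood of it.\<close>
lemma eis4_eis6_nonzero: "eis4 \<tau> \<noteq> 0 \<or> eis6 \<tau> \<noteq> 0"
proof (rule ccontr)
  assume "\<not> ?thesis"
  hence ab: "eis4 \<tau> = 0" "eis6 \<tau> = 0" by auto
  define v where "v = (of_int 0 * per1 - per2) / 2"
  have v: "v = - per2 / 2" by (simp add: v_def)
  interpret half: period_lattice per1 v
    by standard (use Im_pos in \<open>simp add: v per2_def\<close>)
  note tr = wp_half_translate[of _ 0, folded v_def]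
  \<comment> \<open>The second conclusion of the translation lemma carries its premise on z; any
    point off the finer lattice discharges it.\<close>
  have vL: "v \<notin> L" 
    using tr(2) half.eventually_not_lattice[of 0] eventually_happens trivial_limit_at[of "0 :: complex"] by blast
  have "4 * wp \<tau> v ^ 3 = 0"
    using wp_half_period[OF vL] ab lattice_ptsI[of "2 * v" 0 per1 "-1" per2] by (simp add: v)
  hence e: "wp \<tau> v = 0" by simp
  obtain p where p: "p has_fps_expansion pfps \<tau>" "eventually (\<lambda>z. wp \<tau> z = 1 / z ^ 2 + p z) (at 0)"
    using wp_near by blast
  have p0: "p 0 = 0" using has_fps_expansion_imp_0_eq_fps_nth_0[OF p(1)] pfps_nth(1) by simp
  have "(p \<longlongrightarrow> 0) (at 0)"
    using has_fps_expansion_imp_continuous[OF p(1), of UNIV] p0 by (simp add: continuous_within)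
  hence "eventually (\<lambda>z. norm (p z) < 1) (at 0)"
    by (auto dest: tendsto_norm_zero intro!: order_tendstoD)
  moreover have "eventually (\<lambda>z :: complex. z \<in> ball 0 1) (at 0)" by (intro eventually_at_in_open') auto
  ultimately have nz: "eventually (\<lambda>z. wp \<tau> z \<noteq> 0) (at 0)"
    using p(2) eventually_neq_at_within[of 0]
  proof eventually_elim
    case (elim z)
    have "norm (z ^ 2) * norm (p z) < 1 * 1"
      unfolding norm_power using elim by (intro mult_strict_mono power_less_one_iff[THEN iffD2]) auto
    moreover have "wp \<tau> z * z ^ 2 = 1 + z ^ 2 * p z" using elim by (simp add: field_simps)
    moreover have "z ^ 2 * p z \<noteq> - 1" using calculation(1) by (metis mult_1 norm_minus_cancel norm_mult norm_one order_less_irrefl)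
    ultimately show ?case by (auto simp: add_eq_0_iff)
  qed
  have "eventually (\<lambda>z. wp \<tau> (z + v) = 0) (at 0)"
    using nz half.eventually_not_lattice[of 0] by eventually_elim (use tr(1) ab e in auto)
  then obtain U where U: "open U" "0 \<in> U" "\<And>z. z \<in> U \<Longrightarrow> z \<noteq> 0 \<Longrightarrow> wp \<tau> (z + v) = 0"
    unfolding eventually_at_topological by blast
  \<comment> \<open>An open strip without lattice points that contains v and has 0 on its boundary.
    Continuation from v makes \<open>wp\<close> vanish on it, which contradicts the pole at
    0.\<close>
  define S where "S = {z. Re z > 0} \<inter> {z. Re z < 2 * pi * Im \<tau>}"
  have S: "open S" "connected S"
    unfolding S_def by (auto intro!: open_Int open_halfspace_Re_gt open_halfspace_Re_lt convex_connected
      convex_Int convex_halfspace_Re_gt convex_halfspace_Re_lt)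
  have SL: "S \<subseteq> - L"
  proof safe
    fix z assume z: "z \<in> S" "z \<in> L"
    then obtain m n where "z = of_int m * per1 + of_int n * per2" by (auto simp: lattice_pts_def)
    hence "Re z = - of_int n * (2 * pi * Im \<tau>)" by (simp add: per2_def)
    with z have "0 < real_of_int (- n) * (2 * pi * Im \<tau>)" "real_of_int (- n) * (2 * pi * Im \<tau>) < 1 * (2 * pi * Im \<tau>)"
      by (auto simp: S_def)
    moreover have "2 * pi * Im \<tau> > 0" using Im_pos by simp
    ultimately have "0 < real_of_int (- n)" "real_of_int (- n) < 1"
      using zero_less_mult_pos2 mult_less_cancel_right_pos by blast+
    hence "0 < - n" "- n < 1" by linarith+
    thus False by linarith
  qed
  have vS: "v \<in> S" using Im_pos by (simp add: v S_def per2_def)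
  define U' where "U' = {z \<in> S. z - v \<in> U}"
  have "open U'"
  proof -
    have "U' = S \<inter> (\<lambda>z. z + v) ` U" by (force simp: U'_def image_iff)
    thus ?thesis using S U by (auto intro: open_translation_subtract open_translation simp: add.commute[of _ v])
  qed
  moreover have "v \<in> U'" using vS U by (simp add: U'_def)
  ultimately have "v islimpt U'" by (simp add: interior_limit_point interior_open)
  have "wp \<tau> z = 0" if "z \<in> S" for z
  proof (rule analytic_continuation[OF holomorphic_on_subset[OF wp_holo SL] S _ vS \<open>v islimpt U'\<close> _ that])
    fix z assume "z \<in> U'"
    thus "wp \<tau> z = 0" using U(3)[of "z - v"] e by (cases "z = v") (auto simp: U'_def)
  qed (auto simp: U'_def)
  moreover have "\<exists>z\<in>S. wp \<tau> z \<noteq> 0"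
  proof -
    obtain r where r: "r > 0" "\<And>z. z \<noteq> 0 \<Longrightarrow> dist z 0 < r \<Longrightarrow> wp \<tau> z \<noteq> 0"
      using nz unfolding eventually_at by auto
    define x where "x = min (r / 2) (pi * Im \<tau>)"
    have "x > 0" "x < r" "x < 2 * pi * Im \<tau>"
      using r Im_pos pi_gt_zero by (auto simp: x_def min_def)
    thus ?thesis using r(2)[of "of_real x"] by (intro bexI[of _ "of_real x"]) (auto simp: S_def)
  qed
  ultimately show False by blast
qed

end

section \<open>Complex multiplication\<close>

text \<open>In even degree the derivative enters only through its square, so these coefficients are
  polynomials in the value x. In odd degree the contributions of v and -v cancel.\<close>

lemma wp_taylor_coeffs:
  fixes G :: "complex fps" and a b x :: complex
  assumes G0: "fps_nth G 0 = x" and G1: "fps_nth G 1 ^ 2 = 4 * x ^ 3 - 12 * a * x + 2 * b"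
    and ode: "fps_deriv (fps_deriv G) = fps_const 6 * G ^ 2 - fps_const (6 * a)"
  shows "fps_nth G 2 = 3 * x ^ 2 - 3 * a"
    "fps_nth G 4 = 5 * x ^ 3 - 9 * a * x + b"
    "fps_nth G 6 = 7 * x ^ 4 - 84 / 5 * a * x ^ 2 + 2 * b * x + 9 / 5 * a ^ 2"
    "fps_nth G 8 = 9 * x ^ 5 - 27 * a * x ^ 3 + 45 / 14 * b * x ^ 2 + 54 / 5 * a ^ 2 * x - 99 / 70 * a * b"
proof -
  define g where "g = fps_nth G"
  have rec: "of_nat ((n + 1) * (n + 2)) * g (n + 2) = 6 * (\<Sum>i=0..n. g i * g (n - i)) - (if n = 0 then 6 * a else 0)" for n
    using arg_cong[OF ode, of "\<lambda>F. fps_nth F n"]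
    by (auto simp: g_def fps_square_nth atLeast0AtMost algebra_simps)
  have g0: "g 0 = x" using G0 by (simp add: g_def)
  have g1: "g 1 ^ 2 = 4 * x ^ 3 - 12 * a * x + 2 * b" using G1 by (simp add: g_def)
  have g2: "g 2 = 3 * x ^ 2 - 3 * a" using rec[of 0] g0 by (simp add: numeral_2_eq_2 algebra_simps) algebra
  have "6 * g 3 = 12 * x * g 1" using rec[of 1] g0 by (simp add: eval_nat_numeral algebra_simps)
  hence g3: "g 3 = 2 * x * g 1" by simp
  have "12 * g 4 = 6 * (2 * x * g 2 + g 1 ^ 2)" using rec[of 2] g0 by (simp add: eval_nat_numeral algebra_simps)
  hence g4: "g 4 = 5 * x ^ 3 - 9 * a * x + b" unfolding g1 g2 by algebra
  have "20 * g 5 = 12 * (x * g 3 + g 1 * g 2)" using rec[of 3] g0 by (simp add: eval_nat_numeral algebra_simps)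
  hence "5 * g 5 = 3 * g 1 * (5 * x ^ 2 - 3 * a)" unfolding g3 g2 by algebra
  hence g5: "g 5 = 3 / 5 * g 1 * (5 * x ^ 2 - 3 * a)" by (simp add: field_simps)
  have "30 * g 6 = 6 * (2 * x * g 4 + 2 * g 1 * g 3 + g 2 ^ 2)" using rec[of 4] g0 by (simp add: eval_nat_numeral algebra_simps)
  hence "5 * g 6 = 35 * x ^ 4 - 84 * a * x ^ 2 + 10 * b * x + 9 * a ^ 2" 
    using g1 unfolding g3 g2 g4 by algebra
  hence g6: "g 6 = 7 * x ^ 4 - 84 / 5 * a * x ^ 2 + 2 * b * x + 9 / 5 * a ^ 2" by (simp add: field_simps)
  have "56 * g 8 = 6 * (2 * x * g 6 + 2 * g 1 * g 5 + 2 * g 2 * g 4 + g 3 ^ 2)" using rec[of 6] g0 by (simp add: eval_nat_numeral algebra_simps)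
  also have "2 * g 1 * g 5 = 6 / 5 * g 1 ^ 2 * (5 * x ^ 2 - 3 * a)" unfolding g5 by (simp add: power2_eq_square)
  also have "g 3 ^ 2 = 4 * x ^ 2 * g 1 ^ 2" unfolding g3 by (simp add: power2_eq_square)
  finally have "g 8 = 6 / 56 * (2 * x * g 6 + 6 / 5 * g 1 ^ 2 * (5 * x ^ 2 - 3 * a) + 2 * g 2 * g 4 + 4 * x ^ 2 * g 1 ^ 2)"
    by (simp add: field_simps) algebra
  hence g8: "g 8 = 9 * x ^ 5 - 27 * a * x ^ 3 + 45 / 14 * b * x ^ 2 + 54 / 5 * a ^ 2 * x - 99 / 70 * a * b"
    unfolding g1 g2 g4 g6 by (simp add: field_simps) (simp add: eval_nat_numeral algebra_simps, algebra)
  show "fps_nth G 2 = 3 * x ^ 2 - 3 * a"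
    "fps_nth G 4 = 5 * x ^ 3 - 9 * a * x + b"
    "fps_nth G 6 = 7 * x ^ 4 - 84 / 5 * a * x ^ 2 + 2 * b * x + 9 / 5 * a ^ 2"
    "fps_nth G 8 = 9 * x ^ 5 - 27 * a * x ^ 3 + 45 / 14 * b * x ^ 2 + 54 / 5 * a ^ 2 * x - 99 / 70 * a * b"
    using g2 g4 g6 g8 by (simp_all only: g_def)
qed

text \<open>Here t is the trace and N the norm of \<tau>; N is also the order of the kernel of
  multiplication by \<tau>.\<close>

locale cm_lattice = upper +
  fixes N :: nat and t :: int
  assumes tau_sq: "\<tau> ^ 2 = of_int t * \<tau> - of_nat N" and N_pos: "N > 0"
begin

text \<open>A generator of the kernel: the kernel is L/\<tau> modulo L, and L/\<tau> is spanned by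
  \<open>per1\<close> and \<open>v1\<close>.\<close>

definition v1 :: complex where "v1 = per1 / \<tau>"

lemma tau_nz: "\<tau> \<noteq> 0" using Im_pos by auto

lemma N_v1: "of_nat N * v1 = of_int t * per1 - per2"
proof -
  have "of_nat N = (of_int t - \<tau>) * \<tau>" using tau_sq by (simp add: algebra_simps power2_eq_square)
  hence "of_nat N * v1 = (of_int t - \<tau>) * per1" using tau_nz by (simp add: v1_def)
  thus ?thesis by (simp add: per2_def algebra_simps)
qed

sublocale M: period_lattice per1 v1
proof
  have "v1 / per1 = 1 / \<tau>" by (simp add: v1_def)
  moreover have "Im (1 / \<tau>) \<noteq> 0" using Im_pos tau_nz by (simp add: Im_divide complex_eq_iff)
  ultimately show "Im (v1 / per1) \<noteq> 0" by simp
qed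

lemma L_subset: "z \<in> L \<Longrightarrow> z \<in> M.L"
proof -
  assume "z \<in> L"
  then obtain m n where "z = of_int m * per1 + of_int n * per2" by (auto simp: lattice_pts_def)
  moreover have "per2 = of_int t * per1 - of_nat N * v1" using N_v1 by simp
  ultimately have "z = of_int (m + n * t) * per1 + of_int (- n * int N) * v1" by (simp add: algebra_simps)
  thus ?thesis by (rule lattice_ptsI)
qed

lemma tau_mult_L: "\<tau> * z \<in> L \<Longrightarrow> z \<in> M.L"
proof -
  assume "\<tau> * z \<in> L"
  then obtain m n where "\<tau> * z = of_int m * per1 + of_int n * per2" by (auto simp: lattice_pts_def)
  hence "z = of_int n * per1 + of_int m * v1" using tau_nz by (simp add: v1_def per2_def field_simps)
  thus ?thesis by (rule lattice_ptsI)
qed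

lemma nat_v1_M: "of_nat j * v1 \<in> M.L" by (rule lattice_ptsI[of _ 0 _ "int j"]) simp

lemma shift_not_L: "z \<notin> M.L \<Longrightarrow> z + of_nat j * v1 \<notin> L"
  using L_subset[of "z + of_nat j * v1"] nat_v1_M[of j] by auto

text \<open>The kernel is cyclic of exact order N: after multiplication by N, comparing imaginary
  parts shows that N divides j.\<close>

lemma nat_v1_not_L:
  assumes "0 < j" "j < N"
  shows "of_nat j * v1 \<notin> L"
proof
  assume "of_nat j * v1 \<in> L"
  then obtain m n where "of_nat j * v1 = of_int m * per1 + of_int n * per2" by (auto simp: lattice_pts_def)
  hence "of_nat N * (of_nat j * v1) = of_nat N * (of_int m * per1 + of_int n * per2)" by simp
  hence "of_nat j * (of_int t * per1 - per2) = of_nat N * (of_int m * per1 + of_int n * per2)"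
    unfolding N_v1[symmetric] by (simp add: mult_ac)
  hence "per1 * (of_nat j * (of_int t - \<tau>)) = per1 * (of_nat N * (of_int m + of_int n * \<tau>))"
    by (simp add: per2_def algebra_simps)
  hence "of_nat j * (of_int t - \<tau>) = of_nat N * (of_int m + of_int n * \<tau>)"
    by (simp only: mult_cancel_left) simp
  hence "Im (of_nat j * (of_int t - \<tau>)) = Im (of_nat N * (of_int m + of_int n * \<tau>))" by (simp only:)
  hence "Im \<tau> * (of_int (int j) + of_int (int N * n)) = 0" by (simp add: algebra_simps)
  hence "real_of_int (int j + int N * n) = 0" using Im_pos by simp
  hence "int j + int N * n = 0" by (simp only: of_int_eq_0_iff)
  hence "int N dvd int j" by (metis dvd_add_left_iff dvd_triv_left dvd_0_right)
  thus False using assms zdvd_not_zless[of "int j" "int N"] by simp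
qed

definition torsion_wp :: "nat \<Rightarrow> complex" where "torsion_wp j = wp \<tau> (of_nat j * v1)"

lemma torsion_wp_reflect:
  assumes "0 < j" "j < N"
  shows "torsion_wp (N - j) = torsion_wp j"
proof -
  have "of_nat (N - j) * v1 = - (of_nat j * v1) + (of_int t * per1 - per2)"
    using assms by (simp add: of_nat_diff left_diff_distrib N_v1)
  moreover have "of_int t * per1 - per2 \<in> L" by (rule lattice_ptsI[of _ t _ "-1"]) simp
  ultimately show ?thesis
    using wp_per[of "of_int t * per1 - per2" "- (of_nat j * v1)"] wp_minus[OF nat_v1_not_L[OF assms]]
      nat_v1_not_L[OF assms] by (simp add: torsion_wp_def)
qed

text \<open>Obtained by differentiating a constant. The linear term of \<open>H\<close> absorbs two
  increments: that of \<tau> \<open>qzeta\<close>(\<tau> z) along \<open>per1\<close>, and that of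
  the kernel sum along \<open>v1\<close>, where reindexing leaves a single translation by N v1 = t
  per1 - per2.\<close>

lemma wp_sum:
  assumes z: "z \<notin> M.L"
  shows "(\<Sum>j<N. wp \<tau> (z + of_nat j * v1)) = (of_nat N - \<tau> ^ 2) * eis2 \<tau> - \<tau> / per1 + \<tau> ^ 2 * wp \<tau> (\<tau> * z)"
proof -
  define H where "H z = (\<Sum>j<N. qzeta \<tau> (z + of_nat j * v1)) - \<tau> * qzeta \<tau> (\<tau> * z) - \<tau> / per1 * z" for z
  obtain w where w: "w has_fps_expansion wfps \<tau>" "eventually (\<lambda>z. qzeta \<tau> z = 1 / z + w z) (at 0)"
    using qzeta_near by blast
  \<comment> \<open>At 0 the term j = 0 and the scaled zeta function both have the pole 1/z, so it
    cancels.\<close>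
  define g where "g z = (\<Sum>j\<in>{1..<N}. qzeta \<tau> (z + of_nat j * v1)) + w z - \<tau> * w (\<tau> * z) - \<tau> / per1 * z" for z
  have A: "(\<lambda>z. qzeta \<tau> (z + of_nat j * v1)) holomorphic_on - M.L" for j
    by (rule holomorphic_on_compose_gen[OF _ qzeta_holo, unfolded o_def])
       (use shift_not_L in \<open>auto intro!: holomorphic_intros\<close>)
  have B: "(\<lambda>z. qzeta \<tau> (\<tau> * z)) holomorphic_on - M.L"
    by (rule holomorphic_on_compose_gen[OF _ qzeta_holo, unfolded o_def])
       (use tau_mult_L in \<open>auto intro!: holomorphic_intros\<close>)
  have H: "H z = g 0" if "z \<notin> M.L" for z
  proof (rule M.elliptic_const[of H g])
    show "H holomorphic_on - M.L" unfolding H_def by (intro holomorphic_intros A B)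
    fix z assume z: "z \<notin> M.L"
    have \<tau>z: "\<tau> * z \<notin> L" using z tau_mult_L by blast
    have 0: "qzeta \<tau> (\<tau> * (z + per1)) = qzeta \<tau> (\<tau> * z) - 1"
      using qzeta_per2[OF \<tau>z] by (simp add: per2_def algebra_simps)
    moreover have "qzeta \<tau> (z + per1 + of_nat j * v1) = qzeta \<tau> (z + of_nat j * v1)" for j
      using qzeta_per1[of "z + of_nat j * v1"] by (simp add: add_ac)
    moreover have "\<tau> / per1 * (z + per1) = \<tau> / per1 * z + \<tau>" by (simp add: distrib_left)
    ultimately show "H (z + per1) = H z" unfolding H_def by (simp add: right_diff_distrib)
    have "\<tau> * (z + v1) = \<tau> * z + per1" using tau_nz by (simp add: v1_def field_simps)
    hence 1: "qzeta \<tau> (\<tau> * (z + v1)) = qzeta \<tau> (\<tau> * z)" using qzeta_per1[of "\<tau> * z"] by simp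
    have "(\<Sum>j<N. qzeta \<tau> (z + v1 + of_nat j * v1)) + qzeta \<tau> z = (\<Sum>j<Suc N. qzeta \<tau> (z + of_nat j * v1))"
      by (subst sum.lessThan_Suc_shift) (simp add: algebra_simps)
    moreover have "qzeta \<tau> (z + of_nat N * v1) = qzeta \<tau> z + 1"
    proof -
      have "exp (z - per2 + of_int t * per1) = exp (z - per2)"
        using exp_plus_2pin[of "z - per2" t] by (simp add: mult_ac)
      hence "qzeta \<tau> (z - per2 + of_int t * per1) = qzeta \<tau> (z - per2)"
        unfolding qzeta_def exp_minus by simp
      moreover have "z - per2 \<notin> L" using z L_subset[of z] by auto
      ultimately show ?thesis using qzeta_per2[of "z - per2"] unfolding N_v1 by (simp add: algebra_simps)
    qed
    ultimately have 2: "(\<Sum>j<N. qzeta \<tau> (z + v1 + of_nat j * v1)) = (\<Sum>j<N. qzeta \<tau> (z + of_nat j * v1)) + 1"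
      by simp
    have 3: "\<tau> / per1 * v1 = 1" using tau_nz by (simp add: v1_def)
    have "\<tau> / per1 * (z + v1) = \<tau> / per1 * z + 1" by (simp only: distrib_left 3)
    thus "H (z + v1) = H z" unfolding H_def 1 2 by simp
  next
    have "qzeta \<tau> analytic_on - L" using qzeta_holo open_compl_L by (simp add: analytic_on_open)
    hence "(\<lambda>z. qzeta \<tau> (z + of_nat j * v1)) analytic_on {0}" if "j \<in> {1..<N}" for j
      by (intro analytic_on_compose_gen[of "\<lambda>z. z + of_nat j * v1" "{0}" "qzeta \<tau>" "- L", unfolded o_def])
         (use nat_v1_not_L[of j] that in \<open>auto intro!: analytic_intros\<close>)
    thus "g analytic_on {0}" unfolding g_def
      by (intro analytic_intros has_fps_expansion_imp_analytic_0[OF w(1)]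
           has_fps_expansion_imp_analytic_0[OF has_fps_expansion_scale[OF w(1)]])
    have "filterlim (\<lambda>z. \<tau> * z) (at 0) (at 0)"
      using tau_nz by (auto simp: filterlim_at eventually_at_filter intro!: tendsto_eq_intros)
    from eventually_compose_filterlim[OF w(2) this]
    have w': "eventually (\<lambda>z. qzeta \<tau> (\<tau> * z) = 1 / (\<tau> * z) + w (\<tau> * z)) (at 0)" .
    show "eventually (\<lambda>z. H z = g z) (at 0)"
      using w(2) w' eventually_neq_at_within[of 0]
    proof eventually_elim
      case (elim z)
      have "{..<N} = insert 0 {1..<N}" using N_pos by auto
      hence "(\<Sum>j<N. qzeta \<tau> (z + of_nat j * v1)) = qzeta \<tau> z + (\<Sum>j\<in>{1..<N}. qzeta \<tau> (z + of_nat j * v1))" by simp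
      moreover have "\<tau> * qzeta \<tau> (\<tau> * z) = 1 / z + \<tau> * w (\<tau> * z)"
        unfolding elim(2) using tau_nz by (simp add: distrib_left)
      ultimately show ?case unfolding H_def g_def elim(1) by simp
    qed
  qed (use that in auto)
  have D: "(qzeta \<tau> has_field_derivative (eis2 \<tau> - wp \<tau> z)) (at z)" if "z \<notin> L" for z
    using holomorphic_derivI[OF qzeta_holo open_compl_L, of z] that by (simp add: wp_def)
  have \<tau>z: "\<tau> * z \<notin> L" using z tau_mult_L by blast
  have D1: "((\<lambda>z. qzeta \<tau> (z + of_nat j * v1)) has_field_derivative (eis2 \<tau> - wp \<tau> (z + of_nat j * v1)) * 1) (at z)" for j
    by (rule DERIV_chain2[where f = "qzeta \<tau>" and g = "\<lambda>z. z + of_nat j * v1", OF D[OF shift_not_L[OF z]]])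
       (auto intro!: derivative_eq_intros)
  have D2: "((\<lambda>z. qzeta \<tau> (\<tau> * z)) has_field_derivative (eis2 \<tau> - wp \<tau> (\<tau> * z)) * \<tau>) (at z)"
    by (rule DERIV_chain2[where f = "qzeta \<tau>" and g = "\<lambda>z. \<tau> * z", OF D[OF \<tau>z]])
       (auto intro!: derivative_eq_intros)
  have "(H has_field_derivative (\<Sum>j<N. (eis2 \<tau> - wp \<tau> (z + of_nat j * v1)) * 1) -
      \<tau> * ((eis2 \<tau> - wp \<tau> (\<tau> * z)) * \<tau>) - \<tau> / per1 * 1) (at z)"
    unfolding H_def by (intro DERIV_diff DERIV_sum DERIV_cmult D1 D2 DERIV_ident)
  moreover have "(H has_field_derivative 0) (at z)"
  proof -
    have "eventually (\<lambda>w. w \<in> - M.L) (nhds z)"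
      using M.closed_lattice z by (intro eventually_nhds_in_open) (auto simp: open_Compl)
    hence "eventually (\<lambda>w. H w = g 0) (nhds z)" by eventually_elim (use H in auto)
    thus ?thesis by (subst DERIV_cong_ev[OF refl _ refl]) auto
  qed
  ultimately have "(\<Sum>j<N. (eis2 \<tau> - wp \<tau> (z + of_nat j * v1)) * 1) -
      \<tau> * ((eis2 \<tau> - wp \<tau> (\<tau> * z)) * \<tau>) - \<tau> / per1 * 1 = 0"
    by (rule DERIV_unique)
  thus ?thesis by (simp add: sum_subtractf algebra_simps power2_eq_square)
qed

text \<open>Degrees 0, 2, 4, 6 and 8 of \<open>wp_sum\<close> once the term j = 0 is moved to the
  right, where it supplies the -1 next to the powers of \<tau>.\<close>

lemma power_sums:
  defines "s \<equiv> \<lambda>f :: complex \<Rightarrow> complex. \<Sum>j\<in>{1..<N}. f (torsion_wp j)" and "a \<equiv> eis4 \<tau>" and "b \<equiv> eis6 \<tau>"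
  shows "s (\<lambda>x. x) = (of_nat N - \<tau> ^ 2) * eis2 \<tau> - \<tau> / per1"
    "s (\<lambda>x. 3 * x ^ 2 - 3 * a) = 3 / 5 * a * (\<tau> ^ 4 - 1)"
    "s (\<lambda>x. 5 * x ^ 3 - 9 * a * x + b) = - b / 14 * (\<tau> ^ 6 - 1)"
    "s (\<lambda>x. 7 * x ^ 4 - 84 / 5 * a * x ^ 2 + 2 * b * x + 9 / 5 * a ^ 2) = 3 / 25 * a ^ 2 * (\<tau> ^ 8 - 1)"
    "s (\<lambda>x. 9 * x ^ 5 - 27 * a * x ^ 3 + 45 / 14 * b * x ^ 2 + 54 / 5 * a ^ 2 * x - 99 / 70 * a * b) =
       - 9 / 770 * a * b * (\<tau> ^ 10 - 1)"
proof -
  define C where "C = (of_nat N - \<tau> ^ 2) * eis2 \<tau> - \<tau> / per1"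
  obtain p where p: "p has_fps_expansion pfps \<tau>" "eventually (\<lambda>z. wp \<tau> z = 1 / z ^ 2 + p z) (at 0)"
    using wp_near by blast
  have "\<exists>G. (\<lambda>z. wp \<tau> (of_nat j * v1 + z)) has_fps_expansion G \<and> fps_nth G 0 = torsion_wp j \<and>
      fps_nth G 1 ^ 2 = 4 * torsion_wp j ^ 3 - 12 * a * torsion_wp j + 2 * b \<and>
      fps_deriv (fps_deriv G) = fps_const 6 * G ^ 2 - fps_const (6 * a)" if "j \<in> {1..<N}" for j
  proof -
    have v: "of_nat j * v1 \<notin> L" using that by (intro nat_v1_not_L) auto
    show ?thesis using wp_shift_fps[OF v] wp_ode1[OF v] unfolding torsion_wp_def a_def b_def by metis
  qed
  then obtain G where G: "\<And>j. j \<in> {1..<N} \<Longrightarrow> (\<lambda>z. wp \<tau> (of_nat j * v1 + z)) has_fps_expansion G j"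
      "\<And>j. j \<in> {1..<N} \<Longrightarrow> fps_nth (G j) 0 = torsion_wp j"
      "\<And>j. j \<in> {1..<N} \<Longrightarrow> fps_nth (G j) 1 ^ 2 = 4 * torsion_wp j ^ 3 - 12 * a * torsion_wp j + 2 * b"
      "\<And>j. j \<in> {1..<N} \<Longrightarrow> fps_deriv (fps_deriv (G j)) = fps_const 6 * G j ^ 2 - fps_const (6 * a)"
    by metis
  have "filterlim (\<lambda>z. \<tau> * z) (at 0) (at 0)"
    using tau_nz by (auto simp: filterlim_at eventually_at_filter intro!: tendsto_eq_intros)
  from eventually_compose_filterlim[OF p(2) this]
  have p': "eventually (\<lambda>z. wp \<tau> (\<tau> * z) = 1 / (\<tau> * z) ^ 2 + p (\<tau> * z)) (at 0)" .
  have ev: "eventually (\<lambda>z. (\<Sum>j\<in>{1..<N}. wp \<tau> (of_nat j * v1 + z)) = C + \<tau> ^ 2 * p (\<tau> * z) - p z) (at 0)"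
    using p(2) p' eventually_neq_at_within[of 0] M.eventually_not_lattice[of 0]
  proof eventually_elim
    case (elim z)
    have "{..<N} = insert 0 {1..<N}" using N_pos by auto
    hence "(\<Sum>j\<in>{1..<N}. wp \<tau> (of_nat j * v1 + z)) = C + \<tau> ^ 2 * wp \<tau> (\<tau> * z) - wp \<tau> z"
      using wp_sum[OF elim(4)] by (simp add: C_def algebra_simps)
    also have "\<dots> = C + \<tau> ^ 2 * p (\<tau> * z) - p z"
      unfolding elim(1,2) using elim(3) tau_nz by (simp add: power_mult_distrib distrib_left)
    finally show ?case .
  qed
  have Gsum: "(\<Sum>j\<in>{1..<N}. G j) = fps_const C + fps_const (\<tau> ^ 2) * Abs_fps (\<lambda>n. \<tau> ^ n * fps_nth (pfps \<tau>) n) - pfps \<tau>"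
  proof (rule fps_expansion_unique_at[OF _ _ ev])
    show "(\<lambda>z. C + \<tau> ^ 2 * p (\<tau> * z) - p z) has_fps_expansion
        fps_const C + fps_const (\<tau> ^ 2) * Abs_fps (\<lambda>n. \<tau> ^ n * fps_nth (pfps \<tau>) n) - pfps \<tau>"
      by (intro has_fps_expansion_diff has_fps_expansion_add has_fps_expansion_const
            has_fps_expansion_cmult_left has_fps_expansion_scale p)
  qed (intro has_fps_expansion_sum G)
  have eq: "(\<Sum>j\<in>{1..<N}. fps_nth (G j) n) = (if n = 0 then C else 0) + (\<tau> ^ (n + 2) - 1) * fps_nth (pfps \<tau>) n" for n
    using arg_cong[OF Gsum, of "\<lambda>F. fps_nth F n"]
    by (simp add: fps_sum_nth power_add algebra_simps power2_eq_square)
  note T = wp_taylor_coeffs[OF G(2,3,4)]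
  show "s (\<lambda>x. x) = (of_nat N - \<tau> ^ 2) * eis2 \<tau> - \<tau> / per1"
    using eq[of 0] G(2) pfps_nth by (simp add: s_def C_def)
  show "s (\<lambda>x. 3 * x ^ 2 - 3 * a) = 3 / 5 * a * (\<tau> ^ 4 - 1)"
    using eq[of 2] pfps_nth by (simp add: s_def T(1) a_def)
  show "s (\<lambda>x. 5 * x ^ 3 - 9 * a * x + b) = - b / 14 * (\<tau> ^ 6 - 1)"
    using eq[of 4] pfps_nth by (simp add: s_def T(2) b_def)
  show "s (\<lambda>x. 7 * x ^ 4 - 84 / 5 * a * x ^ 2 + 2 * b * x + 9 / 5 * a ^ 2) = 3 / 25 * a ^ 2 * (\<tau> ^ 8 - 1)"
    using eq[of 6] pfps_nth68 by (simp add: s_def T(3) a_def)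
  show "s (\<lambda>x. 9 * x ^ 5 - 27 * a * x ^ 3 + 45 / 14 * b * x ^ 2 + 54 / 5 * a ^ 2 * x - 99 / 70 * a * b) =
       - 9 / 770 * a * b * (\<tau> ^ 10 - 1)"
    using eq[of 8] pfps_nth68 by (simp add: s_def T(4) a_def b_def)
qed

end

context cm_lattice
begin

text \<open>With N = \<tau> cnj \<tau> the left side is (cnj \<tau> - \<tau>) \<tau>. This is how
  the term \<tau>/(2 pi i) of the first power sum becomes the non-holomorphic correction of
  E_2.\<close>

lemma tau_cnj: "of_nat N - \<tau> ^ 2 = - 2 * \<i> * of_real (Im \<tau>) * \<tau>"
proof -
  have "2 * Re \<tau> * Im \<tau> = of_int t * Im \<tau>"
    using arg_cong[OF tau_sq, of Im] by (simp add: power2_eq_square algebra_simps)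
  hence "of_int t = 2 * Re \<tau>" using Im_pos by simp
  hence "of_int t = \<tau> + cnj \<tau>" by (simp add: complex_eq_iff)
  hence "of_nat N - \<tau> ^ 2 = (cnj \<tau> - \<tau>) * \<tau>"
    using tau_sq by (simp add: algebra_simps power2_eq_square)
  thus ?thesis by (simp add: complex_eq_iff algebra_simps)
qed

lemma sum_torsion_wp: "(\<Sum>j\<in>{1..<N}. torsion_wp j) = (of_nat N - \<tau> ^ 2) * (eis2 \<tau> - 1 / of_real (4 * pi * Im \<tau>))"
proof -
  have "(of_nat N - \<tau> ^ 2) * (1 / of_real (4 * pi * Im \<tau>)) = \<tau> / per1"
    unfolding tau_cnj using Im_pos by (simp add: field_simps)
  thus ?thesis using power_sums(1) by (simp add: right_diff_distrib)
qed

lemma half_period: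
  assumes "2 * j = N" "0 < j"
  shows "4 * torsion_wp j ^ 3 - 12 * eis4 \<tau> * torsion_wp j + 2 * eis6 \<tau> = 0"
  unfolding torsion_wp_def
proof (rule wp_half_period)
  show "of_nat j * v1 \<notin> L" using assms by (intro nat_v1_not_L) auto
  have "2 * (of_nat j * v1) = of_int t * per1 - per2" unfolding N_v1[symmetric] assms(1)[symmetric] by simp
  also have "\<dots> \<in> L" by (rule lattice_ptsI[of _ t _ "-1"]) simp
  finally show "2 * (of_nat j * v1) \<in> L" .
qed

text \<open>Supplements the power sums for N = 4 and N = 6. The translation formula applies at v1
  because j > 1 keeps v1 out of the lattice spanned by \<open>per1\<close> and j v1.\<close>

lemma half_translate:
  assumes "2 * j = N" "1 < j"
  shows "(torsion_wp 1 - torsion_wp j) * (torsion_wp (Suc j) - torsion_wp j) = 3 * torsion_wp j ^ 2 - 3 * eis4 \<tau>"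
proof -
  have v: "(of_int t * per1 - per2) / 2 = of_nat j * v1"
    unfolding N_v1[symmetric] assms(1)[symmetric] by simp
  have "v1 \<notin> lattice_pts per1 (of_nat j * v1)"
  proof
    assume "v1 \<in> lattice_pts per1 (of_nat j * v1)"
    then obtain m n where mn: "v1 = of_int m * per1 + of_int n * (of_nat j * v1)" by (auto simp: lattice_pts_def)
    define k u where "k = 1 - n * int j" and "u = v1 / per1"
    have "v1 = u * per1" by (simp add: u_def)
    hence "(of_int k * u) * per1 = of_int m * per1" using mn by (simp add: k_def algebra_simps)
    hence "of_int k * u = of_int m" by simp
    from arg_cong[OF this, of Im] have "real_of_int k * Im u = 0" by simp
    hence "k = 0" using M.indep by (simp add: u_def)
    hence "n * int j = 1" by (simp add: k_def)
    hence "int j dvd 1" by (metis dvd_triv_right)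
    thus False using assms(2) by simp
  qed
  from wp_half_translate(1)[of v1 t, unfolded v, OF this] show ?thesis
    by (simp add: torsion_wp_def algebra_simps)
qed

text \<open>Since \<open>wp\<close> is even, j and N - j contribute equally; for even N the half
  period j = N/2 is left over once.\<close>

lemma sum_orbit:
  "N = 1 \<Longrightarrow> (\<Sum>j\<in>{1..<N}. f (torsion_wp j)) = 0"
  "N = 2 \<Longrightarrow> (\<Sum>j\<in>{1..<N}. f (torsion_wp j)) = f (torsion_wp 1)"
  "N = 3 \<Longrightarrow> (\<Sum>j\<in>{1..<N}. f (torsion_wp j)) = 2 * f (torsion_wp 1)"
  "N = 4 \<Longrightarrow> (\<Sum>j\<in>{1..<N}. f (torsion_wp j)) = f (torsion_wp 2) + 2 * f (torsion_wp 1)"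
  "N = 5 \<Longrightarrow> (\<Sum>j\<in>{1..<N}. f (torsion_wp j)) = 2 * f (torsion_wp 1) + 2 * f (torsion_wp 2)"
  "N = 6 \<Longrightarrow> (\<Sum>j\<in>{1..<N}. f (torsion_wp j)) = f (torsion_wp 3) + 2 * f (torsion_wp 2) + 2 * f (torsion_wp 1)"
  for f :: "complex \<Rightarrow> complex"
proof -
  have I: "{1..<2} = {1 :: nat}" "{1..<3} = {1, 2 :: nat}" "{1..<4} = {1, 2, 3 :: nat}"
    "{1..<5} = {1, 2, 3, 4 :: nat}" "{1..<6} = {1, 2, 3, 4, 5 :: nat}"
    by auto
  note r = torsion_wp_reflect[of 1] torsion_wp_reflect[of 2]
  show "N = 1 \<Longrightarrow> (\<Sum>j\<in>{1..<N}. f (torsion_wp j)) = 0" by simp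
  show "N = 2 \<Longrightarrow> (\<Sum>j\<in>{1..<N}. f (torsion_wp j)) = f (torsion_wp 1)" by (simp add: I del: One_nat_def)
  show "N = 3 \<Longrightarrow> (\<Sum>j\<in>{1..<N}. f (torsion_wp j)) = 2 * f (torsion_wp 1)" using r by (simp add: I del: One_nat_def)
  show "N = 4 \<Longrightarrow> (\<Sum>j\<in>{1..<N}. f (torsion_wp j)) = f (torsion_wp 2) + 2 * f (torsion_wp 1)" using r by (simp add: I del: One_nat_def)
  show "N = 5 \<Longrightarrow> (\<Sum>j\<in>{1..<N}. f (torsion_wp j)) = 2 * f (torsion_wp 1) + 2 * f (torsion_wp 2)" using r by (simp add: I del: One_nat_def)
  show "N = 6 \<Longrightarrow> (\<Sum>j\<in>{1..<N}. f (torsion_wp j)) = f (torsion_wp 3) + 2 * f (torsion_wp 2) + 2 * f (torsion_wp 1)" using r by (simp add: I del: One_nat_def)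
qed

end

section \<open>Elimination: solving the kernel equations for each discriminant\<close>

lemma cubic_root_ex: "\<exists>k :: complex. k ^ 3 = b"
proof (cases "b = 0")
  case False
  have "exp (Ln b / 3) ^ 3 = exp (of_nat 3 * (Ln b / 3))" by (rule exp_of_nat_mult[symmetric])
  thus ?thesis using False by (intro exI[of _ "exp (Ln b / 3)"]) simp
qed (intro exI[of _ 0], simp)

lemma cancel_factor: "k * (x - y) = 0 \<Longrightarrow> k \<noteq> 0 \<Longrightarrow> x = (y :: complex)"
  by simp

lemma cancel_factor0: "k * x = 0 \<Longrightarrow> k \<noteq> 0 \<Longrightarrow> x = (0 :: complex)"
  by simp

text \<open>The eliminations below cancel factors from Z[\<tau>]; they are non-zero because \<tau>
  is not real.\<close>

lemma linear_tau_nonzero: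
  assumes "Im \<tau> > 0" "Im c = 0" "Im d = 0" "d \<noteq> 0"
  shows "c + d * \<tau> \<noteq> 0"
proof
  assume "c + d * \<tau> = 0"
  hence "Im (c + d * \<tau>) = 0" by simp
  moreover have "Re d \<noteq> 0" using assms by (auto simp: complex_eq_iff)
  ultimately show False using assms by simp
qed

text \<open>The kernel is trivial, so the sums over it are empty and force y and a to vanish. Only b
  survives, and the scale is a cube root of it.\<close>

lemma values_3:
  fixes \<tau> y a b :: complex
  assumes "\<tau> ^ 2 = \<tau> - 1" "(1 - \<tau> ^ 2) * y = 0" "a * (\<tau> ^ 4 - 1) = 0"
    and im: "Im \<tau> > 0" and ab: "a \<noteq> 0 \<or> b \<noteq> 0"
  shows "\<exists>\<kappa>. \<kappa> \<noteq> 0 \<and> y = 0 \<and> a = 0 \<and> b = \<kappa> ^ 3"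
proof -
  have "2 + (- 1) * \<tau> \<noteq> 0" "1 + 1 * \<tau> \<noteq> 0"
    by (rule linear_tau_nonzero[OF im]; simp)+
  moreover have "(2 + (- 1) * \<tau>) * y = 0" "a * (1 + 1 * \<tau>) = 0" using assms(1-3) by algebra+
  ultimately have "y = 0" "a = 0" by (metis mult_eq_0_iff)+
  moreover obtain \<kappa> where "\<kappa> ^ 3 = b" using cubic_root_ex by blast
  ultimately show ?thesis using ab by (intro exI[of _ \<kappa>]) auto
qed

lemma values_4:
  fixes \<tau> y a b :: complex
  assumes "\<tau> ^ 2 = - 1" "(1 - \<tau> ^ 2) * y = 0" "b * (\<tau> ^ 6 - 1) = 0" and ab: "a \<noteq> 0 \<or> b \<noteq> 0"
  shows "\<exists>\<kappa>. \<kappa> \<noteq> 0 \<and> y = 0 \<and> a = \<kappa> ^ 2 \<and> b = 0"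
proof -
  have "2 * y = 0" "2 * b = 0" using assms(1-3) by algebra+
  thus ?thesis using ab by (intro exI[of _ "csqrt a"]) auto
qed

text \<open>The kernel has one non-zero point, a half period with value e. Then e is a multiple of
  y, the second power sum gives a, and the cubic at the half period gives b. The normalisation y =
  15 \<kappa> clears denominators.\<close>

lemma values_7:
  fixes \<tau> y a b e :: complex
  assumes \<tau>: "\<tau> ^ 2 = \<tau> - 2" and e: "e = (2 - \<tau> ^ 2) * y" "3 * e ^ 2 - 3 * a = 3 / 5 * a * (\<tau> ^ 4 - 1)"
    "4 * e ^ 3 - 12 * a * e + 2 * b = 0" and im: "Im \<tau> > 0" and ab: "a \<noteq> 0 \<or> b \<noteq> 0"
  shows "\<exists>\<kappa>. \<kappa> \<noteq> 0 \<and> y = \<kappa> * 15 \<and> a = \<kappa> ^ 2 * 2625 \<and> b = \<kappa> ^ 3 * 661500"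
proof -
  define \<kappa> where "\<kappa> = y / 15"
  have y: "y = 15 * \<kappa>" by (simp add: \<kappa>_def)
  have e': "e = 15 * (4 - \<tau>) * \<kappa>" using e(1) \<tau> y by algebra
  have "5 * (3 * e ^ 2 - 3 * a) = 3 * a * (\<tau> ^ 4 - 1)" using e(2) by (simp add: field_simps)
  hence "3 * ((2 + (- 1) * \<tau>) * (a - \<kappa> ^ 2 * 2625)) = 0" using e' \<tau> by algebra
  moreover have "2 + (- 1) * \<tau> \<noteq> 0" by (rule linear_tau_nonzero[OF im]) simp_all
  ultimately have a: "a = \<kappa> ^ 2 * 2625" by simp
  have "2 * (b - \<kappa> ^ 3 * 661500) = 0" using e(3) a e' \<tau> by algebra
  hence b: "b = \<kappa> ^ 3 * 661500" by simp
  show ?thesis using y a b ab by (intro exI[of _ \<kappa>]) auto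
qed

lemma values_8:
  fixes \<tau> y a b e :: complex
  assumes \<tau>: "\<tau> ^ 2 = - 2" and e: "e = (2 - \<tau> ^ 2) * y" "3 * e ^ 2 - 3 * a = 3 / 5 * a * (\<tau> ^ 4 - 1)"
    "4 * e ^ 3 - 12 * a * e + 2 * b = 0" and ab: "a \<noteq> 0 \<or> b \<noteq> 0"
  shows "\<exists>\<kappa>. \<kappa> \<noteq> 0 \<and> y = \<kappa> * 5 \<and> a = \<kappa> ^ 2 * 250 \<and> b = \<kappa> ^ 3 * 14000"
proof -
  define \<kappa> where "\<kappa> = y / 5"
  have y: "y = 5 * \<kappa>" by (simp add: \<kappa>_def)
  have e': "e = 20 * \<kappa>" using e(1) \<tau> y by algebra
  have "5 * (3 * e ^ 2 - 3 * a) = 3 * a * (\<tau> ^ 4 - 1)" using e(2) by (simp add: field_simps)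
  hence "24 * (a - \<kappa> ^ 2 * 250) = 0" using e' \<tau> by algebra
  hence a: "a = \<kappa> ^ 2 * 250" by simp
  have "2 * (b - \<kappa> ^ 3 * 14000) = 0" using e(3) a e' by algebra
  hence b: "b = \<kappa> ^ 3 * 14000" by simp
  show ?thesis using y a b ab by (intro exI[of _ \<kappa>]) auto
qed

text \<open>The two non-zero kernel points are opposite and share the value x. In the absence of a
  half period, b comes from the third power sum.\<close>

lemma values_11:
  fixes \<tau> y a b x :: complex
  assumes \<tau>: "\<tau> ^ 2 = \<tau> - 3" and x: "2 * x = (3 - \<tau> ^ 2) * y" "2 * (3 * x ^ 2 - 3 * a) = 3 / 5 * a * (\<tau> ^ 4 - 1)"
    "2 * (5 * x ^ 3 - 9 * a * x + b) = - b / 14 * (\<tau> ^ 6 - 1)" and im: "Im \<tau> > 0" and ab: "a \<noteq> 0 \<or> b \<noteq> 0"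
  shows "\<exists>\<kappa>. \<kappa> \<noteq> 0 \<and> y = \<kappa> * 8 \<and> a = \<kappa> ^ 2 * 352 \<and> b = \<kappa> ^ 3 * 27104"
proof -
  define \<kappa> where "\<kappa> = y / 8"
  have y: "y = 8 * \<kappa>" by (simp add: \<kappa>_def)
  have "2 * (x - 4 * (6 - \<tau>) * \<kappa>) = 0" using x(1) \<tau> y by algebra
  hence x': "x = 4 * (6 - \<tau>) * \<kappa>" by simp
  have t4: "\<tau> ^ 4 = - 5 * \<tau> + 6" and t6: "\<tau> ^ 6 = 16 * \<tau> - 3" using \<tau> by algebra+
  have "5 * (2 * (3 * x ^ 2 - 3 * a)) = 3 * a * (\<tau> ^ 4 - 1)" using x(2) by (simp add: field_simps)
  hence "15 * ((3 + (- 1) * \<tau>) * (a - \<kappa> ^ 2 * 352)) = 0" unfolding t4 using x' \<tau> by algebra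
  moreover have "3 + (- 1) * \<tau> \<noteq> 0" by (rule linear_tau_nonzero[OF im]) simp_all
  ultimately have a: "a = \<kappa> ^ 2 * 352" by simp
  have "14 * (2 * (5 * x ^ 3 - 9 * a * x + b)) = - b * (\<tau> ^ 6 - 1)" using x(3) by (simp add: field_simps)
  hence "8 * ((3 + 2 * \<tau>) * (b - \<kappa> ^ 3 * 27104)) = 0" unfolding t6 using a x' \<tau> by algebra
  moreover have "3 + 2 * \<tau> \<noteq> 0" by (rule linear_tau_nonzero[OF im]) simp_all
  ultimately have b: "b = \<kappa> ^ 3 * 27104" by simp
  show ?thesis using y a b ab by (intro exI[of _ \<kappa>]) auto
qed

text \<open>Here e is the value at the half period 2 v1 and c the value at v1 and 3 v1, which
  translation by the half period exchanges. Elimination leaves a quadratic form in e and c - e over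
  Q(\<tau>) whose discriminant is 5 times a square.\<close>

lemma values_15:
  fixes \<tau> y a b e c :: complex
  assumes \<tau>: "\<tau> ^ 2 = \<tau> - 4" and x: "e + 2 * c = (4 - \<tau> ^ 2) * y" 
    "(3 * e ^ 2 - 3 * a) + 2 * (3 * c ^ 2 - 3 * a) = 3 / 5 * a * (\<tau> ^ 4 - 1)"
    "4 * e ^ 3 - 12 * a * e + 2 * b = 0" "(c - e) ^ 2 = 3 * e ^ 2 - 3 * a"
    and im: "Im \<tau> > 0" and ab: "a \<noteq> 0 \<or> b \<noteq> 0"
  shows "\<exists>\<kappa> s. s ^ 2 = 5 \<and> \<kappa> \<noteq> 0 \<and> y = \<kappa> * (21 + 8 * s) \<and> a = \<kappa> ^ 2 * (1225 + 2080 * s) \<and>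
           b = \<kappa> ^ 3 * (377300 + 640640 * s)"
proof -
  define w where "w = c - e"
  have c: "c = e + w" by (simp add: w_def)
  have a: "3 * a = 3 * e ^ 2 - w ^ 2" using x(4) c by algebra
  have b: "b = 6 * a * e - 2 * e ^ 3"
  proof -
    have "2 * (b - (6 * a * e - 2 * e ^ 3)) = 0" using x(3) by algebra
    thus ?thesis by (rule cancel_factor) simp
  qed
  have t4: "\<tau> ^ 4 = - 7 * \<tau> + 12" using \<tau> by algebra
  have "5 * ((3 * e ^ 2 - 3 * a) + 2 * (3 * c ^ 2 - 3 * a)) = (3 * a) * (\<tau> ^ 4 - 1)" using x(2) by (simp add: field_simps)
  hence quad: "(21 * \<tau> - 33) * e ^ 2 + 60 * e * w + (56 - 7 * \<tau>) * w ^ 2 = 0"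
    unfolding t4 using a c by algebra
  have e: "e \<noteq> 0"
  proof
    assume e: "e = 0"
    have "(56 + (- 7) * \<tau>) * w ^ 2 = 0" using quad e by simp
    moreover have "56 + (- 7) * \<tau> \<noteq> 0" by (rule linear_tau_nonzero[OF im]) simp_all
    ultimately have "w = 0" by simp
    thus False using ab a b e by simp
  qed
  have n1: "(- 24) + 6 * \<tau> \<noteq> 0" by (rule linear_tau_nonzero[OF im]) simp_all
  have n2: "8 + (- 1) * \<tau> \<noteq> 0" by (rule linear_tau_nonzero[OF im]) simp_all
  \<comment> \<open>Completing the square in \<open>quad\<close> gives ((56 - 7\<tau>) w + 30 e)^2 =
    5 ((6\<tau> - 24) e)^2; s is the quotient of the two bases.\<close>
  define s where "s = - ((56 - 7 * \<tau>) * w + 30 * e) / (((- 24) + 6 * \<tau>) * e)"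
  have s1: "s * (((- 24) + 6 * \<tau>) * e) = - ((56 - 7 * \<tau>) * w + 30 * e)"
    using e n1 by (simp add: s_def)
  have "(((- 24) + 6 * \<tau>) * e) ^ 2 * (s ^ 2 - 5) = (s * (((- 24) + 6 * \<tau>) * e)) ^ 2 - 5 * (((- 24) + 6 * \<tau>) * e) ^ 2"
    by (simp add: algebra_simps power2_eq_square)
  also have "\<dots> = ((56 - 7 * \<tau>) * w + 30 * e) ^ 2 - 5 * (((- 24) + 6 * \<tau>) * e) ^ 2"
    unfolding s1 by (simp only: power2_minus)
  also have "\<dots> = 0" using quad \<tau> by algebra
  finally have s: "s ^ 2 = 5" using e n1 by simp
  have "70 * w + e * (35 + 5 * \<tau> + (4 * \<tau> - 32) * s) = 0"
  proof -
    have "6 * (70 * w + e * (35 + 5 * \<tau> + (4 * \<tau> - 32) * s)) = 0" using s1 \<tau> by algebra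
    thus ?thesis by (rule cancel_factor0) simp
  qed
  hence w: "70 * w = - e * (35 + 5 * \<tau> + (4 * \<tau> - 32) * s)" by (simp add: add_eq_0_iff)
  \<comment> \<open>The factor beside e is 8470 times the inverse of 42 - 29\<tau> + 16s +
    12\<tau>s. This scale removes \<tau> from y, a and b.\<close>
  define \<kappa> where "\<kappa> = e * (37 + 21 * \<tau> + 32 * s - 8 * \<tau> * s) / 8470"
  have k: "8470 * \<kappa> = e * (37 + 21 * \<tau> + 32 * s - 8 * \<tau> * s)" by (simp add: \<kappa>_def)
  have "8470 * (e - \<kappa> * (42 - 29 * \<tau> + 16 * s + 12 * \<tau> * s)) = 0" using k s \<tau> by algebra
  hence ek: "e = \<kappa> * (42 - 29 * \<tau> + 16 * s + 12 * \<tau> * s)" by simp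
  have "70 * (w - \<kappa> * (21 + 33 * \<tau> + 8 * s - 22 * \<tau> * s)) = 0" using w s \<tau> unfolding ek by algebra
  hence wk: "w = \<kappa> * (21 + 33 * \<tau> + 8 * s - 22 * \<tau> * s)" by simp
  have "(8 + (- 1) * \<tau>) * (y - \<kappa> * (21 + 8 * s)) = 0" using x(1) c ek wk s \<tau> by algebra
  hence y: "y = \<kappa> * (21 + 8 * s)" using n2 by simp
  have "3 * (a - \<kappa> ^ 2 * (1225 + 2080 * s)) = 0" using a ek wk s \<tau> by algebra
  hence a': "a = \<kappa> ^ 2 * (1225 + 2080 * s)" by simp
  have "b = \<kappa> ^ 3 * (377300 + 640640 * s)" using b a' ek s \<tau> by algebra
  moreover have "\<kappa> \<noteq> 0" using e ek by auto
  ultimately show ?thesis using s y a' by (intro exI[of _ \<kappa>] exI[of _ s]) simp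
qed

text \<open>Here e, f, c are the values at 3 v1, 2 v1, v1. Translation by the half period sends v1
  to 4 v1, which is -2 v1 modulo L, so the product of c - e and f - e is known and their sum S
  becomes the natural unknown.\<close>

lemma values_24:
  fixes \<tau> y a b e f c :: complex
  assumes \<tau>: "\<tau> ^ 2 = - 6" and x: "e + 2 * f + 2 * c = (6 - \<tau> ^ 2) * y"
    "(3 * e ^ 2 - 3 * a) + 2 * (3 * f ^ 2 - 3 * a) + 2 * (3 * c ^ 2 - 3 * a) = 3 / 5 * a * (\<tau> ^ 4 - 1)"
    "(5 * e ^ 3 - 9 * a * e + b) + 2 * (5 * f ^ 3 - 9 * a * f + b) + 2 * (5 * c ^ 3 - 9 * a * c + b) = - b / 14 * (\<tau> ^ 6 - 1)"
    "(7 * e ^ 4 - 84 / 5 * a * e ^ 2 + 2 * b * e + 9 / 5 * a ^ 2) + 2 * (7 * f ^ 4 - 84 / 5 * a * f ^ 2 + 2 * b * f + 9 / 5 * a ^ 2)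
       + 2 * (7 * c ^ 4 - 84 / 5 * a * c ^ 2 + 2 * b * c + 9 / 5 * a ^ 2) = 3 / 25 * a ^ 2 * (\<tau> ^ 8 - 1)"
    "4 * e ^ 3 - 12 * a * e + 2 * b = 0" "(c - e) * (f - e) = 3 * e ^ 2 - 3 * a"
    and ab: "a \<noteq> 0 \<or> b \<noteq> 0"
  shows "\<exists>\<kappa> s. s ^ 2 = 2 \<and> \<kappa> \<noteq> 0 \<and> y = \<kappa> * (21 + 5 * s) \<and> a = \<kappa> ^ 2 * (3514 - 988 * s) \<and>
           b = \<kappa> ^ 3 * (646576 - 181792 * s)"
proof -
  define S where "S = f + c - 2 * e"
  have f: "f = S - c + 2 * e" by (simp add: S_def)
  have t4: "\<tau> ^ 4 = 36" "\<tau> ^ 6 = - 216" "\<tau> ^ 8 = 1296" using \<tau> by algebra+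
  have b: "b = 6 * a * e - 2 * e ^ 3"
  proof -
    have "2 * (b - (6 * a * e - 2 * e ^ 3)) = 0" using x(5) by algebra
    thus ?thesis by (rule cancel_factor) simp
  qed
  have uv: "3 * a = 3 * e ^ 2 - (c - e) * (S - (c - e))" using x(6) f by algebra
  have "5 * ((3 * e ^ 2 - 3 * a) + 2 * (3 * f ^ 2 - 3 * a) + 2 * (3 * c ^ 2 - 3 * a)) = 3 * a * 35" using x(2) t4 by simp
  hence "15 * (2 * S ^ 2 + 4 * e * S - 7 * e ^ 2) = 0" using uv f by algebra
  hence quad: "2 * S ^ 2 + 4 * e * S - 7 * e ^ 2 = 0" by (rule cancel_factor0) simp
  have "14 * ((5 * e ^ 3 - 9 * a * e + b) + 2 * (5 * f ^ 3 - 9 * a * f + b) + 2 * (5 * c ^ 3 - 9 * a * c + b)) = b * 217"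
    unfolding x(3) t4 by simp
  hence lin: "14 * (5 * (5 * e ^ 3 + 6 * e ^ 2 * S + 6 * e * (S ^ 2 - 2 * (3 * e ^ 2 - 3 * a)) + 2 * (S ^ 3 - 3 * (3 * e ^ 2 - 3 * a) * S))
      - 9 * a * (5 * e + 2 * S)) = 147 * (6 * a * e - 2 * e ^ 3)"
    using uv f b by algebra
  have e: "e \<noteq> 0"
  proof
    \<comment> \<open>With e = S = 0 the relation from the third power sum is void, and the fourth
      has to exclude the case.\<close>
    assume e: "e = 0"
    hence "S = 0" "b = 0" using quad b by simp_all
    hence c: "c ^ 2 = 3 * a" "f = - c" using uv f e by (simp_all add: power2_eq_square)
    have "25 * ((7 * e ^ 4 - 84 / 5 * a * e ^ 2 + 2 * b * e + 9 / 5 * a ^ 2) + 2 * (7 * f ^ 4 - 84 / 5 * a * f ^ 2 + 2 * b * f + 9 / 5 * a ^ 2)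
       + 2 * (7 * c ^ 4 - 84 / 5 * a * c ^ 2 + 2 * b * c + 9 / 5 * a ^ 2)) = 3 * a ^ 2 * 1295"
      unfolding x(4) t4 by simp
    hence "700 * (c ^ 2) ^ 2 - 1680 * a * c ^ 2 + 225 * a ^ 2 = 3885 * a ^ 2"
      using c(2) e \<open>b = 0\<close> by (simp add: algebra_simps)
    hence "2400 * a ^ 2 = 0" unfolding c(1) by algebra
    thus False using ab \<open>b = 0\<close> by simp
  qed
  \<comment> \<open>The quadratic reads 2 (S + e)^2 = 9 e^2.\<close>
  define s where "s = 2 * (S + e) / (3 * e)"
  have s1: "3 * (s * e) = 2 * (S + e)" using e by (simp add: s_def)
  have "9 * e ^ 2 * (s ^ 2 - 2) = 0" using s1 quad by algebra
  hence s: "s ^ 2 = 2" using e by simp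
  \<comment> \<open>For s^2 = 2 one has (64 s - 44)(11 + 16 s) = 1564.\<close>
  define \<kappa> where "\<kappa> = e * (11 + 16 * s) / 1564"
  have k: "1564 * \<kappa> = e * (11 + 16 * s)" by (simp add: \<kappa>_def)
  have "1564 * (e - \<kappa> * (64 * s - 44)) = 0" using k s by algebra
  hence ek: "e = \<kappa> * (64 * s - 44)" by simp
  have "2 * (S - \<kappa> * (236 - 130 * s)) = 0" using s1 s unfolding ek by algebra
  hence Sk: "S = \<kappa> * (236 - 130 * s)" by simp
  have k0: "\<kappa> \<noteq> 0" using e ek by auto
  have "12 * (y - \<kappa> * (21 + 5 * s)) = 0" using x(1) \<tau> f ek Sk s by algebra
  hence y: "y = \<kappa> * (21 + 5 * s)" by simp
  have "s * e * 1512 * (a - \<kappa> ^ 2 * (3514 - 988 * s)) = 0" using lin s unfolding ek Sk by algebra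
  moreover have "s \<noteq> 0" using s by auto
  ultimately have a: "a = \<kappa> ^ 2 * (3514 - 988 * s)" using e by simp
  have "b = \<kappa> ^ 3 * (646576 - 181792 * s)" using b a s unfolding ek by algebra
  thus ?thesis using s y a k0 by (intro exI[of _ \<kappa>] exI[of _ s]) simp
qed

text \<open>The values x at v1 and z at 2 v1 occur symmetrically, so the unknowns are u = x + z and
  p = x z. The second and third power sums give a and b; the fourth becomes a quadratic equation for
  p/u^2.\<close>

lemma values_20:
  fixes \<tau> y a b x z :: complex
  assumes \<tau>: "\<tau> ^ 2 = - 5" and x: "2 * x + 2 * z = (5 - \<tau> ^ 2) * y"
    "2 * (3 * x ^ 2 - 3 * a) + 2 * (3 * z ^ 2 - 3 * a) = 3 / 5 * a * (\<tau> ^ 4 - 1)"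
    "2 * (5 * x ^ 3 - 9 * a * x + b) + 2 * (5 * z ^ 3 - 9 * a * z + b) = - b / 14 * (\<tau> ^ 6 - 1)"
    "2 * (7 * x ^ 4 - 84 / 5 * a * x ^ 2 + 2 * b * x + 9 / 5 * a ^ 2)
       + 2 * (7 * z ^ 4 - 84 / 5 * a * z ^ 2 + 2 * b * z + 9 / 5 * a ^ 2) = 3 / 25 * a ^ 2 * (\<tau> ^ 8 - 1)"
    and ab: "a \<noteq> 0 \<or> b \<noteq> 0"
  shows "\<exists>\<kappa> s. s ^ 2 = 5 \<and> \<kappa> \<noteq> 0 \<and> y = \<kappa> * (139 + 45 * s) \<and> a = \<kappa> ^ 2 * (108250 + 29835 * s) \<and>
           b = \<kappa> ^ 3 * (180994000 + 49884120 * s)"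
proof -
  define u p where "u = x + z" and "p = x * z"
  have t: "\<tau> ^ 4 = 25" "\<tau> ^ 6 = - 125" "\<tau> ^ 8 = 625" using \<tau> by algebra+
  have "5 * (2 * (3 * x ^ 2 - 3 * a) + 2 * (3 * z ^ 2 - 3 * a)) = 3 * a * 24" using x(2) t by simp
  hence "6 * (22 * a - 5 * (u ^ 2 - 2 * p)) = 0" unfolding u_def p_def by algebra
  hence a: "22 * a = 5 * (u ^ 2 - 2 * p)" by (rule cancel_factor) simp
  have "14 * (2 * (5 * x ^ 3 - 9 * a * x + b) + 2 * (5 * z ^ 3 - 9 * a * z + b)) = b * 126"
    unfolding x(3) t by simp
  hence "14 * (5 * b - (10 * (u ^ 3 - 3 * u * p) - 18 * a * u)) = 0" unfolding u_def p_def by algebra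
  hence b: "5 * b = 10 * (u ^ 3 - 3 * u * p) - 18 * a * u" by (rule cancel_factor) simp
  have "25 * (2 * (7 * x ^ 4 - 84 / 5 * a * x ^ 2 + 2 * b * x + 9 / 5 * a ^ 2)
       + 2 * (7 * z ^ 4 - 84 / 5 * a * z ^ 2 + 2 * b * z + 9 / 5 * a ^ 2)) = 3 * a ^ 2 * 624" using x(4) t by simp
  hence "350 * (u ^ 4 - 4 * u ^ 2 * p + 2 * p ^ 2) - 840 * a * (u ^ 2 - 2 * p) + 100 * b * u + 180 * a ^ 2 = 1872 * a ^ 2"
    unfolding u_def p_def by (simp add: algebra_simps) algebra
  hence quad: "2000 * p ^ 2 + 3500 * p * u ^ 2 - 919 * u ^ 4 = 0" using a b by algebra
  have u: "u \<noteq> 0"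
  proof
    assume "u = 0"
    with quad have "p = 0" by simp
    with \<open>u = 0\<close> a b ab show False by simp
  qed
  \<comment> \<open>Completing the square in \<open>quad\<close> gives (p + 7/8 u^2)^2 = 5
    (99/200)^2 u^4.\<close>
  define s where "s = (p + 7 / 8 * u ^ 2) * 200 / (99 * u ^ 2)"
  have s1: "99 * (s * u ^ 2) = 25 * (8 * p + 7 * u ^ 2)" using u by (simp add: s_def field_simps)
  have "(99 * u ^ 2) ^ 2 * (s ^ 2 - 5) = 0" using s1 quad by algebra
  hence s: "s ^ 2 = 5" using u by simp
  \<comment> \<open>For s^2 = 5 one has (695 + 225 s)(139 - 45 s) = 45980.\<close>
  define \<kappa> where "\<kappa> = u * (139 - 45 * s) / 45980"
  have k: "45980 * \<kappa> = u * (139 - 45 * s)" by (simp add: \<kappa>_def)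
  have "45980 * (u - \<kappa> * (695 + 225 * s)) = 0" using k s by algebra
  hence uk: "u = \<kappa> * (695 + 225 * s)" by simp
  have "200 * (p - \<kappa> ^ 2 * (129925 + 90738 * s)) = 0" using s1 s unfolding uk by algebra
  hence pk: "p = \<kappa> ^ 2 * (129925 + 90738 * s)" by simp
  have k0: "\<kappa> \<noteq> 0" using u uk by auto
  have "10 * (y - \<kappa> * (139 + 45 * s)) = 0" using x(1) \<tau> uk u_def by algebra
  hence y: "y = \<kappa> * (139 + 45 * s)" by simp
  have "22 * (a - \<kappa> ^ 2 * (108250 + 29835 * s)) = 0" using a s unfolding uk pk by algebra
  hence a': "a = \<kappa> ^ 2 * (108250 + 29835 * s)" by simp
  have "5 * (b - \<kappa> ^ 3 * (180994000 + 49884120 * s)) = 0" using b s unfolding uk pk a' by algebra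
  hence "b = \<kappa> ^ 3 * (180994000 + 49884120 * s)" by simp
  thus ?thesis using s y a' k0 by (intro exI[of _ \<kappa>] exI[of _ s]) simp
qed

text \<open>Symmetric functions are used again, but here the quadratic for p/u^2 splits over
  Q(\<tau>). One root is the true solution; the other survives the first four power sums and is
  refuted by the fifth.\<close>

lemma values_19:
  fixes \<tau> y a b x z :: complex
  assumes \<tau>: "\<tau> ^ 2 = \<tau> - 5" and x: "2 * x + 2 * z = (5 - \<tau> ^ 2) * y"
    "2 * (3 * x ^ 2 - 3 * a) + 2 * (3 * z ^ 2 - 3 * a) = 3 / 5 * a * (\<tau> ^ 4 - 1)"
    "2 * (5 * x ^ 3 - 9 * a * x + b) + 2 * (5 * z ^ 3 - 9 * a * z + b) = - b / 14 * (\<tau> ^ 6 - 1)"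
    "2 * (7 * x ^ 4 - 84 / 5 * a * x ^ 2 + 2 * b * x + 9 / 5 * a ^ 2)
       + 2 * (7 * z ^ 4 - 84 / 5 * a * z ^ 2 + 2 * b * z + 9 / 5 * a ^ 2) = 3 / 25 * a ^ 2 * (\<tau> ^ 8 - 1)"
    "2 * (9 * x ^ 5 - 27 * a * x ^ 3 + 45 / 14 * b * x ^ 2 + 54 / 5 * a ^ 2 * x - 99 / 70 * a * b)
       + 2 * (9 * z ^ 5 - 27 * a * z ^ 3 + 45 / 14 * b * z ^ 2 + 54 / 5 * a ^ 2 * z - 99 / 70 * a * b) =
       - 9 / 770 * a * b * (\<tau> ^ 10 - 1)"
    and im: "Im \<tau> > 0" and ab: "a \<noteq> 0 \<or> b \<noteq> 0"
  shows "\<exists>\<kappa>. \<kappa> \<noteq> 0 \<and> y = \<kappa> * 24 \<and> a = \<kappa> ^ 2 * 1824 \<and> b = \<kappa> ^ 3 * 311904"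
proof -
  define u p where "u = x + z" and "p = x * z"
  have t: "\<tau> ^ 4 = 20 - 9 * \<tau>" "\<tau> ^ 6 = 56 * \<tau> - 55" "\<tau> ^ 8 = - 279 * \<tau> - 5" "\<tau> ^ 10 = 1111 * \<tau> + 1420"
    using \<tau> by algebra+
  have "5 * (2 * (3 * x ^ 2 - 3 * a) + 2 * (3 * z ^ 2 - 3 * a)) = 3 * a * (19 - 9 * \<tau>)" using x(2) t by simp
  hence "3 * ((39 - 9 * \<tau>) * a - 10 * (u ^ 2 - 2 * p)) = 0" unfolding u_def p_def by algebra
  hence "(39 - 9 * \<tau>) * a = 10 * (u ^ 2 - 2 * p)" by (rule cancel_factor) simp
  \<comment> \<open>Since (39 - 9\<tau>)(20 + 6\<tau>) = 1050, division by 39 - 9\<tau> becomes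
    multiplication by 20 + 6\<tau>.\<close>
  hence "(39 + (- 9) * \<tau>) * (105 * a - (20 + 6 * \<tau>) * (u ^ 2 - 2 * p)) = 0" using \<tau> by algebra
  moreover have "39 + (- 9) * \<tau> \<noteq> 0" by (rule linear_tau_nonzero[OF im]) simp_all
  ultimately have a: "105 * a = (20 + 6 * \<tau>) * (u ^ 2 - 2 * p)" by simp
  have "14 * (2 * (5 * x ^ 3 - 9 * a * x + b) + 2 * (5 * z ^ 3 - 9 * a * z + b)) = - b * (56 * \<tau> - 56)"
    using x(3) t by simp
  hence "28 * (2 * \<tau> * b + 5 * (u ^ 3 - 3 * u * p) - 9 * a * u) = 0" unfolding u_def p_def by algebra
  hence "2 * \<tau> * b + 5 * (u ^ 3 - 3 * u * p) - 9 * a * u = 0" by (rule cancel_factor0) simp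
  hence b: "10 * b = (\<tau> - 1) * (5 * (u ^ 3 - 3 * u * p) - 9 * a * u)" using \<tau> by algebra
  have "25 * (2 * (7 * x ^ 4 - 84 / 5 * a * x ^ 2 + 2 * b * x + 9 / 5 * a ^ 2)
       + 2 * (7 * z ^ 4 - 84 / 5 * a * z ^ 2 + 2 * b * z + 9 / 5 * a ^ 2)) = 3 * a ^ 2 * (- 279 * \<tau> - 6)" using x(4) t by simp
  hence eq7: "350 * (u ^ 4 - 4 * u ^ 2 * p + 2 * p ^ 2) - 840 * a * (u ^ 2 - 2 * p) + 100 * b * u + 180 * a ^ 2 =
      3 * a ^ 2 * (- 279 * \<tau> - 6)"
    unfolding u_def p_def by (simp add: algebra_simps) algebra
  \<comment> \<open>Up to a non-zero factor from Z[\<tau>], this is the fourth power sum after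
    elimination of a and b, factored over Q(\<tau>).\<close>
  define r where "r = (125 * p - (29 + \<tau>) * u ^ 2) * (250 * p + (287 + 53 * \<tau>) * u ^ 2)"
  have "6 * ((12615 + 792 * \<tau>) * r) = 0" unfolding r_def using eq7 a b \<tau> by algebra
  moreover have "12615 + 792 * \<tau> \<noteq> 0" by (rule linear_tau_nonzero[OF im]) simp_all
  ultimately have r: "r = 0" using cancel_factor0 by (metis zero_neq_numeral)
  have "250 * p + (287 + 53 * \<tau>) * u ^ 2 \<noteq> 0 \<or> u = 0"
  proof (rule ccontr)
    assume "\<not> ?thesis"
    hence p: "250 * p + (287 + 53 * \<tau>) * u ^ 2 = 0" and u: "u \<noteq> 0" by auto
    define m where "m = u / 150"
    have u': "u = 150 * m" by (simp add: m_def)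
    have "250 * (p - (- (287 + 53 * \<tau>) * 90 * m ^ 2)) = 0" using p unfolding u' by algebra
    hence p': "p = - (287 + 53 * \<tau>) * 90 * m ^ 2" by (rule cancel_factor) simp
    have "105 * (a - (38 + 22 * \<tau>) * 300 * m ^ 2) = 0" using a \<tau> unfolding u' p' by algebra
    hence a': "a = (38 + 22 * \<tau>) * 300 * m ^ 2" by (rule cancel_factor) simp
    have "10 * (b - (883 * \<tau> - 1018) * 6750 * m ^ 3) = 0" using b \<tau> unfolding u' p' a' by algebra
    hence b': "b = (883 * \<tau> - 1018) * 6750 * m ^ 3" by (rule cancel_factor) simp
    have "770 * (2 * (9 * x ^ 5 - 27 * a * x ^ 3 + 45 / 14 * b * x ^ 2 + 54 / 5 * a ^ 2 * x - 99 / 70 * a * b)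
       + 2 * (9 * z ^ 5 - 27 * a * z ^ 3 + 45 / 14 * b * z ^ 2 + 54 / 5 * a ^ 2 * z - 99 / 70 * a * b)) =
        - 9 * a * b * (1111 * \<tau> + 1419)"
      using x(5) t by simp
    hence "13860 * (u ^ 5 - 5 * u ^ 3 * p + 5 * u * p ^ 2) - 41580 * a * (u ^ 3 - 3 * u * p) + 4950 * b * (u ^ 2 - 2 * p)
        + 16632 * a ^ 2 * u - 4356 * a * b = - 9 * a * b * (1111 * \<tau> + 1419)"
      unfolding u_def p_def by (simp add: algebra_simps) algebra
    hence "1155 * 150 ^ 5 * ((10 + 9 * \<tau>) * m ^ 5) = 0" using \<tau> unfolding u' p' a' b' by algebra
    hence "(10 + 9 * \<tau>) * m ^ 5 = 0" by (rule cancel_factor0) simp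
    moreover have "10 + 9 * \<tau> \<noteq> 0" by (rule linear_tau_nonzero[OF im]) simp_all
    ultimately show False using u u' by simp
  qed
  hence p: "125 * p = (29 + \<tau>) * u ^ 2"
  proof
    assume "u = 0"
    with r show ?thesis by (simp add: r_def)
  qed (use r in \<open>simp add: r_def\<close>)
  define \<kappa> where "\<kappa> = y / 24"
  have y: "y = \<kappa> * 24" by (simp add: \<kappa>_def)
  have "2 * (u - \<kappa> * (120 - 12 * \<tau>)) = 0" using x(1) y \<tau> u_def by algebra
  hence uk: "u = \<kappa> * (120 - 12 * \<tau>)" by (rule cancel_factor) simp
  have "625 * (5 * p - \<kappa> ^ 2 * (16416 - 2736 * \<tau>)) = 0" using p \<tau> unfolding uk by algebra
  hence pk: "5 * p = \<kappa> ^ 2 * (16416 - 2736 * \<tau>)" by (rule cancel_factor) simp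
  have "525 * (a - \<kappa> ^ 2 * 1824) = 0" using a pk \<tau> unfolding uk by algebra
  hence a': "a = \<kappa> ^ 2 * 1824" by (rule cancel_factor) simp
  have "10 * (b - \<kappa> ^ 3 * 311904) = 0" using b pk \<tau> unfolding uk a' by algebra
  hence b': "b = \<kappa> ^ 3 * 311904" by (rule cancel_factor) simp
  show ?thesis using y a' b' ab by (intro exI[of _ \<kappa>]) auto
qed

section \<open>Derivatives of Eisenstein series and the discriminant\<close>

context upper
begin

text \<open>Degrees 1, 3 and 5 of the Burgers equation. The last contains w 7, which the
  differential equation of \<open>wp\<close> expresses through the square of
  \<open>eis4\<close>.\<close>

lemma vfps_nth: "fps_nth (vfps \<tau>) 1 = eis2 \<tau> ^ 2 - eis4 \<tau>"
  "- 5 * fps_nth (vfps \<tau>) 3 = 4 * eis2 \<tau> * eis4 \<tau> - eis6 \<tau>"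
  "70 * fps_nth (vfps \<tau>) 5 = 6 * eis2 \<tau> * eis6 \<tau> - 24 * eis4 \<tau> ^ 2"
proof -
  define w where "w = fps_nth (wfps \<tau>)"
  have ev: "w 0 = 0" "w 2 = 0" "w 4 = 0" "w 6 = 0" unfolding w_def by (rule wfps_even; simp)+
  have 1: "eis2 \<tau> = w 1" "eis4 \<tau> = - 5 * w 3" "eis6 \<tau> = 70 * w 5" by (simp_all add: eis2_def eis4_def eis6_def w_def)
  have "- 7 * w 7 = 3 / 25 * eis4 \<tau> ^ 2"
    using pfps_nth68(1) by (simp add: pfps_def w_def eval_nat_numeral)
  hence "- 7 * (w 7 - - 3 / 175 * eis4 \<tau> ^ 2) = 0" by algebra
  hence 7: "w 7 = - 3 / 175 * eis4 \<tau> ^ 2" by (rule cancel_factor) simp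
  have "fps_nth (vfps \<tau>) 1 = 5 * w 3 + w 1 ^ 2"
    using vfps_burgers[of 1] ev by (simp add: w_def fps_mult_nth eval_nat_numeral)
  thus "fps_nth (vfps \<tau>) 1 = eis2 \<tau> ^ 2 - eis4 \<tau>" by (simp add: 1)
  have "fps_nth (vfps \<tau>) 3 = 14 * w 5 + 4 * w 1 * w 3"
    using vfps_burgers[of 3] ev by (simp add: w_def fps_mult_nth eval_nat_numeral)
  thus "- 5 * fps_nth (vfps \<tau>) 3 = 4 * eis2 \<tau> * eis4 \<tau> - eis6 \<tau>" by (simp add: 1)
  have "fps_nth (vfps \<tau>) 5 = 27 * w 7 + 6 * w 1 * w 5 + 3 * w 3 ^ 2"
    using vfps_burgers[of 5] ev by (simp add: w_def fps_mult_nth eval_nat_numeral)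
  thus "70 * fps_nth (vfps \<tau>) 5 = 6 * eis2 \<tau> * eis6 \<tau> - 24 * eis4 \<tau> ^ 2" unfolding 7 by (simp add: 1 power2_eq_square)
qed

end

lemma ramanujan:
  assumes "Im \<tau> > 0"
  shows "(eis2 has_field_derivative 2 * of_real pi * \<i> * (eis2 \<tau> ^ 2 - eis4 \<tau>)) (at \<tau>)"
    "(eis4 has_field_derivative 2 * of_real pi * \<i> * (4 * eis2 \<tau> * eis4 \<tau> - eis6 \<tau>)) (at \<tau>)"
    "(eis6 has_field_derivative 2 * of_real pi * \<i> * (6 * eis2 \<tau> * eis6 \<tau> - 24 * eis4 \<tau> ^ 2)) (at \<tau>)"
proof -
  interpret upper \<tau> by standard fact
  note D = wfps_deriv[OF assms]
  show "(eis2 has_field_derivative 2 * of_real pi * \<i> * (eis2 \<tau> ^ 2 - eis4 \<tau>)) (at \<tau>)"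
    using D[of 1] unfolding vfps_nth(1) by (simp add: eis2_def[abs_def])
  show "(eis4 has_field_derivative 2 * of_real pi * \<i> * (4 * eis2 \<tau> * eis4 \<tau> - eis6 \<tau>)) (at \<tau>)"
    using DERIV_cmult[OF D[of 3], of "-5"] unfolding vfps_nth(2)[symmetric] by (simp add: eis4_def[abs_def] mult_ac)
  show "(eis6 has_field_derivative 2 * of_real pi * \<i> * (6 * eis2 \<tau> * eis6 \<tau> - 24 * eis4 \<tau> ^ 2)) (at \<tau>)"
    using DERIV_cmult[OF D[of 5], of 70] unfolding vfps_nth(3)[symmetric] by (simp add: eis6_def[abs_def] mult_ac)
qed

section \<open>The Euler product and the logarithmic derivative of the discriminant\<close>

definition euler_prod :: "complex \<Rightarrow> complex" where
  "euler_prod q = (\<Prod>n. 1 - q ^ Suc n)"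

lemma convergent_euler_prod: "norm q < 1 \<Longrightarrow> convergent_prod (\<lambda>n. 1 - q ^ Suc n :: complex)"
proof -
  assume "norm q < 1"
  hence "summable (\<lambda>n. norm ((1 - q ^ Suc n) - 1))"
    by (auto simp: norm_mult norm_power intro!: summable_mult summable_geometric)
  thus ?thesis
    using abs_convergent_prod_conv_summable abs_convergent_prod_imp_convergent_prod by blast
qed

lemma euler_prod_nonzero: "norm q < 1 \<Longrightarrow> euler_prod q \<noteq> 0"
  unfolding euler_prod_def
proof (rule prodinf_nonzero[OF convergent_euler_prod])
  fix n assume "norm q < 1"
  hence "norm (q ^ Suc n) < 1" by (simp add: norm_power power_less_one_iff del: power_Suc)
  thus "1 - q ^ Suc n \<noteq> 0" by auto
qed

lemma uniform_limit_euler_prod: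
  assumes r: "0 < r" "r < 1"
  shows "uniform_limit (ball 0 r) (\<lambda>N q. \<Prod>n<N. 1 - q ^ Suc n) euler_prod sequentially"
proof -
  have "uniformly_convergent_on (cball 0 r) (\<lambda>N x. \<Sum>n<N. norm (- ((x::complex) ^ Suc n)))"
  proof (rule uniformly_convergentI, rule Weierstrass_m_test)
    show "norm (norm (- (x ^ Suc n))) \<le> r * r ^ n" if "x \<in> cball 0 r" for n and x :: complex
      using that r power_mono[of "norm x" r "Suc n"] by (simp add: norm_mult norm_power)
    show "summable (\<lambda>n. r * r ^ n)" using r by (intro summable_mult summable_geometric) auto
  qed
  hence "uniformly_convergent_on (cball 0 r) (\<lambda>N x. \<Prod>n<N. 1 + - ((x::complex) ^ Suc n))"
    by (intro uniformly_convergent_on_prod continuous_intros) auto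
  then obtain g where g: "uniform_limit (cball 0 r) (\<lambda>N q. \<Prod>n<N. 1 - q ^ Suc n :: complex) g sequentially"
    by (auto simp: uniformly_convergent_on_def)
  have "g q = euler_prod q" if "q \<in> ball 0 r" for q
  proof (rule LIMSEQ_unique)
    show "(\<lambda>N. \<Prod>n<N. 1 - q ^ Suc n) \<longlonglongrightarrow> g q"
      using tendsto_uniform_limitI[OF g] that by auto
    have "(\<lambda>n. \<Prod>i\<le>n. 1 - q ^ Suc i) \<longlonglongrightarrow> euler_prod q"
      unfolding euler_prod_def using that r by (intro convergent_prod_LIMSEQ convergent_euler_prod) auto
    thus "(\<lambda>N. \<Prod>n<N. 1 - q ^ Suc n) \<longlonglongrightarrow> euler_prod q" by (simp add: LIMSEQ_lessThan_iff_atMost)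
  qed
  moreover have "uniform_limit (ball 0 r) (\<lambda>N q. \<Prod>n<N. 1 - q ^ Suc n :: complex) g sequentially"
    using g by (rule uniform_limit_on_subset) auto
  ultimately show ?thesis by (metis (no_types, lifting) uniform_limit_cong')
qed

text \<open>Termwise logarithmic differentiation gives - k q^k / (1 - q^k) for each factor, and
  expanding and regrouping these turns them into divisor sums.\<close>

lemma euler_prod_deriv:
  assumes q: "norm q < 1"
  shows "(euler_prod has_field_derivative deriv euler_prod q) (at q)"
    and "q * deriv euler_prod q = - euler_prod q * (\<Sum>m. q ^ Suc m * of_nat (\<Sum>d | d dvd Suc m. d))"
proof -
  define r where "r = (norm q + 1) / 2"
  have r: "0 < r" "r < 1" "norm q < r" using q norm_ge_zero[of q] unfolding r_def by (auto simp del: norm_ge_zero)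
  note ul = uniform_limit_euler_prod[OF r(1,2)]
  have "euler_prod holomorphic_on ball 0 r"
  proof (rule holomorphic_uniform_sequence[where f = "\<lambda>N q. \<Prod>n<N. 1 - q ^ Suc n"])
    fix x :: complex assume "x \<in> ball 0 r"
    then obtain d where d: "d > 0" "cball x d \<subseteq> ball 0 r"
      using open_contains_cball[of "ball 0 r"] open_ball by blast
    thus "\<exists>d>0. cball x d \<subseteq> ball 0 r \<and> uniform_limit (cball x d) (\<lambda>N q. \<Prod>n<N. 1 - q ^ Suc n) euler_prod sequentially"
      using uniform_limit_on_subset[OF ul d(2)] by blast
  qed (auto intro!: holomorphic_intros)
  thus "(euler_prod has_field_derivative deriv euler_prod q) (at q)"
    using r by (intro holomorphic_derivI) auto
  define f where "f = (\<lambda>k (x :: complex). 1 - x ^ Suc k)"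
  have "(\<lambda>k. deriv (f k) q / f k q) sums (deriv euler_prod q / euler_prod q)"
    by (rule logderiv_prodinf_complex_uniform_limit[where A = "ball 0 r"])
       (use ul r euler_prod_nonzero[OF q] in \<open>auto simp: f_def intro!: holomorphic_intros\<close>)
  hence "(\<lambda>k. q * (deriv (f k) q / f k q)) sums (q * (deriv euler_prod q / euler_prod q))"
    by (rule sums_mult)
  moreover have "q * (deriv (f k) q / f k q) = - (of_nat (Suc k) * geom1 (q ^ Suc k))" for k
  proof -
    have "(f k has_field_derivative - (of_nat (Suc k) * q ^ k)) (at q)"
      using DERIV_diff[OF DERIV_const DERIV_power[OF DERIV_ident, where n = "Suc k" and x = q and s = UNIV]] by (simp add: f_def)
    from DERIV_imp_deriv[OF this] show ?thesis by (simp add: f_def geom1_def)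
  qed
  ultimately have A: "(\<lambda>k. of_nat (Suc k) * geom1 (q ^ Suc k)) sums - (q * (deriv euler_prod q / euler_prod q))"
    using sums_minus by fastforce
  define h where "h n d = of_nat n * q ^ (n * d)" for n d
  have S: "summable (\<lambda>n. of_nat (Suc n) * norm q ^ n)"
    using q sums_summable[OF geometric_deriv_sums[of "norm q"]] by simp
  have inner: "(\<lambda>d. h (Suc n) (Suc d)) sums (of_nat (Suc n) * geom1 (q ^ Suc n))" for n
  proof -
    have "norm (q ^ Suc n) < 1" using q by (simp add: norm_power power_less_one_iff del: power_Suc)
    from sums_mult[OF geometric_sums[OF this], of "of_nat (Suc n) * q ^ Suc n"]
    have "(\<lambda>d. of_nat (Suc n) * (q ^ Suc n) ^ Suc d) sums (of_nat (Suc n) * geom1 (q ^ Suc n))"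
      by (simp add: geom1_def mult_ac)
    thus ?thesis unfolding h_def power_mult .
  qed
  have bound: "norm (h (Suc n) (Suc d)) \<le> (of_nat (Suc n) * norm q ^ n) * norm q ^ d" for n d
  proof -
    have "norm (h (Suc n) (Suc d)) \<le> of_nat (Suc n) * norm q ^ (n + d)"
      unfolding h_def norm_mult norm_power norm_of_nat using q by (intro mult_left_mono power_decreasing) auto
    thus ?thesis by (simp add: power_add mult_ac)
  qed
  have "(\<lambda>m. \<Sum>d | d dvd Suc m. h (Suc m div d) d) sums suminf (\<lambda>n. of_nat (Suc n) * geom1 (q ^ Suc n))"
    by (rule dirichlet_double_sum(2)[where f = h and a = "\<lambda>n. of_nat (Suc n) * norm q ^ n" and b = "\<lambda>d. norm q ^ d", OF bound _ _ _ _ inner])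
       (use S q in \<open>auto intro!: summable_geometric simp del: of_nat_Suc\<close>)
  moreover have "(\<Sum>d | d dvd Suc m. h (Suc m div d) d) = q ^ Suc m * of_nat (\<Sum>d | d dvd Suc m. d)" for m
  proof -
    have dd: "Suc m div (Suc m div d) = d" if dvd: "d dvd Suc m" for d
    proof -
      obtain k where k: "Suc m = d * k" using dvd by (elim dvdE)
      hence "d > 0" "k > 0" by (auto intro: Nat.gr0I)
      thus ?thesis unfolding k by simp
    qed
    have "(\<Sum>d | d dvd Suc m. h (Suc m div d) d) = (\<Sum>d | d dvd Suc m. of_nat (Suc m div d) * q ^ Suc m)"
      unfolding h_def by (intro sum.cong) auto
    also have "\<dots> = (\<Sum>d | d dvd Suc m. of_nat d * q ^ Suc m)"
      by (rule sum.reindex_bij_witness[of _ "\<lambda>d. Suc m div d" "\<lambda>d. Suc m div d"]) (auto simp: dd)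
    finally show ?thesis by (simp add: sum_distrib_left mult.commute)
  qed
  ultimately have "(\<Sum>m. q ^ Suc m * of_nat (\<Sum>d | d dvd Suc m. d)) = - (q * (deriv euler_prod q / euler_prod q))"
    using A by (simp add: sums_iff del: power_Suc)
  thus "q * deriv euler_prod q = - euler_prod q * (\<Sum>m. q ^ Suc m * of_nat (\<Sum>d | d dvd Suc m. d))"
    using euler_prod_nonzero[OF q] by (simp add: field_simps)
qed

lemma Delta_eq: "Im \<tau> > 0 \<Longrightarrow> Delta \<tau> = nome \<tau> * euler_prod (nome \<tau>) ^ 24"
proof -
  assume "Im \<tau> > 0"
  hence "norm (nome \<tau>) < 1" by (simp add: nome_def)
  hence "(\<lambda>n. (1 - nome \<tau> ^ Suc n) ^ 24) has_prod euler_prod (nome \<tau>) ^ 24"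
    unfolding euler_prod_def by (intro has_prod_power convergent_prod_has_prod convergent_euler_prod)
  hence "(\<Prod>n. (1 - nome \<tau> ^ Suc n) ^ 24) = euler_prod (nome \<tau>) ^ 24"
    by (metis has_prod_unique)
  thus ?thesis by (simp add: Delta_def Let_def nome_def)
qed

lemma Delta_nonzero: "Im \<tau> > 0 \<Longrightarrow> Delta \<tau> \<noteq> 0"
  using euler_prod_nonzero[of "nome \<tau>"] by (simp add: Delta_eq) (simp add: nome_def)

lemma Delta_deriv:
  assumes "Im \<tau> > 0"
  shows "(Delta has_field_derivative 2 * of_real pi * \<i> * (12 * eis2 \<tau> * Delta \<tau>)) (at \<tau>)"
proof -
  define q S where "q = nome \<tau>" "S = (\<Sum>m. q ^ Suc m * of_nat (\<Sum>d | d dvd Suc m. d))"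
  have q: "norm q < 1" using assms by (simp add: q_S_def nome_def)
  \<comment> \<open>The classical E_2 = 1 - 24 (q + 3 q^2 + 4 q^3 + ...).\<close>
  have y: "12 * eis2 \<tau> = 1 - 24 * S"
    unfolding eis2_def wfps_def fps_sub_nth bernoulli_fps_1 by (simp add: divisor_coeff_def q_S_def field_simps)
  have nd: "(nome has_field_derivative nome \<tau> * (2 * of_real pi * \<i>)) (at \<tau>)"
    unfolding nome_def by (auto intro!: derivative_eq_intros)
  have "((\<lambda>\<tau>. nome \<tau> * euler_prod (nome \<tau>) ^ 24) has_field_derivative
      (nome \<tau> * (2 * of_real pi * \<i>)) * euler_prod q ^ 24 +
      (of_nat 24 * ((deriv euler_prod q * (nome \<tau> * (2 * of_real pi * \<i>))) * euler_prod q ^ (24 - Suc 0))) * nome \<tau>) (at \<tau>)"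
    unfolding q_S_def
    by (intro DERIV_mult DERIV_power nd DERIV_chain2[OF euler_prod_deriv(1)]) (use q in \<open>simp add: q_S_def\<close>)
  also have "(nome \<tau> * (2 * of_real pi * \<i>)) * euler_prod q ^ 24 +
      (of_nat 24 * ((deriv euler_prod q * (nome \<tau> * (2 * of_real pi * \<i>))) * euler_prod q ^ (24 - Suc 0))) * nome \<tau> =
      2 * of_real pi * \<i> * q * euler_prod q ^ 23 * (euler_prod q + 24 * (q * deriv euler_prod q))"
    unfolding q_S_def(1)[symmetric] by (simp add: algebra_simps eval_nat_numeral)
  also have "\<dots> = 2 * of_real pi * \<i> * q * euler_prod q ^ 23 * (euler_prod q * (12 * eis2 \<tau>))"
    unfolding euler_prod_deriv(2)[OF q] q_S_def(2)[symmetric] y by (simp add: algebra_simps)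
  also have "\<dots> = 2 * of_real pi * \<i> * (12 * eis2 \<tau> * Delta \<tau>)"
    unfolding Delta_eq[OF assms] q_S_def(1)[symmetric] by (simp add: eval_nat_numeral)
  finally show ?thesis
    by (rule has_field_derivative_transform_within_open[where S = "{z. Im z > 0}"])
       (use assms in \<open>auto simp: Delta_eq open_halfspace_Im_gt\<close>)
qed

section \<open>Jets modulo a prime\<close>

text \<open>The Leibniz product for sequences of derivatives at a point. Derivatives are used in
  place of Taylor coefficients so that no factorials appear as denominators modulo p.\<close>

definition binconv :: "(nat \<Rightarrow> 'a::comm_ring_1) \<Rightarrow> (nat \<Rightarrow> 'a) \<Rightarrow> nat \<Rightarrow> 'a" where
  "binconv f g n = (\<Sum>k\<le>n. of_nat (n choose k) * f k * g (n - k))"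

lemma binconv_Suc: "binconv f g (Suc n) = binconv (\<lambda>k. f (Suc k)) g n + binconv f (\<lambda>k. g (Suc k)) n"
proof -
  have "binconv f g (Suc n) = f 0 * g (Suc n) +
      (\<Sum>k\<le>n. of_nat (Suc n choose Suc k) * f (Suc k) * g (n - k))"
    unfolding binconv_def by (subst sum.atMost_Suc_shift) simp
  also have "(\<Sum>k\<le>n. of_nat (Suc n choose Suc k) * f (Suc k) * g (n - k)) =
      binconv (\<lambda>k. f (Suc k)) g n + (\<Sum>k\<le>n. of_nat (n choose Suc k) * f (Suc k) * g (n - k))"
    by (simp add: binconv_def algebra_simps sum.distrib)
  also have "f 0 * g (Suc n) + (binconv (\<lambda>k. f (Suc k)) g n +
       (\<Sum>k\<le>n. of_nat (n choose Suc k) * f (Suc k) * g (n - k))) =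
      binconv (\<lambda>k. f (Suc k)) g n +
       (\<Sum>k\<le>Suc n. of_nat (n choose k) * f k * g (Suc n - k))"
    by (subst sum.atMost_Suc_shift) simp
  also have "(\<Sum>k\<le>Suc n. of_nat (n choose k) * f k * g (Suc n - k)) = binconv f (\<lambda>k. g (Suc k)) n"
    by (simp add: binomial_eq_0 binconv_def Suc_diff_le)
  finally show ?thesis .
qed

text \<open>Leibniz for m further derivatives of a product that has already been differentiated n
  times. For prime m all but the two outer terms are divisible by m.\<close>

lemma binconv_add:
  "binconv f g (n + m) =
     (\<Sum>i\<le>m. of_nat (m choose i) * binconv (\<lambda>k. f (k + i)) (\<lambda>k. g (k + (m - i))) n)"
proof (induction m arbitrary: n)
  case (Suc m)
  define h where "h i j = binconv (\<lambda>k. f (k + i)) (\<lambda>k. g (k + j)) n" for i j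
  have "binconv f g (n + Suc m) = binconv f g (Suc n + m)" by simp
  also have "\<dots> = (\<Sum>i\<le>m. of_nat (m choose i) *
      binconv (\<lambda>k. f (k + i)) (\<lambda>k. g (k + (m - i))) (Suc n))" by (rule Suc)
  also have "\<dots> = (\<Sum>i\<le>m. of_nat (m choose i) * (h (Suc i) (m - i) + h i (Suc m - i)))"
    by (intro sum.cong refl) (simp add: binconv_Suc h_def Suc_diff_le)
  also have "\<dots> = (\<Sum>i\<le>m. of_nat (m choose i) * h (Suc i) (m - i)) +
      (\<Sum>i\<le>Suc m. of_nat (m choose i) * h i (Suc m - i))"
    by (simp add: binomial_eq_0 algebra_simps sum.distrib)
  also have "(\<Sum>i\<le>Suc m. of_nat (m choose i) * h i (Suc m - i)) =
      h 0 (Suc m) + (\<Sum>i\<le>m. of_nat (m choose Suc i) * h (Suc i) (m - i))"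
    by (subst sum.atMost_Suc_shift) simp
  also have "(\<Sum>i\<le>m. of_nat (m choose i) * h (Suc i) (m - i)) +
      (h 0 (Suc m) + (\<Sum>i\<le>m. of_nat (m choose Suc i) * h (Suc i) (m - i))) =
      h 0 (Suc m) + (\<Sum>i\<le>m. of_nat (Suc m choose Suc i) * h (Suc i) (m - i))"
    by (simp add: algebra_simps sum.distrib)
  also have "\<dots> = (\<Sum>i\<le>Suc m. of_nat (Suc m choose i) * h i (Suc m - i))"
    by (subst sum.atMost_Suc_shift) simp
  finally show ?case by (simp add: h_def)
qed simp

section \<open>Arithmetic in Z[s] modulo p and the table of jets\<close>

definition quad :: "complex \<Rightarrow> int \<times> int \<Rightarrow> complex" where
  "quad s x = of_int (fst x) + of_int (snd x) * s"

definition qadd :: "int \<Rightarrow> int \<times> int \<Rightarrow> int \<times> int \<Rightarrow> int \<times> int" where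
  "qadd p x y = ((fst x + fst y) mod p, (snd x + snd y) mod p)"

definition qmul :: "int \<Rightarrow> int \<Rightarrow> int \<times> int \<Rightarrow> int \<times> int \<Rightarrow> int \<times> int" where
  "qmul d p x y = ((fst x * fst y + d * snd x * snd y) mod p, (fst x * snd y + snd x * fst y) mod p)"

text \<open>The norm of x + y s. It stands in for being non-zero modulo p: it is multiplicative, and
  0 has norm 0 in every representation by a pair.\<close>

definition qnorm :: "int \<Rightarrow> int \<Rightarrow> int \<times> int \<Rightarrow> int" where
  "qnorm d p x = (fst x ^ 2 - d * snd x ^ 2) mod p"

definition qconv :: "int \<Rightarrow> int \<Rightarrow> int list \<Rightarrow> (int \<times> int) list \<Rightarrow> (int \<times> int) list \<Rightarrow> int \<times> int" where
  "qconv d p r xs ys =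
     foldr (\<lambda>(c, x, y) acc. qadd p (qmul d p (c, 0) (qmul d p x y)) acc) (zip r (zip xs (rev ys))) (0, 0)"

type_synonym table = "int list \<times> (int \<times> int) list \<times> (int \<times> int) list \<times> (int \<times> int) list \<times> (int \<times> int) list"

text \<open>The first component is the current row of Pascal's triangle modulo p, carried along so
  that each Leibniz product is a plain weighted sum; the others are the jets of y, a, b, F so
  far.\<close>

definition next_table :: "int \<Rightarrow> int \<Rightarrow> table \<Rightarrow> table" where
  "next_table d p = (\<lambda>(r, ys, as, bs, fs).
     (map2 (\<lambda>x y. (x + y) mod p) (0 # r) (r @ [0]),
      ys @ [qadd p (qconv d p r ys ys) (qmul d p (-1, 0) (last as))],
      as @ [qadd p (qmul d p (4, 0) (qconv d p r ys as)) (qmul d p (-1, 0) (last bs))],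
      bs @ [qadd p (qmul d p (6, 0) (qconv d p r ys bs)) (qmul d p (-24, 0) (qconv d p r as as))],
      fs @ [qmul d p (12, 0) (qconv d p r ys fs)]))"

primrec jet_table :: "int \<Rightarrow> int \<Rightarrow> int \<times> int \<Rightarrow> int \<times> int \<Rightarrow> int \<times> int \<Rightarrow> nat \<Rightarrow> table" where
  "jet_table d p y a b 0 = ([1], [y], [a], [b], [(1, 0)])"
| "jet_table d p y a b (Suc n) = next_table d p (jet_table d p y a b n)"

text \<open>The number m is the spacing of the non-trivial indices: 3 and 2 at the points with extra
  automorphisms, otherwise 1. It has to divide p - 1 because the reduction of n to n - (p - 1) must
  stay among multiples of m. Table entries of positive index are reduced, so equality of pairs is
  congruence.\<close>

definition good_jet :: "int \<Rightarrow> nat \<Rightarrow> int \<times> int \<Rightarrow> int \<times> int \<Rightarrow> int \<times> int \<Rightarrow> int \<times> int \<Rightarrow> nat \<Rightarrow> bool" where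
  "good_jet d p c y a b m \<longleftrightarrow>
     (case jet_table d (int p) y a b p of (r, ys, as, bs, fs) \<Rightarrow>
        (\<forall>xs \<in> set [ys, as, bs, fs]. xs ! p = qmul d (int p) c (xs ! 1)) \<and>
        (\<forall>i \<in> set [1..<p]. i mod m = 0 \<longrightarrow> qnorm d (int p) (fs ! i) \<noteq> 0) \<and>
        qnorm d (int p) c \<noteq> 0 \<and> (p - 1) mod m = 0)"

text \<open>Taking s = d = 0 covers rational values. As s may be rational, pairs need not represent
  elements of Z[s] uniquely.\<close>

locale quad_ring =
  fixes s :: complex and d :: int
  assumes s2: "s ^ 2 = of_int d"
begin

lemma quad_mult: "quad s x * quad s y = quad s (fst x * fst y + d * snd x * snd y, fst x * snd y + snd x * fst y)"
proof -
  have "quad s x * quad s y = of_int (fst x * fst y) + of_int (snd x * snd y) * s ^ 2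
          + of_int (fst x * snd y + snd x * fst y) * s"
    by (simp add: quad_def algebra_simps power2_eq_square)
  thus ?thesis by (simp add: quad_def s2 algebra_simps)
qed

lemma quad_add: "quad s x + quad s y = quad s (fst x + fst y, snd x + snd y)"
  by (simp add: quad_def algebra_simps)

definition Q :: "complex set" where "Q = range (quad s)"

lemma Q_mult: "x \<in> Q \<Longrightarrow> y \<in> Q \<Longrightarrow> x * y \<in> Q"
  unfolding Q_def using quad_mult by auto

lemma Q_add: "x \<in> Q \<Longrightarrow> y \<in> Q \<Longrightarrow> x + y \<in> Q"
  unfolding Q_def using quad_add by auto

lemma Q_of_int: "of_int n \<in> Q"
  unfolding Q_def by (rule range_eqI[of _ _ "(n, 0)"]) (simp add: quad_def)

lemma Q_of_nat: "of_nat n \<in> Q"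
  using Q_of_int[of "int n"] by simp

lemma Q_minus: "x \<in> Q \<Longrightarrow> - x \<in> Q"
  using Q_mult[OF Q_of_int[of "-1"]] by simp

lemma Q_sum: "(\<And>i. i \<in> I \<Longrightarrow> f i \<in> Q) \<Longrightarrow> sum f I \<in> Q"
  by (induction I rule: infinite_finite_induct) (use Q_of_int[of 0] Q_add in auto)

lemma Q_binconv: "(\<And>i. f i \<in> Q) \<Longrightarrow> (\<And>i. g i \<in> Q) \<Longrightarrow> binconv f g n \<in> Q"
  unfolding binconv_def by (intro Q_sum Q_mult Q_of_nat)

definition qcong :: "nat \<Rightarrow> complex \<Rightarrow> complex \<Rightarrow> bool" where
  "qcong p x y \<longleftrightarrow> (\<exists>t\<in>Q. x - y = of_nat p * t)"

lemma qcong_refl [simp]: "qcong p x x"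
  unfolding qcong_def using Q_of_int[of 0] by (intro bexI[of _ 0]) auto

lemma qcong_sym: "qcong p x y \<Longrightarrow> qcong p y x"
  unfolding qcong_def using Q_minus by (metis minus_diff_eq mult_minus_right)

lemma qcong_add: "qcong p x y \<Longrightarrow> qcong p x' y' \<Longrightarrow> qcong p (x + x') (y + y')"
  unfolding qcong_def by (metis Q_add add_diff_add distrib_left)

lemma qcong_trans: "qcong p x y \<Longrightarrow> qcong p y z \<Longrightarrow> qcong p x z"
  using qcong_add[of p x y y z] unfolding qcong_def by simp

lemma qcong_cmult: "z \<in> Q \<Longrightarrow> qcong p x y \<Longrightarrow> qcong p (z * x) (z * y)"
  unfolding qcong_def by (metis Q_mult mult.left_commute right_diff_distrib)

lemma qcong_mult:
  assumes "qcong p x x'" "qcong p y y'" "x \<in> Q" "y' \<in> Q"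
  shows "qcong p (x * y) (x' * y')"
  using qcong_trans[OF qcong_cmult[OF assms(3,2)]] qcong_cmult[OF assms(4,1)]
  by (simp add: mult.commute)

lemma qcong_sum: "(\<And>i. i \<in> I \<Longrightarrow> qcong p (f i) (g i)) \<Longrightarrow> qcong p (sum f I) (sum g I)"
  by (induction I rule: infinite_finite_induct) (auto intro: qcong_add)

lemma qcong_diff: "qcong p x y \<Longrightarrow> qcong p x' y' \<Longrightarrow> qcong p (x - x') (y - y')"
  using qcong_add[of p x y "-x'" "-y'"] qcong_cmult[OF Q_of_int[of "-1"], of p x' y'] by simp

lemma qcong_binconv:
  assumes "\<And>k. k \<le> n \<Longrightarrow> qcong p (f k) (f' k)" "\<And>k. k \<le> n \<Longrightarrow> qcong p (g k) (g' k)"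
    "\<And>k. f k \<in> Q" "\<And>k. g' k \<in> Q"
  shows "qcong p (binconv f g n) (binconv f' g' n)"
  unfolding binconv_def
  by (intro qcong_sum qcong_mult qcong_cmult Q_of_nat Q_mult assms) auto

lemma qcong_binconv_prime:
  assumes p: "prime p" and Q: "\<And>i. f i \<in> Q" "\<And>i. g i \<in> Q"
  shows "qcong p (binconv f g (n + p)) (binconv (\<lambda>k. f (k + p)) g n + binconv f (\<lambda>k. g (k + p)) n)"
proof -
  define h where "h i = binconv (\<lambda>k. f (k + i)) (\<lambda>k. g (k + (p - i))) n" for i
  obtain m where m: "p = Suc m" using prime_gt_0_nat[OF p] by (cases p) auto
  have "binconv f g (n + p) = (\<Sum>i\<le>p. of_nat (p choose i) * h i)"
    unfolding h_def by (rule binconv_add)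
  also have "\<dots> = h p + h 0 + (\<Sum>i<m. of_nat (p choose Suc i) * h (Suc i))"
    unfolding m by (simp add: sum.atMost_shift del: binomial_Suc_Suc)
  finally have eq: "binconv f g (n + p) = h p + h 0 + (\<Sum>i<m. of_nat (p choose Suc i) * h (Suc i))" .
  have "\<exists>t\<in>Q. of_nat (p choose Suc i) * h (Suc i) = of_nat p * t" if "i < m" for i
  proof -
    \<comment> \<open>The index runs strictly between 0 and p here, the two outer terms having been
      split off.\<close>
    have "p dvd (p choose Suc i)"
      using p that m by (intro dvd_choose_prime) auto
    then obtain k where "p choose Suc i = p * k" by (elim dvdE)
    moreover have "h (Suc i) \<in> Q" unfolding h_def by (intro Q_binconv Q)
    ultimately show ?thesis by (intro bexI[of _ "of_nat k * h (Suc i)"]) (auto intro: Q_mult Q_of_nat)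
  qed
  hence "qcong p (\<Sum>i<m. of_nat (p choose Suc i) * h (Suc i)) (\<Sum>i<m. 0)"
    by (intro qcong_sum) (auto simp: qcong_def)
  from qcong_add[OF qcong_refl this, of "h p + h 0"] eq show ?thesis by (simp add: h_def)
qed

definition reps :: "nat \<Rightarrow> int \<times> int \<Rightarrow> complex \<Rightarrow> bool" where
  "reps p x z \<longleftrightarrow> qcong p z (quad s x)"

lemma reps_Q: "reps p x z \<Longrightarrow> z \<in> Q"
proof -
  assume "reps p x z"
  then obtain t where "t \<in> Q" "z = quad s x + of_nat p * t"
    unfolding reps_def qcong_def by (metis diff_add_cancel add.commute)
  thus "z \<in> Q" using Q_add Q_mult Q_of_nat by (auto simp: Q_def)
qed

lemma qcong_mod: "qcong p (quad s x) (quad s (fst x mod int p, snd x mod int p))"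
proof -
  have "(of_int a :: complex) = of_int (a mod int p) + of_nat p * of_int (a div int p)" for a
    by (metis add.commute mult_div_mod_eq of_int_add of_int_mult of_int_of_nat_eq)
  from this[of "fst x"] this[of "snd x"]
  have "quad s x - quad s (fst x mod int p, snd x mod int p) =
          of_nat p * quad s (fst x div int p, snd x div int p)"
    unfolding quad_def by (simp add: algebra_simps)
  thus ?thesis unfolding qcong_def Q_def by blast
qed

lemma reps_qadd: "reps p x z \<Longrightarrow> reps p y w \<Longrightarrow> reps p (qadd (int p) x y) (z + w)"
  unfolding reps_def qadd_def
  using qcong_trans[OF qcong_add qcong_mod[of p "(fst x + fst y, snd x + snd y)", folded quad_add]]
  by simp

lemma reps_qmul: 
  assumes "reps p x z" "reps p y w" 
  shows "reps p (qmul d (int p) x y) (z * w)"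
proof -
  have "qcong p (z * w) (quad s x * quad s y)"
    using assms reps_Q[OF assms(1)] by (intro qcong_mult) (auto simp: reps_def Q_def)
  from qcong_trans[OF this, unfolded quad_mult, OF qcong_mod] show ?thesis
    by (simp add: reps_def qmul_def)
qed

lemma reps_int: "reps p (c mod int p, 0) (of_int c)" "reps p (c, 0) (of_int c)"
  using qcong_mod[of p "(c, 0)"] by (auto simp: reps_def quad_def)

lemma reps_sum_foldr:
  assumes "\<And>i. i < length L \<Longrightarrow> reps p (g (L ! i)) (h i)"
  shows "reps p (foldr (\<lambda>x acc. qadd (int p) (g x) acc) L (0, 0)) (\<Sum>i<length L. h i)"
  using assms
proof (induction L arbitrary: h)
  case Nil
  show ?case using reps_int(2)[of p 0] by simp
next
  case (Cons x L)
  have "reps p (foldr (\<lambda>x acc. qadd (int p) (g x) acc) L (0, 0)) (\<Sum>i<length L. h (Suc i))"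
    using Cons.prems[of "Suc _"] by (intro Cons.IH) auto
  moreover have "reps p (g x) (h 0)" using Cons.prems[of 0] by simp
  ultimately show ?case by (simp add: sum.lessThan_Suc_shift reps_qadd del: sum.lessThan_Suc)
qed

lemma reps_qconv:
  assumes "length r = Suc n" "length xs = Suc n" "length ys = Suc n"
    "\<And>i. i \<le> n \<Longrightarrow> r ! i = int (n choose i) mod int p"
    "\<And>i. i \<le> n \<Longrightarrow> reps p (xs ! i) (f i)" "\<And>i. i \<le> n \<Longrightarrow> reps p (ys ! i) (g i)"
  shows "reps p (qconv d (int p) r xs ys) (binconv f g n)"
proof -
  have "reps p (foldr (\<lambda>x acc. qadd (int p) ((\<lambda>(c, x, y). qmul d (int p) (c, 0) (qmul d (int p) x y)) x) acc)
           (zip r (zip xs (rev ys))) (0, 0))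
        (\<Sum>i<length (zip r (zip xs (rev ys))). of_nat (n choose i) * (f i * g (n - i)))"
    by (rule reps_sum_foldr)
       (use assms reps_int(1)[of p "int (n choose _)"] in \<open>auto simp: rev_nth intro!: reps_qmul\<close>)
  thus ?thesis
    using assms(1-3) by (simp add: qconv_def binconv_def mult.assoc lessThan_Suc_atMost case_prod_unfold)
qed

end

lemma next_table_row:
  assumes "length r = Suc n" "\<And>i. i \<le> n \<Longrightarrow> r ! i = int (n choose i) mod p" "i \<le> Suc n"
  shows "map2 (\<lambda>x y. (x + y) mod p) (0 # r) (r @ [0]) ! i = int (Suc n choose i) mod p"
proof (cases i)
  case (Suc j)
  hence "(r @ [0]) ! i = int (n choose i) mod p"
    using assms by (auto simp: nth_append binomial_eq_0 not_less less_Suc_eq_le)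
  thus ?thesis using assms Suc by (simp add: mod_simps)
qed (use assms in \<open>simp add: nth_append\<close>)

locale jet = quad_ring +
  fixes Y A B F :: "nat \<Rightarrow> complex"
  assumes Y_Suc: "Y (Suc n) = binconv Y Y n - A n"
    and A_Suc: "A (Suc n) = 4 * binconv Y A n - B n"
    and B_Suc: "B (Suc n) = 6 * binconv Y B n - 24 * binconv A A n"
    and F_Suc: "F (Suc n) = 12 * binconv Y F n"
    and F_0: "F 0 = 1"
begin

lemma reps_jet_table:
  assumes init: "reps p y (Y 0)" "reps p a (A 0)" "reps p b (B 0)" and p: "p > 1"
  shows "case jet_table d (int p) y a b n of (r, ys, as, bs, fs) \<Rightarrow>
     length r = Suc n \<and> length ys = Suc n \<and> length as = Suc n \<and> length bs = Suc n \<and> length fs = Suc n \<and>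
     (\<forall>i\<le>n. r ! i = int (n choose i) mod int p \<and> reps p (ys ! i) (Y i) \<and>
        reps p (as ! i) (A i) \<and> reps p (bs ! i) (B i) \<and> reps p (fs ! i) (F i))"
proof (induction n)
  case 0
  show ?case using init p reps_int(2)[of p 1] by (simp add: F_0)
next
  case (Suc n)
  obtain r ys as bs fs where eq: "jet_table d (int p) y a b n = (r, ys, as, bs, fs)"
    by (metis prod_cases5)
  note IH = Suc[unfolded eq prod.case]
  have last: "last xs = xs ! n" if "length xs = Suc n" for xs :: "(int \<times> int) list"
    using that by (metis diff_Suc_1 last_conv_nth length_0_conv nat.distinct(1))
  have conv: "reps p (qconv d (int p) r xs zs) (binconv f g n)"
    if "length xs = Suc n" "length zs = Suc n" "\<forall>i\<le>n. reps p (xs ! i) (f i)" "\<forall>i\<le>n. reps p (zs ! i) (g i)"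
    for xs zs f g
    by (rule reps_qconv) (use that IH in auto)
  have neg: "reps p (qmul d (int p) (-1, 0) (xs ! n)) (- z)" if "reps p (xs ! n) z" for xs z
    using reps_qmul[OF reps_int(2)[of p "-1"] that] by simp
  have mul: "reps p (qmul d (int p) (k, 0) x) (of_int k * z)" if "reps p x z" for k x z
    by (intro reps_qmul reps_int that)
  have new: "reps p (qadd (int p) (qconv d (int p) r ys ys) (qmul d (int p) (-1, 0) (last as))) (Y (Suc n))"
    "reps p (qadd (int p) (qmul d (int p) (4, 0) (qconv d (int p) r ys as)) (qmul d (int p) (-1, 0) (last bs))) (A (Suc n))"
    "reps p (qadd (int p) (qmul d (int p) (6, 0) (qconv d (int p) r ys bs)) (qmul d (int p) (-24, 0) (qconv d (int p) r as as))) (B (Suc n))"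
    "reps p (qmul d (int p) (12, 0) (qconv d (int p) r ys fs)) (F (Suc n))"
  proof -
    show "reps p (qadd (int p) (qconv d (int p) r ys ys) (qmul d (int p) (-1, 0) (last as))) (Y (Suc n))"
      using reps_qadd[OF conv[of ys ys Y Y] neg[of as "A n"]] IH by (simp add: last Y_Suc)
    show "reps p (qadd (int p) (qmul d (int p) (4, 0) (qconv d (int p) r ys as)) (qmul d (int p) (-1, 0) (last bs))) (A (Suc n))"
      using reps_qadd[OF mul[OF conv[of ys as Y A], of 4] neg[of bs "B n"]] IH by (simp add: last A_Suc)
    show "reps p (qadd (int p) (qmul d (int p) (6, 0) (qconv d (int p) r ys bs)) (qmul d (int p) (-24, 0) (qconv d (int p) r as as))) (B (Suc n))"
      using reps_qadd[OF mul[OF conv[of ys bs Y B], of 6] mul[OF conv[of as as A A], of "-24"]] IH by (simp add: B_Suc)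
    show "reps p (qmul d (int p) (12, 0) (qconv d (int p) r ys fs)) (F (Suc n))"
      using mul[OF conv[of ys fs Y F], of 12] IH by (simp add: F_Suc)
  qed
  have app: "reps p ((xs @ [x]) ! i) (f i)"
    if "length xs = Suc n" "\<forall>i\<le>n. reps p (xs ! i) (f i)" "reps p x (f (Suc n))" "i \<le> Suc n" for xs x f i
    using that by (auto simp: nth_append le_Suc_eq)
  have row: "map2 (\<lambda>x y. (x + y) mod int p) (0 # r) (r @ [0]) ! i = int (Suc n choose i) mod int p"
    if "i \<le> Suc n" for i
    by (rule next_table_row) (use IH that in auto)
  show ?case
    unfolding jet_table.simps eq next_table_def prod.case
    using IH new row by (auto intro!: app simp del: binomial_Suc_Suc)
qed

lemma reps_mult_nonzero:
  assumes "prime p" "qnorm d (int p) x \<noteq> 0" "qnorm d (int p) y \<noteq> 0"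
  shows "qnorm d (int p) (qmul d (int p) x y) \<noteq> 0"
proof -
  let ?N = "\<lambda>x. fst x ^ 2 - d * snd x ^ 2"
  have "?N (fst x * fst y + d * snd x * snd y, fst x * snd y + snd x * fst y) = ?N x * ?N y"
    by (simp add: algebra_simps power2_eq_square)
  hence "qnorm d (int p) (qmul d (int p) x y) = (?N x * ?N y) mod int p"
    unfolding qnorm_def qmul_def fst_conv snd_conv by (metis (no_types, lifting) mod_diff_cong mod_mult_cong mod_mod_trivial power_mod)
  moreover have "\<not> int p dvd ?N x * ?N y"
  proof -
    have "prime (int p)" using assms(1) by simp
    moreover have "\<not> int p dvd ?N x" "\<not> int p dvd ?N y"
      using assms(2,3) unfolding qnorm_def by (simp_all add: dvd_eq_mod_eq_0)
    ultimately show ?thesis using prime_dvd_multD by blast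
  qed
  ultimately show ?thesis by (simp add: dvd_eq_mod_eq_0)
qed

text \<open>If z = 0, the pair x is congruent modulo p to a pair (u, v) with u + v s = 0. Then u^2 =
  d v^2, so the norm vanishes modulo p, and this remains valid for s = 0.\<close>

lemma reps_nonzero:
  assumes "reps p x z" "qnorm d (int p) x \<noteq> 0"
  shows "z \<noteq> 0"
proof
  assume "z = 0"
  with assms obtain t where "- quad s x = of_nat p * quad s t" by (auto simp: reps_def qcong_def Q_def)
  hence eq: "of_int (fst x + int p * fst t) + of_int (snd x + int p * snd t) * s = 0" (is "of_int ?u + of_int ?v * s = 0")
    by (simp add: quad_def algebra_simps add_eq_0_iff)
  have "of_int (?u ^ 2) = (of_int ?v * s) ^ 2"
    using eq by (metis add_eq_0_iff of_int_power power2_minus)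
  also have "\<dots> = of_int (d * ?v ^ 2)" by (simp only: power_mult_distrib s2 of_int_mult of_int_power mult.commute)
  finally have "?u ^ 2 = d * ?v ^ 2" by (simp only: of_int_eq_iff)
  hence "fst x ^ 2 - d * snd x ^ 2 = int p * (d * (2 * snd x * snd t + int p * snd t ^ 2) - (2 * fst x * fst t + int p * fst t ^ 2))"
    by (simp add: algebra_simps power2_eq_square)
  thus False using assms(2) unfolding qnorm_def by simp
qed

lemma F_nonzero:
  assumes good: "good_jet d p c y a b m" and p: "prime p"
    and init: "reps p y (Y 0)" "reps p a (A 0)" "reps p b (B 0)" and n: "n mod m = 0"
  shows "F n \<noteq> 0"
proof -
  have Q: "Y i \<in> Q \<and> A i \<in> Q \<and> B i \<in> Q \<and> F i \<in> Q" for i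
    using reps_jet_table[OF init prime_gt_1_nat[OF p], of i]
    by (auto split: prod.splits dest: reps_Q)
  obtain r ys as bs fs where eq: "jet_table d (int p) y a b p = (r, ys, as, bs, fs)"
    by (metis prod_cases5)
  note T = reps_jet_table[OF init prime_gt_1_nat[OF p], of p, unfolded eq prod.case]
  note G = good[unfolded good_jet_def eq prod.case]
  define k where "k = quad s c"
  have k: "k \<in> Q" "reps p c k" by (auto simp: k_def Q_def reps_def)
  have base: "qcong p (X p) (k * X 1)"
    if "xs ! p = qmul d (int p) c (xs ! 1)" "\<forall>i\<le>p. reps p (xs ! i) (X i)" for xs X
  proof -
    have "reps p (xs ! p) (k * X 1)"
      unfolding that(1) using that prime_gt_1_nat[OF p] k by (intro reps_qmul) auto
    moreover have "reps p (xs ! p) (X p)" using that by auto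
    ultimately show ?thesis unfolding reps_def using qcong_trans qcong_sym by blast
  qed
  \<comment> \<open>The congruence passes through products: modulo p, shifting by p and k times
    shifting by 1 both satisfy Leibniz.\<close>
  have step: "qcong p (binconv f g (n + p)) (k * binconv f g (Suc n))"
    if "\<And>i. f i \<in> Q" "\<And>i. g i \<in> Q" "\<And>i. i \<le> n \<Longrightarrow> qcong p (f (i + p)) (k * f (Suc i))"
       "\<And>i. i \<le> n \<Longrightarrow> qcong p (g (i + p)) (k * g (Suc i))" for f g n
  proof -
    have "qcong p (binconv (\<lambda>k. f (k + p)) g n + binconv f (\<lambda>k. g (k + p)) n)
       (binconv (\<lambda>i. k * f (Suc i)) g n + binconv f (\<lambda>i. k * g (Suc i)) n)"
      using that k by (intro qcong_add qcong_binconv Q_mult) auto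
    also have "binconv (\<lambda>i. k * f (Suc i)) g n + binconv f (\<lambda>i. k * g (Suc i)) n = k * binconv f g (Suc n)"
      unfolding binconv_Suc by (simp add: binconv_def sum_distrib_left algebra_simps)
    finally show ?thesis
      by (rule qcong_trans[OF qcong_binconv_prime[OF p, of f g n], OF that(1,2)])
  qed
  have per: "qcong p (Y (n + p)) (k * Y (Suc n)) \<and> qcong p (A (n + p)) (k * A (Suc n)) \<and>
    qcong p (B (n + p)) (k * B (Suc n)) \<and> qcong p (F (n + p)) (k * F (Suc n))" for n
  proof (induction n rule: less_induct)
    case (less n)
    show ?case
    proof (cases n)
      case 0
      show ?thesis using base[of ys Y] base[of as A] base[of bs B] base[of fs F] T G 0 by auto
    next
      case (Suc j)
      have IH: "qcong p (Y (i + p)) (k * Y (Suc i))" "qcong p (A (i + p)) (k * A (Suc i))"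
          "qcong p (B (i + p)) (k * B (Suc i))" "qcong p (F (i + p)) (k * F (Suc i))" if "i \<le> j" for i
        using less[of i] that Suc by auto
      have num: "qcong p (of_int t * u) (of_int t * v)" if "qcong p u v" for t u v
        using that by (intro qcong_cmult Q_of_int)
      have c: "qcong p (binconv Y Y (j + p)) (k * binconv Y Y (Suc j))"
        "qcong p (binconv Y A (j + p)) (k * binconv Y A (Suc j))"
        "qcong p (binconv Y B (j + p)) (k * binconv Y B (Suc j))"
        "qcong p (binconv A A (j + p)) (k * binconv A A (Suc j))"
        "qcong p (binconv Y F (j + p)) (k * binconv Y F (Suc j))"
        using Q IH by (intro step; blast)+
      have "qcong p (Y (Suc j + p)) (k * binconv Y Y (Suc j) - k * A (Suc j))"
        unfolding add_Suc Y_Suc by (intro qcong_diff c IH order_refl)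
      moreover have "qcong p (A (Suc j + p)) (4 * (k * binconv Y A (Suc j)) - k * B (Suc j))"
        unfolding add_Suc A_Suc using qcong_diff[OF num[OF c(2), of 4] IH(3)[of j]] by simp
      moreover have "qcong p (B (Suc j + p)) (6 * (k * binconv Y B (Suc j)) - 24 * (k * binconv A A (Suc j)))"
        unfolding add_Suc B_Suc using qcong_diff[OF num[OF c(3), of 6] num[OF c(4), of 24]] by simp
      moreover have "qcong p (F (Suc j + p)) (12 * (k * binconv Y F (Suc j)))"
        unfolding add_Suc F_Suc using num[OF c(5), of 12] by simp
      ultimately show ?thesis
        unfolding Suc by (simp add: Y_Suc[of "Suc j"] A_Suc[of "Suc j"] B_Suc[of "Suc j"] F_Suc[of "Suc j"] algebra_simps)
    qed
  qed
  \<comment> \<open>Index 0 stands apart: the descent below ends at positive indices, and F 0 = 1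
    anyway.\<close>
  have "\<exists>x. reps p x (F n) \<and> qnorm d (int p) x \<noteq> 0" if "n > 0" "n mod m = 0" for n
    using that
  proof (induction n rule: less_induct)
    case (less n)
    show ?case
    proof (cases "n < p")
      case True
      thus ?thesis using T G less.prems by (intro exI[of _ "fs ! n"]) auto
    next
      case False
      \<comment> \<open>Descent by p - 1: F n is congruent to k F (j + 1) with j + 1 = n - (p - 1),
        and k has non-zero norm.\<close>
      define j where "j = n - p"
      have n: "n = j + p" using False by (simp add: j_def)
      have "Suc j = n - (p - 1)" using prime_gt_1_nat[OF p] n by simp
      moreover have "m dvd p - 1" "m dvd n" using G less.prems by (auto simp only: mod_eq_0_iff_dvd)
      hence "m dvd n - (p - 1)" by (rule dvd_diff_nat[rotated])
      ultimately have "Suc j mod m = 0" by simp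
      then obtain x where x: "reps p x (F (Suc j))" "qnorm d (int p) x \<noteq> 0"
        using less.IH[of "Suc j"] n prime_gt_1_nat[OF p] by auto
      have "reps p (qmul d (int p) c x) (k * F (Suc j))" using x k by (intro reps_qmul)
      hence "reps p (qmul d (int p) c x) (F n)"
        using per[of j] unfolding n reps_def by (blast intro: qcong_trans)
      thus ?thesis using reps_mult_nonzero[OF p _ x(2)] G by blast
    qed
  qed
  thus ?thesis using reps_nonzero n F_0 by (metis neq0_conv zero_neq_one)
qed

end

section \<open>Finite checks, each at a prime that splits in Q(sqrt D)\<close>

lemma good_jet_3: "good_jet 0 7 (4, 0) (0, 0) (0, 0) (1, 0) 3"
  by code_simp

lemma good_jet_4: "good_jet 0 5 (1, 0) (0, 0) (1, 0) (0, 0) 2"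
  by code_simp

lemma good_jet_7: "good_jet 0 23 (18, 0) (15, 0) (2625, 0) (661500, 0) 1"
  by code_simp

lemma good_jet_8: "good_jet 0 17 (2, 0) (5, 0) (250, 0) (14000, 0) 1"
  by code_simp

lemma good_jet_11: "good_jet 0 23 (12, 0) (8, 0) (352, 0) (27104, 0) 1"
  by code_simp

text \<open>As 5 is not a square modulo 17, \<open>qnorm\<close> vanishes only on pairs divisible by
  17. The same holds for 5 modulo 7 and for 2 modulo 5 in the other two checks with d > 0.\<close>

lemma good_jet_15: "good_jet 5 17 (15, 13) (21, 8) (1225, 2080) (377300, 640640) 1"
  by code_simp

lemma good_jet_19: "good_jet 0 7 (2, 0) (24, 0) (1824, 0) (311904, 0) 1"
  by code_simp

lemma good_jet_20: "good_jet 5 7 (1, 2) (139, 45) (108250, 29835) (180994000, 49884120) 1"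
  by code_simp

lemma good_jet_24: "good_jet 2 5 (4, 1) (21, 5) (3514, -988) (646576, -181792) 1"
  by code_simp

section \<open>Transfer to the disc\<close>

lemma higher_deriv_quadratic:
  assumes "f holomorphic_on ball 0 1" "g holomorphic_on ball 0 1"
  shows "(deriv ^^ n) (\<lambda>w. f w * g w) 0 = binconv (\<lambda>k. (deriv ^^ k) f 0) (\<lambda>k. (deriv ^^ k) g 0) n"
  using higher_deriv_mult[OF assms, of 0 n] by (simp add: binconv_def atLeast0AtMost)

locale disc = upper
begin

text \<open>The Moebius map of \<open>sigma_mat\<close>, whose scalar factor cancels; it carries the
  disc to the upper half plane and 0 to \<tau>.\<close>

definition cayley :: "complex \<Rightarrow> complex" where "cayley w = (\<tau> - cnj \<tau> * w) / (1 - w)"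
definition disc_scale :: complex where "disc_scale = - of_real (4 * pi * Im \<tau>)"

lemma Im_cayley: "norm w < 1 \<Longrightarrow> Im (cayley w) > 0"
proof -
  assume w: "norm w < 1"
  have "Im ((\<tau> - cnj \<tau> * w) * cnj (1 - w)) = Im \<tau> * (1 - norm w ^ 2)"
    unfolding cmod_power2 by (simp add: algebra_simps power2_eq_square)
  moreover have "norm w ^ 2 < 1" using w by (simp add: power_less_one_iff)
  moreover have "cayley w = (\<tau> - cnj \<tau> * w) * cnj (1 - w) / of_real (norm (1 - w) ^ 2)"
    unfolding cayley_def by (subst complex_div_cnj) simp
  moreover have "norm (1 - w) > 0" using w by auto
  ultimately show ?thesis using Im_pos by (simp only: Im_divide_of_real) simp
qed

lemma cayley_deriv: "norm w < 1 \<Longrightarrow> (cayley has_field_derivative (\<tau> - cnj \<tau>) / (1 - w) ^ 2) (at w)"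
proof -
  assume "norm w < 1"
  hence "1 - w \<noteq> 0" by auto
  thus ?thesis unfolding cayley_def[abs_def]
    by (auto intro!: derivative_eq_intros simp: field_simps power2_eq_square)
qed

lemma disc_scale_eq: "2 * of_real pi * \<i> * (\<tau> - cnj \<tau>) = disc_scale"
  by (simp add: disc_scale_def complex_eq_iff)

lemma comp_cayley_deriv:
  assumes w: "norm w < 1" and D: "\<And>\<tau>. Im \<tau> > 0 \<Longrightarrow> (f has_field_derivative 2 * of_real pi * \<i> * f' \<tau>) (at \<tau>)"
  shows "((\<lambda>w. f (cayley w)) has_field_derivative disc_scale * f' (cayley w) / (1 - w) ^ 2) (at w)"
proof -
  have "((\<lambda>w. f (cayley w)) has_field_derivative 2 * of_real pi * \<i> * f' (cayley w) * ((\<tau> - cnj \<tau>) / (1 - w) ^ 2)) (at w)"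
    by (rule DERIV_chain2[OF D[OF Im_cayley[OF w]] cayley_deriv[OF w]])
  also have "2 * of_real pi * \<i> * f' (cayley w) * ((\<tau> - cnj \<tau>) / (1 - w) ^ 2) = disc_scale * f' (cayley w) / (1 - w) ^ 2"
    unfolding disc_scale_eq[symmetric] by (simp only: times_divide_eq_right mult_ac)
  finally show ?thesis .
qed

text \<open>The weight 2 series is only quasimodular. The summand 1/(1 - w) restores the shape of
  Ramanujan's first equation, and at w = 0 its value 1 equals -\<open>disc_scale\<close>/(4 pi Im
  \<tau>), which turns E_2 into E_2^* at the centre.\<close>

definition dY where "dY w = disc_scale * eis2 (cayley w) / (1 - w) ^ 2 + 1 / (1 - w)"
definition dA where "dA w = disc_scale ^ 2 * eis4 (cayley w) / (1 - w) ^ 4"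
definition dB where "dB w = disc_scale ^ 3 * eis6 (cayley w) / (1 - w) ^ 6"
definition dF where "dF w = Delta (cayley w) / (1 - w) ^ 12"

lemma disc_derivs:
  assumes w: "norm w < 1"
  shows "(dY has_field_derivative dY w * dY w - dA w) (at w)"
    "(dA has_field_derivative 4 * (dY w * dA w) - dB w) (at w)"
    "(dB has_field_derivative 6 * (dY w * dB w) - 24 * (dA w * dA w)) (at w)"
    "(dF has_field_derivative 12 * (dY w * dF w)) (at w)"
proof -
  define i where "i = 1 / (1 - w)"
  have w1: "1 - w \<noteq> 0" using w by auto
  note C = comp_cayley_deriv[OF w]
  have I: "((\<lambda>w. 1 / (1 - w) ^ n) has_field_derivative of_nat n * i ^ (n + 1)) (at w)" for n
  proof -
    have "((\<lambda>w. 1 / (1 - w)) has_field_derivative i ^ 2) (at w)"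
      using w1 by (auto intro!: derivative_eq_intros simp: i_def power2_eq_square)
    from DERIV_power[OF this, of n] show ?thesis
      by (cases n) (simp_all add: power_one_over i_def power2_eq_square mult_ac)
  qed
  have fold: "c / (1 - w) ^ n = c * i ^ n" for c n by (simp add: i_def power_one_over)
  have I1: "((\<lambda>w. 1 / (1 - w)) has_field_derivative i ^ 2) (at w)" using I[of 1] by (simp add: power2_eq_square)
  have Y: "dY w = disc_scale * eis2 (cayley w) * i ^ 2 + i" unfolding dY_def fold by (simp add: i_def)
  have A: "dA w = disc_scale ^ 2 * eis4 (cayley w) * i ^ 4" unfolding dA_def fold ..
  have B: "dB w = disc_scale ^ 3 * eis6 (cayley w) * i ^ 6" unfolding dB_def fold ..
  have F: "dF w = Delta (cayley w) * i ^ 12" unfolding dF_def fold ..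
  have M: "((\<lambda>w. c * f (cayley w) / (1 - w) ^ n) has_field_derivative
      c * (disc_scale * f' (cayley w) * i ^ (n + 2) + of_nat n * f (cayley w) * i ^ (n + 1))) (at w)"
    if "\<And>\<tau>. Im \<tau> > 0 \<Longrightarrow> (f has_field_derivative 2 * of_real pi * \<i> * f' \<tau>) (at \<tau>)" for f f' c n
  proof -
    have "((\<lambda>w. c * (f (cayley w) * (1 / (1 - w) ^ n))) has_field_derivative
      c * (disc_scale * f' (cayley w) / (1 - w) ^ 2 * (1 / (1 - w) ^ n) + (of_nat n * i ^ (n + 1)) * f (cayley w))) (at w)"
      by (intro DERIV_cmult DERIV_mult C[OF that] I)
    thus ?thesis unfolding fold by (simp add: power_add algebra_simps power2_eq_square)
  qed
  have "(dY has_field_derivative disc_scale * (disc_scale * (eis2 (cayley w) ^ 2 - eis4 (cayley w)) * i ^ (2 + 2) + of_nat 2 * eis2 (cayley w) * i ^ (2 + 1)) + i ^ 2) (at w)"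
    unfolding dY_def[abs_def] by (intro DERIV_add M I1 ramanujan)
  also have "disc_scale * (disc_scale * (eis2 (cayley w) ^ 2 - eis4 (cayley w)) * i ^ (2 + 2) + of_nat 2 * eis2 (cayley w) * i ^ (2 + 1)) + i ^ 2 = dY w * dY w - dA w"
    unfolding Y A by (simp add: algebra_simps eval_nat_numeral)
  finally show "(dY has_field_derivative dY w * dY w - dA w) (at w)" .
  have "(dA has_field_derivative disc_scale ^ 2 * (disc_scale * (4 * eis2 (cayley w) * eis4 (cayley w) - eis6 (cayley w)) * i ^ (4 + 2) + of_nat 4 * eis4 (cayley w) * i ^ (4 + 1))) (at w)"
    unfolding dA_def[abs_def] by (intro M ramanujan)
  also have "disc_scale ^ 2 * (disc_scale * (4 * eis2 (cayley w) * eis4 (cayley w) - eis6 (cayley w)) * i ^ (4 + 2) + of_nat 4 * eis4 (cayley w) * i ^ (4 + 1)) = 4 * (dY w * dA w) - dB w"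
    unfolding Y A B by (simp add: algebra_simps eval_nat_numeral)
  finally show "(dA has_field_derivative 4 * (dY w * dA w) - dB w) (at w)" .
  have "(dB has_field_derivative disc_scale ^ 3 * (disc_scale * (6 * eis2 (cayley w) * eis6 (cayley w) - 24 * eis4 (cayley w) ^ 2) * i ^ (6 + 2) + of_nat 6 * eis6 (cayley w) * i ^ (6 + 1))) (at w)"
    unfolding dB_def[abs_def] by (intro M ramanujan)
  also have "disc_scale ^ 3 * (disc_scale * (6 * eis2 (cayley w) * eis6 (cayley w) - 24 * eis4 (cayley w) ^ 2) * i ^ (6 + 2) + of_nat 6 * eis6 (cayley w) * i ^ (6 + 1)) = 6 * (dY w * dB w) - 24 * (dA w * dA w)"
    unfolding Y A B by (simp add: algebra_simps eval_nat_numeral)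
  finally show "(dB has_field_derivative 6 * (dY w * dB w) - 24 * (dA w * dA w)) (at w)" .
  have "((\<lambda>w. 1 * Delta (cayley w) / (1 - w) ^ 12) has_field_derivative 1 * (disc_scale * (12 * eis2 (cayley w) * Delta (cayley w)) * i ^ (12 + 2) + of_nat 12 * Delta (cayley w) * i ^ (12 + 1))) (at w)"
    by (intro M Delta_deriv)
  also have "1 * (disc_scale * (12 * eis2 (cayley w) * Delta (cayley w)) * i ^ (12 + 2) + of_nat 12 * Delta (cayley w) * i ^ (12 + 1)) = 12 * (dY w * dF w)"
    unfolding Y F by (simp add: algebra_simps eval_nat_numeral)
  finally show "(dF has_field_derivative 12 * (dY w * dF w)) (at w)" by (simp add: dF_def[abs_def])
qed

lemma disc_holo: "dY holomorphic_on ball 0 1" "dA holomorphic_on ball 0 1" "dB holomorphic_on ball 0 1" "dF holomorphic_on ball 0 1"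
proof -
  have hol: "f holomorphic_on ball 0 1" if "\<And>w. norm w < 1 \<Longrightarrow> (f has_field_derivative g w) (at w)"
    for f g :: "complex \<Rightarrow> complex"
    unfolding holomorphic_on_open[OF open_ball] using that by (meson mem_ball_0)
  show "dY holomorphic_on ball 0 1" "dA holomorphic_on ball 0 1" "dB holomorphic_on ball 0 1" "dF holomorphic_on ball 0 1"
    by (rule hol[OF disc_derivs(1)] hol[OF disc_derivs(2)] hol[OF disc_derivs(3)] hol[OF disc_derivs(4)]; assumption)+
qed

lemma slash_eq: "\<exists>C\<noteq>0. slash12 Delta (sigma_mat \<tau>) = (\<lambda>w. C * dF w)"
proof -
  define s where "s = 1 / (2 * \<i> * complex_of_real (Im \<tau>))"
  have s0: "s \<noteq> 0" using Im_pos by (auto simp: s_def)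
  have "sigma_mat \<tau> $ 1 $ 1 = s * - cnj \<tau>" "sigma_mat \<tau> $ 1 $ 2 = s * \<tau>"
    "sigma_mat \<tau> $ 2 $ 1 = s * - 1" "sigma_mat \<tau> $ 2 $ 2 = s * 1"
    by (simp_all add: sigma_mat_def s_def)
  hence det: "det (sigma_mat \<tau>) = s ^ 2 * (\<tau> - cnj \<tau>)"
    unfolding det_2 by (simp add: power2_eq_square algebra_simps)
  have "\<tau> - cnj \<tau> \<noteq> 0" using Im_pos by (auto simp: complex_eq_iff)
  hence C0: "det (sigma_mat \<tau>) ^ 6 / s ^ 12 \<noteq> 0" using s0 by (simp add: det)
  have "slash12 Delta (sigma_mat \<tau>) w = det (sigma_mat \<tau>) ^ 6 / s ^ 12 * dF w" for w
  proof -
    have "(s * - cnj \<tau> * w + s * \<tau>) / (s * - 1 * w + s * 1) = (s * (\<tau> - cnj \<tau> * w)) / (s * (1 - w))"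
      by (simp add: algebra_simps)
    also have "\<dots> = cayley w" using s0 by (simp add: cayley_def)
    finally have "(s * - cnj \<tau> * w + s * \<tau>) / (s * - 1 * w + s * 1) = cayley w" .
    moreover have "s * - 1 * w + s * 1 = s * (1 - w)" by (simp add: algebra_simps)
    ultimately show ?thesis
      by (simp add: slash12_def sigma_mat_def s_def [symmetric] dF_def power_mult_distrib)
  qed
  thus ?thesis using C0 by blast
qed

definition nY where "nY n = (deriv ^^ n) dY 0"
definition nA where "nA n = (deriv ^^ n) dA 0"
definition nB where "nB n = (deriv ^^ n) dB 0"
definition nF where "nF n = (deriv ^^ n) dF 0"

lemma jet_step:
  fixes f g :: "complex \<Rightarrow> complex"
  assumes "\<And>w. norm w < 1 \<Longrightarrow> (f has_field_derivative g w) (at w)"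
  shows "(deriv ^^ Suc n) f 0 = (deriv ^^ n) g 0"
proof -
  have "eventually (\<lambda>w. w \<in> ball 0 1) (nhds (0 :: complex))" by (intro eventually_nhds_in_open) auto
  hence "eventually (\<lambda>w. deriv f w = g w) (nhds 0)"
    by eventually_elim (use assms in \<open>auto intro: DERIV_imp_deriv\<close>)
  thus ?thesis unfolding funpow_Suc_right o_def by (intro higher_deriv_cong_ev) auto
qed

lemma jet_rec:
  "nY (Suc n) = binconv nY nY n - nA n"
  "nA (Suc n) = 4 * binconv nY nA n - nB n"
  "nB (Suc n) = 6 * binconv nY nB n - 24 * binconv nA nA n"
  "nF (Suc n) = 12 * binconv nY nF n"
proof -
  note H = disc_holo
  note Q = higher_deriv_quadratic
  have 0: "(0 :: complex) \<in> ball 0 1" by simp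
  have cm: "(deriv ^^ n) (\<lambda>w. c * f w) 0 = c * (deriv ^^ n) f 0" if "f holomorphic_on ball 0 1" for c f
    using higher_deriv_cmult'[of f 0 n c] that by (metis 0 analytic_on_open analytic_on_subset empty_subsetI insert_subset open_ball)
  have st: "nY (Suc n) = (deriv ^^ n) (\<lambda>w. dY w * dY w - dA w) 0"
    "nA (Suc n) = (deriv ^^ n) (\<lambda>w. 4 * (dY w * dA w) - dB w) 0"
    "nB (Suc n) = (deriv ^^ n) (\<lambda>w. 6 * (dY w * dB w) - 24 * (dA w * dA w)) 0"
    "nF (Suc n) = (deriv ^^ n) (\<lambda>w. 12 * (dY w * dF w)) 0"
    unfolding nY_def nA_def nB_def nF_def by (rule jet_step, erule disc_derivs)+
  have df: "(deriv ^^ n) (\<lambda>w. f w - g w) 0 = (deriv ^^ n) f 0 - (deriv ^^ n) g 0"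
    if "f holomorphic_on ball 0 1" "g holomorphic_on ball 0 1" for f g
    using higher_deriv_diff[OF that open_ball 0] .
  note P = holomorphic_on_mult[OF H(1) H(1)] holomorphic_on_mult[OF H(1) H(2)] holomorphic_on_mult[OF H(1) H(3)]
    holomorphic_on_mult[OF H(2) H(2)] holomorphic_on_mult[OF H(1) H(4)]
  have c: "(\<lambda>w. c * f w) holomorphic_on ball 0 1" if "f holomorphic_on ball 0 1" for c :: complex and f
    by (intro holomorphic_intros that)
  show "nY (Suc n) = binconv nY nY n - nA n"
    unfolding st df[OF P(1) H(2)] Q[OF H(1) H(1)] by (simp add: nY_def[abs_def] nA_def)
  show "nA (Suc n) = 4 * binconv nY nA n - nB n"
    unfolding st df[OF c[OF P(2)] H(3)] cm[OF P(2)] Q[OF H(1) H(2)] by (simp add: nY_def[abs_def] nA_def[abs_def] nB_def)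
  show "nB (Suc n) = 6 * binconv nY nB n - 24 * binconv nA nA n"
    unfolding st df[OF c[OF P(3)] c[OF P(4)]] cm[OF P(3)] cm[OF P(4)] Q[OF H(1) H(3)] Q[OF H(2) H(2)]
    by (simp add: nY_def[abs_def] nA_def[abs_def] nB_def[abs_def])
  show "nF (Suc n) = 12 * binconv nY nF n"
    unfolding st cm[OF P(5)] Q[OF H(1) H(4)] by (simp add: nY_def[abs_def] nF_def[abs_def])
qed

lemma fourier_coeff_jet: "\<exists>C\<noteq>0. \<forall>n. fourier_coeff \<tau> Delta n = C * nF n / fact n"
proof -
  obtain C where C: "C \<noteq> 0" "slash12 Delta (sigma_mat \<tau>) = (\<lambda>w. C * dF w)" using slash_eq by blast
  have "eventually (\<lambda>w. w \<in> ball 0 1) (nhds (0 :: complex))" by (intro eventually_nhds_in_open) auto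
  hence "eventually (\<lambda>w. (\<lambda>n. fps_nth (Abs_fps (fourier_coeff \<tau> Delta)) n * w ^ n) sums (C * dF w)) (nhds 0)"
    by eventually_elim (use sums_fourier_coeff_Delta[OF Im_pos] C(2) in auto)
  hence "(\<lambda>w. C * dF w) has_fps_expansion Abs_fps (fourier_coeff \<tau> Delta)" by (rule has_fps_expansionI)
  moreover have "dF has_fps_expansion fps_expansion dF 0"
    by (rule has_fps_expansion_fps_expansion[OF _ _ disc_holo(4)]) auto
  hence "(\<lambda>w. C * dF w) has_fps_expansion fps_const C * fps_expansion dF 0" by (intro fps_expansion_intros)
  ultimately have "Abs_fps (fourier_coeff \<tau> Delta) = fps_const C * fps_expansion dF 0"
    by (rule fps_expansion_unique_complex)
  from arg_cong[OF this, of fps_nth] have "fourier_coeff \<tau> Delta n = C * nF n / fact n" for n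
    by (simp add: fun_eq_iff fps_expansion_def nF_def)
  thus ?thesis using C(1) by blast
qed

text \<open>The n-th derivatives of y, a, b and F have degrees n+1, n+2, n+3 and n in the scale l.
  Dividing by these powers, and F also by its value at 0, keeps the recursions and leaves jets that
  start at elements of Z[s].\<close>

lemma fourier_coeff_nonzero:
  assumes good: "good_jet d p c y a b m" and p: "prime p" and s: "s ^ 2 = of_int d" and n: "n mod m = 0"
    and \<kappa>: "\<kappa> \<noteq> 0" "eis2 \<tau> - 1 / of_real (4 * pi * Im \<tau>) = \<kappa> * quad s y"
      "eis4 \<tau> = \<kappa> ^ 2 * quad s a" "eis6 \<tau> = \<kappa> ^ 3 * quad s b"
  shows "fourier_coeff \<tau> Delta n \<noteq> 0"
proof -
  define l where "l = disc_scale * \<kappa>"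
  have kk0: "disc_scale \<noteq> 0" using Im_pos by (simp add: disc_scale_def)
  have l: "l \<noteq> 0" using kk0 \<kappa>(1) by (simp add: l_def)
  have g0: "cayley 0 = \<tau>" by (simp add: cayley_def)
  have F0: "nF 0 \<noteq> 0" using Delta_nonzero[OF Im_pos] by (simp add: nF_def dF_def g0)
  \<comment> \<open>The factor e is for the normalisation of F by its value at 0; in the other three
    recursions it is 1.\<close>
  have scale: "binconv (\<lambda>n. f n / l ^ (n + i)) (\<lambda>n. g n / (l ^ (n + j) * e)) n = binconv f g n / (l ^ (n + i + j) * e)"
    for f g i j e n
  proof -
    have "l ^ (k + i) * l ^ (n - k + j) = l ^ (n + i + j)" if "k \<le> n" for k
      using that by (simp flip: power_add add: add_ac)
    hence "f k / l ^ (k + i) * (g (n - k) / (l ^ (n - k + j) * e)) = f k * g (n - k) / (l ^ (n + i + j) * e)" if "k \<le> n" for k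
      using that by (metis (no_types, lifting) mult.assoc times_divide_times_eq)
    thus ?thesis unfolding binconv_def sum_divide_distrib by (intro sum.cong) (simp_all add: mult.assoc)
  qed
  note scale1 = scale[where e = 1, unfolded mult_1_right]
  interpret jet s d "\<lambda>n. nY n / l ^ (n + 1)" "\<lambda>n. nA n / l ^ (n + 2)" "\<lambda>n. nB n / l ^ (n + 3)"
    "\<lambda>n. nF n / (l ^ (n + 0) * nF 0)"
  proof
    fix n
    show "nY (Suc n) / l ^ (Suc n + 1) = binconv (\<lambda>n. nY n / l ^ (n + 1)) (\<lambda>n. nY n / l ^ (n + 1)) n - nA n / l ^ (n + 2)"
      unfolding scale1 jet_rec by (simp add: diff_divide_distrib eval_nat_numeral)
    show "nA (Suc n) / l ^ (Suc n + 2) = 4 * binconv (\<lambda>n. nY n / l ^ (n + 1)) (\<lambda>n. nA n / l ^ (n + 2)) n - nB n / l ^ (n + 3)"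
      unfolding scale1 jet_rec by (simp add: diff_divide_distrib eval_nat_numeral)
    show "nB (Suc n) / l ^ (Suc n + 3) = 6 * binconv (\<lambda>n. nY n / l ^ (n + 1)) (\<lambda>n. nB n / l ^ (n + 3)) n -
        24 * binconv (\<lambda>n. nA n / l ^ (n + 2)) (\<lambda>n. nA n / l ^ (n + 2)) n"
      unfolding scale1 jet_rec by (simp add: diff_divide_distrib eval_nat_numeral)
    show "nF (Suc n) / (l ^ (Suc n + 0) * nF 0) = 12 * binconv (\<lambda>n. nY n / l ^ (n + 1)) (\<lambda>n. nF n / (l ^ (n + 0) * nF 0)) n"
      unfolding scale jet_rec by (simp add: mult_ac)
  qed (use s F0 in auto)
  have "disc_scale / of_real (4 * pi * Im \<tau>) = - 1" using Im_pos by (simp add: disc_scale_def)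
  hence "nY 0 = disc_scale * (eis2 \<tau> - 1 / of_real (4 * pi * Im \<tau>))"
    unfolding nY_def dY_def by (simp add: g0 right_diff_distrib)
  hence Y: "reps p y (nY 0 / l ^ (0 + 1))" using l kk0 \<kappa>(1) unfolding \<kappa>(2) by (simp add: l_def reps_def)
  have "nA 0 = l ^ 2 * quad s a" "nB 0 = l ^ 3 * quad s b"
    by (simp_all add: nA_def dA_def nB_def dB_def g0 \<kappa>(3,4) l_def power_mult_distrib)
  hence A: "reps p a (nA 0 / l ^ (0 + 2))" and B: "reps p b (nB 0 / l ^ (0 + 3))"
    using l by (simp_all add: reps_def power2_eq_square power3_eq_cube)
  have "nF n / (l ^ (n + 0) * nF 0) \<noteq> 0" by (rule F_nonzero[OF good p Y A B n])
  thus ?thesis using fourier_coeff_jet by auto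
qed

end

section \<open>The nine discriminants\<close>

lemma csqrt_neg: "d < 0 \<Longrightarrow> csqrt (of_int d) = \<i> * of_real (sqrt (- of_int d))"
  using csqrt_minus[of "of_real (- of_int d)"] by simp

lemma Im_cm_point: "D < 0 \<Longrightarrow> Im (cm_point D) > 0"
  by (simp add: cm_point_def csqrt_neg)

lemma cm_point_even: "even D \<Longrightarrow> cm_point D ^ 2 = of_int D / 4"
  by (simp add: cm_point_def power_divide)

lemma cm_point_odd: "odd D \<Longrightarrow> cm_point D ^ 2 = cm_point D - (1 - of_int D) / 4"
proof -
  have "((1 + c) / 2) ^ 2 = (1 + c) / 2 - (1 - c ^ 2) / 4" for c :: complex
    by (simp add: power2_eq_square field_simps)
  from this[of "csqrt (of_int D)"] show "odd D \<Longrightarrow> ?thesis" by (simp add: cm_point_def)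
qed

lemma cm_disc:
  assumes "D < 0" "even D \<Longrightarrow> of_int D = - 4 * (of_nat N :: complex)" "odd D \<Longrightarrow> of_int D = 1 - 4 * (of_nat N :: complex)" "N > 0"
  shows "cm_lattice (cm_point D) N (if even D then 0 else 1)" "disc (cm_point D)"
proof -
  show "disc (cm_point D)" by unfold_locales (rule Im_cm_point[OF assms(1)])
  show "cm_lattice (cm_point D) N (if even D then 0 else 1)"
  proof
    show "Im (cm_point D) > 0" by (rule Im_cm_point[OF assms(1)])
    show "cm_point D ^ 2 = of_int (if even D then 0 else 1) * cm_point D - of_nat N"
      using cm_point_even[of D] cm_point_odd[of D] assms(2,3) by auto
  qed fact
qed

lemma nonzero_3: "3 dvd n \<Longrightarrow> fourier_coeff (cm_point (-3)) Delta n \<noteq> 0"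
proof -
  assume n: "3 dvd n"
  define \<tau> where "\<tau> = cm_point (-3)"
  interpret cm_lattice \<tau> 1 1 using cm_disc(1)[of "-3" 1] by (simp add: \<tau>_def)
  interpret disc \<tau> using cm_disc(2)[of "-3" 1] by (simp add: \<tau>_def)
  define y where "y = eis2 \<tau> - 1 / of_real (4 * pi * Im \<tau>)"
  have \<tau>: "\<tau> ^ 2 = \<tau> - 1" using tau_sq by simp
  note S = sum_orbit(1)[OF refl]
  note y = sum_torsion_wp[folded y_def, unfolded S[of "\<lambda>x. x"] of_nat_numeral of_nat_1]
  note p2 = power_sums(2)[unfolded S[of "\<lambda>x. 3 * x ^ 2 - 3 * eis4 \<tau>"]]
  obtain \<kappa> where v: "\<kappa> \<noteq> 0" "y = 0" "eis4 \<tau> = 0" "eis6 \<tau> = \<kappa> ^ 3"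
    using y p2 values_3[OF \<tau> _ _ Im_pos eis4_eis6_nonzero, of y] by auto
  show ?thesis unfolding \<tau>_def[symmetric]
    \<comment> \<open>The scaled triple is rational, so s = 0 is taken, as in all cases of class
      number one.\<close>
    by (rule fourier_coeff_nonzero[OF good_jet_3, of 0 n \<kappa>])
       (use v n in \<open>simp_all add: quad_def y_def\<close>)
qed

lemma nonzero_4: "even n \<Longrightarrow> fourier_coeff (cm_point (-4)) Delta n \<noteq> 0"
proof -
  assume n: "even n"
  define \<tau> where "\<tau> = cm_point (-4)"
  interpret cm_lattice \<tau> 1 0 using cm_disc(1)[of "-4" 1] by (simp add: \<tau>_def)
  interpret disc \<tau> using cm_disc(2)[of "-4" 1] by (simp add: \<tau>_def)
  define y where "y = eis2 \<tau> - 1 / of_real (4 * pi * Im \<tau>)"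
  have \<tau>: "\<tau> ^ 2 = - 1" using tau_sq by simp
  note S = sum_orbit(1)[OF refl]
  note y = sum_torsion_wp[folded y_def, unfolded S[of "\<lambda>x. x"] of_nat_numeral of_nat_1]
  note p3 = power_sums(3)[unfolded S[of "\<lambda>x. 5 * x ^ 3 - 9 * eis4 \<tau> * x + eis6 \<tau>"]]
  obtain \<kappa> where v: "\<kappa> \<noteq> 0" "y = 0" "eis4 \<tau> = \<kappa> ^ 2" "eis6 \<tau> = 0"
    using y p3 values_4[OF \<tau> _ _ eis4_eis6_nonzero, of y] by auto
  show ?thesis unfolding \<tau>_def[symmetric]
    by (rule fourier_coeff_nonzero[OF good_jet_4, of 0 n \<kappa>])
       (use v n in \<open>simp_all add: quad_def y_def\<close>)
qed

lemma nonzero_7: "fourier_coeff (cm_point (-7)) Delta n \<noteq> 0"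
proof -
  define \<tau> where "\<tau> = cm_point (-7)"
  interpret cm_lattice \<tau> 2 1 using cm_disc(1)[of "-7" 2] by (simp add: \<tau>_def)
  interpret disc \<tau> using cm_disc(2)[of "-7" 2] by (simp add: \<tau>_def)
  define y where "y = eis2 \<tau> - 1 / of_real (4 * pi * Im \<tau>)"
  have \<tau>: "\<tau> ^ 2 = \<tau> - 2" using tau_sq by simp
  note S = sum_orbit(2)[OF refl]
  note y = sum_torsion_wp[folded y_def, unfolded S[of "\<lambda>x. x"] of_nat_numeral of_nat_1]
  note p2 = power_sums(2)[unfolded S[of "\<lambda>x. 3 * x ^ 2 - 3 * eis4 \<tau>"]]
  have "2 * 1 = (2 :: nat)" "0 < (1 :: nat)" by simp_all
  note h = half_period[OF this]
  obtain \<kappa> where v: "\<kappa> \<noteq> 0" "y = \<kappa> * 15" "eis4 \<tau> = \<kappa> ^ 2 * 2625" "eis6 \<tau> = \<kappa> ^ 3 * 661500"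
    using values_7[OF \<tau> y p2 h Im_pos eis4_eis6_nonzero] by blast
  show ?thesis unfolding \<tau>_def[symmetric]
    by (rule fourier_coeff_nonzero[OF good_jet_7, of 0 n \<kappa>])
       (use v in \<open>simp_all add: quad_def y_def\<close>)
qed

lemma nonzero_8: "fourier_coeff (cm_point (-8)) Delta n \<noteq> 0"
proof -
  define \<tau> where "\<tau> = cm_point (-8)"
  interpret cm_lattice \<tau> 2 0 using cm_disc(1)[of "-8" 2] by (simp add: \<tau>_def)
  interpret disc \<tau> using cm_disc(2)[of "-8" 2] by (simp add: \<tau>_def)
  define y where "y = eis2 \<tau> - 1 / of_real (4 * pi * Im \<tau>)"
  have \<tau>: "\<tau> ^ 2 = - 2" using tau_sq by simp
  note S = sum_orbit(2)[OF refl]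
  note y = sum_torsion_wp[folded y_def, unfolded S[of "\<lambda>x. x"] of_nat_numeral of_nat_1]
  note p2 = power_sums(2)[unfolded S[of "\<lambda>x. 3 * x ^ 2 - 3 * eis4 \<tau>"]]
  have "2 * 1 = (2 :: nat)" "0 < (1 :: nat)" by simp_all
  note h = half_period[OF this]
  obtain \<kappa> where v: "\<kappa> \<noteq> 0" "y = \<kappa> * 5" "eis4 \<tau> = \<kappa> ^ 2 * 250" "eis6 \<tau> = \<kappa> ^ 3 * 14000"
    using values_8[OF \<tau> y p2 h eis4_eis6_nonzero] by blast
  show ?thesis unfolding \<tau>_def[symmetric]
    by (rule fourier_coeff_nonzero[OF good_jet_8, of 0 n \<kappa>])
       (use v in \<open>simp_all add: quad_def y_def\<close>)
qed

lemma nonzero_11: "fourier_coeff (cm_point (-11)) Delta n \<noteq> 0"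
proof -
  define \<tau> where "\<tau> = cm_point (-11)"
  interpret cm_lattice \<tau> 3 1 using cm_disc(1)[of "-11" 3] by (simp add: \<tau>_def)
  interpret disc \<tau> using cm_disc(2)[of "-11" 3] by (simp add: \<tau>_def)
  define y where "y = eis2 \<tau> - 1 / of_real (4 * pi * Im \<tau>)"
  have \<tau>: "\<tau> ^ 2 = \<tau> - 3" using tau_sq by simp
  note S = sum_orbit(3)[OF refl]
  note y = sum_torsion_wp[folded y_def, unfolded S[of "\<lambda>x. x"] of_nat_numeral of_nat_1]
  note p2 = power_sums(2)[unfolded S[of "\<lambda>x. 3 * x ^ 2 - 3 * eis4 \<tau>"]]
  note p3 = power_sums(3)[unfolded S[of "\<lambda>x. 5 * x ^ 3 - 9 * eis4 \<tau> * x + eis6 \<tau>"]]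
  obtain \<kappa> where v: "\<kappa> \<noteq> 0" "y = \<kappa> * 8" "eis4 \<tau> = \<kappa> ^ 2 * 352" "eis6 \<tau> = \<kappa> ^ 3 * 27104"
    using values_11[OF \<tau> y p2 p3 Im_pos eis4_eis6_nonzero] by blast
  show ?thesis unfolding \<tau>_def[symmetric]
    by (rule fourier_coeff_nonzero[OF good_jet_11, of 0 n \<kappa>])
       (use v in \<open>simp_all add: quad_def y_def\<close>)
qed

lemma nonzero_15: "fourier_coeff (cm_point (-15)) Delta n \<noteq> 0"
proof -
  define \<tau> where "\<tau> = cm_point (-15)"
  interpret cm_lattice \<tau> 4 1 using cm_disc(1)[of "-15" 4] by (simp add: \<tau>_def)
  interpret disc \<tau> using cm_disc(2)[of "-15" 4] by (simp add: \<tau>_def)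
  define y where "y = eis2 \<tau> - 1 / of_real (4 * pi * Im \<tau>)"
  have \<tau>: "\<tau> ^ 2 = \<tau> - 4" using tau_sq by simp
  note S = sum_orbit(4)[OF refl]
  note y = sum_torsion_wp[folded y_def, unfolded S[of "\<lambda>x. x"] of_nat_numeral of_nat_1]
  note p2 = power_sums(2)[unfolded S[of "\<lambda>x. 3 * x ^ 2 - 3 * eis4 \<tau>"]]
  have "2 * 2 = (4 :: nat)" "0 < (2 :: nat)" by simp_all
  note h = half_period[OF this]
  \<comment> \<open>With 4 v1 in L, the points 3 v1 and -v1 agree modulo L; this makes the
    translation formula a square.\<close>
  have "torsion_wp 3 = torsion_wp 1" using torsion_wp_reflect[of 1] by (simp add: numeral_3_eq_3)
  hence tr: "(torsion_wp 1 - torsion_wp 2) ^ 2 = 3 * torsion_wp 2 ^ 2 - 3 * eis4 \<tau>"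
    using half_translate[of 2] by (simp add: power2_eq_square numeral_3_eq_3 numeral_2_eq_2)
  obtain \<kappa> s where v: "s ^ 2 = 5" "\<kappa> \<noteq> 0" "y = \<kappa> * (21 + 8 * s)" "eis4 \<tau> = \<kappa> ^ 2 * (1225 + 2080 * s)" "eis6 \<tau> = \<kappa> ^ 3 * (377300 + 640640 * s)"
    using values_15[OF \<tau> y p2 h tr Im_pos eis4_eis6_nonzero] by blast
  show ?thesis unfolding \<tau>_def[symmetric]
    by (rule fourier_coeff_nonzero[OF good_jet_15, of s n \<kappa>])
       (use v in \<open>simp_all add: quad_def y_def\<close>)
qed

lemma nonzero_19: "fourier_coeff (cm_point (-19)) Delta n \<noteq> 0"
proof -
  define \<tau> where "\<tau> = cm_point (-19)"
  interpret cm_lattice \<tau> 5 1 using cm_disc(1)[of "-19" 5] by (simp add: \<tau>_def)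
  interpret disc \<tau> using cm_disc(2)[of "-19" 5] by (simp add: \<tau>_def)
  define y where "y = eis2 \<tau> - 1 / of_real (4 * pi * Im \<tau>)"
  have \<tau>: "\<tau> ^ 2 = \<tau> - 5" using tau_sq by simp
  note S = sum_orbit(5)[OF refl]
  note y = sum_torsion_wp[folded y_def, unfolded S[of "\<lambda>x. x"] of_nat_numeral of_nat_1]
  note p2 = power_sums(2)[unfolded S[of "\<lambda>x. 3 * x ^ 2 - 3 * eis4 \<tau>"]]
  note p3 = power_sums(3)[unfolded S[of "\<lambda>x. 5 * x ^ 3 - 9 * eis4 \<tau> * x + eis6 \<tau>"]]
  note p4 = power_sums(4)[unfolded S[of "\<lambda>x. 7 * x ^ 4 - 84 / 5 * eis4 \<tau> * x ^ 2 + 2 * eis6 \<tau> * x + 9 / 5 * eis4 \<tau> ^ 2"]]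
  note p5 = power_sums(5)[unfolded S[of "\<lambda>x. 9 * x ^ 5 - 27 * eis4 \<tau> * x ^ 3 + 45 / 14 * eis6 \<tau> * x ^ 2 + 54 / 5 * eis4 \<tau> ^ 2 * x - 99 / 70 * eis4 \<tau> * eis6 \<tau>"]]
  obtain \<kappa> where v: "\<kappa> \<noteq> 0" "y = \<kappa> * 24" "eis4 \<tau> = \<kappa> ^ 2 * 1824" "eis6 \<tau> = \<kappa> ^ 3 * 311904"
    using values_19[OF \<tau> y p2 p3 p4 p5 Im_pos eis4_eis6_nonzero] by blast
  show ?thesis unfolding \<tau>_def[symmetric]
    by (rule fourier_coeff_nonzero[OF good_jet_19, of 0 n \<kappa>])
       (use v in \<open>simp_all add: quad_def y_def\<close>)
qed

lemma nonzero_20: "fourier_coeff (cm_point (-20)) Delta n \<noteq> 0"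
proof -
  define \<tau> where "\<tau> = cm_point (-20)"
  interpret cm_lattice \<tau> 5 0 using cm_disc(1)[of "-20" 5] by (simp add: \<tau>_def)
  interpret disc \<tau> using cm_disc(2)[of "-20" 5] by (simp add: \<tau>_def)
  define y where "y = eis2 \<tau> - 1 / of_real (4 * pi * Im \<tau>)"
  have \<tau>: "\<tau> ^ 2 = - 5" using tau_sq by simp
  note S = sum_orbit(5)[OF refl]
  note y = sum_torsion_wp[folded y_def, unfolded S[of "\<lambda>x. x"] of_nat_numeral of_nat_1]
  note p2 = power_sums(2)[unfolded S[of "\<lambda>x. 3 * x ^ 2 - 3 * eis4 \<tau>"]]
  note p3 = power_sums(3)[unfolded S[of "\<lambda>x. 5 * x ^ 3 - 9 * eis4 \<tau> * x + eis6 \<tau>"]]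
  note p4 = power_sums(4)[unfolded S[of "\<lambda>x. 7 * x ^ 4 - 84 / 5 * eis4 \<tau> * x ^ 2 + 2 * eis6 \<tau> * x + 9 / 5 * eis4 \<tau> ^ 2"]]
  obtain \<kappa> s where v: "s ^ 2 = 5" "\<kappa> \<noteq> 0" "y = \<kappa> * (139 + 45 * s)" "eis4 \<tau> = \<kappa> ^ 2 * (108250 + 29835 * s)" "eis6 \<tau> = \<kappa> ^ 3 * (180994000 + 49884120 * s)"
    using values_20[OF \<tau> y p2 p3 p4 eis4_eis6_nonzero] by blast
  show ?thesis unfolding \<tau>_def[symmetric]
    by (rule fourier_coeff_nonzero[OF good_jet_20, of s n \<kappa>])
       (use v in \<open>simp_all add: quad_def y_def\<close>)
qed

lemma nonzero_24: "fourier_coeff (cm_point (-24)) Delta n \<noteq> 0"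
proof -
  define \<tau> where "\<tau> = cm_point (-24)"
  interpret cm_lattice \<tau> 6 0 using cm_disc(1)[of "-24" 6] by (simp add: \<tau>_def)
  interpret disc \<tau> using cm_disc(2)[of "-24" 6] by (simp add: \<tau>_def)
  define y where "y = eis2 \<tau> - 1 / of_real (4 * pi * Im \<tau>)"
  have \<tau>: "\<tau> ^ 2 = - 6" using tau_sq by simp
  note S = sum_orbit(6)[OF refl]
  note y = sum_torsion_wp[folded y_def, unfolded S[of "\<lambda>x. x"] of_nat_numeral of_nat_1]
  note p2 = power_sums(2)[unfolded S[of "\<lambda>x. 3 * x ^ 2 - 3 * eis4 \<tau>"]]
  note p3 = power_sums(3)[unfolded S[of "\<lambda>x. 5 * x ^ 3 - 9 * eis4 \<tau> * x + eis6 \<tau>"]]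
  note p4 = power_sums(4)[unfolded S[of "\<lambda>x. 7 * x ^ 4 - 84 / 5 * eis4 \<tau> * x ^ 2 + 2 * eis6 \<tau> * x + 9 / 5 * eis4 \<tau> ^ 2"]]
  have "2 * 3 = (6 :: nat)" "0 < (3 :: nat)" by simp_all
  note h = half_period[OF this]
  \<comment> \<open>With 6 v1 in L, the points 4 v1 and -2 v1 agree modulo L.\<close>
  have "torsion_wp 4 = torsion_wp 2" using torsion_wp_reflect[of 2] by (simp add: eval_nat_numeral)
  hence tr: "(torsion_wp 1 - torsion_wp 3) * (torsion_wp 2 - torsion_wp 3) = 3 * torsion_wp 3 ^ 2 - 3 * eis4 \<tau>"
    using half_translate[of 3] by (simp add: eval_nat_numeral)
  obtain \<kappa> s where v: "s ^ 2 = 2" "\<kappa> \<noteq> 0" "y = \<kappa> * (21 + 5 * s)" "eis4 \<tau> = \<kappa> ^ 2 * (3514 - 988 * s)" "eis6 \<tau> = \<kappa> ^ 3 * (646576 - 181792 * s)"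
    using values_24[OF \<tau> y p2 p3 p4 h tr eis4_eis6_nonzero] by blast
  show ?thesis unfolding \<tau>_def[symmetric]
    by (rule fourier_coeff_nonzero[OF good_jet_24, of s n \<kappa>])
       (use v in \<open>simp_all add: quad_def y_def\<close>)
qed

theorem theorem1p3:
  fixes D :: int and n :: nat
  assumes "D \<in> {-3, -4, -7, -8, -11, -15, -19, -20, -24}"
    and "D = -4 \<Longrightarrow> even n"
    and "D = -3 \<Longrightarrow> 3 dvd n"
  shows "fourier_coeff (cm_point D) Delta n \<noteq> 0"
  using assms
  by (auto simp: nonzero_3 nonzero_4 nonzero_7 nonzero_8 nonzero_11 nonzero_15 nonzero_19 nonzero_20 nonzero_24)

end
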